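(* Let $1\le n\le 3$. If $(u_0,u_1)\in (L^{1,1}(\mathbf{R}^n)\cap Y^{2})\times (L^{1,1}(\mathbf{R}^n)\cap Y^{1})$ and $P_0+P_1\neq 0$, then there exist constants $C_1,C_2>0$ independent of $t$ such that the solution $u$ of $u_{tt}+Lu+(I+L)^{-1}u_t=0$, $u(0,\cdot)=u_0$, $u_t(0,\cdot)=u_1$, satisfies $$C_1|P_0+P_1|\,t^{-\frac n4}\le \|u(t,\cdot)\|_{L^2(\mathbf{R}^n)}\le C_2 I_{0,1}\,t^{-\frac n4}$$ for all sufficiently large $t$.
   Context: The Fourier transform is $\hat f(\xi)=\int_{\mathbf{R}^n}e^{-ix\cdot\xi}f(x)\,dx$ (extended to $L^2(\mathbf{R}^n)$). The operator $L$ on $L^2(\mathbf{R}^n)$ is the Fourier multiplier $\widehat{Lf}(\xi)=\log(1+|\xi|^2)\hat f(\xi)$ with its maximal domain. For $\delta\ge 0$, $Y^\delta=\{f\in L^2(\mathbf{R}^n):\int_{\mathbf{R}^n}(1+\log(1+|\xi|^2))^\delta|\hat f(\xi)|^2d\xi<\infty\}$, with norm $\|f\|_{Y^\delta}=\big(\int_{\mathbf{R}^n}(1+\log(1+|\xi|^2))^\delta|\hat f(\xi)|^2d\xi\big)^{1/2}$. $L^{1,1}(\mathbf{R}^n)=\{f\in L^1(\mathbf{R}^n):\|f\|_{1,1}:=\int_{\mathbf{R}^n}(1+|x|)|f(x)|dx<\infty\}$. Cauchy problem: $u_{tt}+Lu+(I+L)^{-1}u_t=0$ on $(0,\infty)\times\mathbf{R}^n$,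 $u(0,\cdot)=u_0$, $u_t(0,\cdot)=u_1$. For $(u_0,u_1)\in Y^2\times Y^1$ the solution is the unique weak solution $u\in C([0,\infty),Y^2)\cap C^1([0,\infty),Y^1)\cap C^2([0,\infty),L^2(\mathbf{R}^n))$; for a.e. $\xi$, $\hat u(t,\xi)$ solves $\hat u_{tt}+\log(1+|\xi|^2)\hat u+(1+\log(1+|\xi|^2))^{-1}\hat u_t=0$ with $\hat u(0,\xi)=\hat u_0(\xi)$, $\hat u_t(0,\xi)=\hat u_1(\xi)$. Notation: $I_{0,l}:=\sqrt{\|u_0\|_{1,1}^2+\|u_1\|_{1,1}^2+\|u_0\|_{Y^{l+1}}^2+\|u_1\|_{Y^l}^2}$ (here with $l=1$) and $P_j:=\int_{\mathbf{R}^n}u_j(x)\,dx$ ($j=0,1$). *)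

theory Defs
  imports "HOL-Analysis.Analysis"
begin

section \<open>Square-integrable functions and the Fourier transform\<close>

text \<open>
  Elements of the function spaces are Borel representatives \<open>\<real>\<^sup>n \<Rightarrow> \<complex>\<close>; identities between them
  are meant almost everywhere. The dimension is \<open>n = CARD('n)\<close>.
\<close>

definition L2 :: "(real^'n \<Rightarrow> complex) set" where
  "L2 = {f \<in> borel_measurable lborel. integrable lborel (\<lambda>x. (norm (f x))\<^sup>2)}"

definition norm_L2 :: "(real^'n \<Rightarrow> complex) \<Rightarrow> real" where
  "norm_L2 f = sqrt (\<integral>x. (norm (f x))\<^sup>2 \<partial>lborel)"

definition fourier_L1 :: "(real^'n \<Rightarrow> complex) \<Rightarrow> real^'n \<Rightarrow> complex" where
  "fourier_L1 f \<xi> = (\<integral>x. exp (- (\<i> * complex_of_real (x \<bullet> \<xi>))) * f x \<partial>lborel)"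

text \<open>
  The extension to \<open>L\<^sup>2\<close> is the closure in \<open>L\<^sup>2 \<times> L\<^sup>2\<close> of the graph of the integral transform on
  \<open>L\<^sup>1 \<inter> L\<^sup>2\<close>; by Plancherel's theorem it is the graph of an everywhere defined operator. The condition
  \<open>fourier_L1 (\<phi> k) \<in> L2\<close>, automatic by Plancherel, prevents \<^const>\<open>norm_L2\<close> from taking its
  default value 0 on a non-integrable argument.
\<close>

definition is_fourier :: "(real^'n \<Rightarrow> complex) \<Rightarrow> (real^'n \<Rightarrow> complex) \<Rightarrow> bool" where
  "is_fourier f g \<longleftrightarrow> f \<in> L2 \<and> g \<in> L2 \<and>
     (\<exists>\<phi> :: nat \<Rightarrow> real^'n \<Rightarrow> complex.
        (\<forall>k. \<phi> k \<in> L2 \<and> integrable lborel (\<phi> k) \<and> fourier_L1 (\<phi> k) \<in> L2) \<and>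
        (\<lambda>k. norm_L2 (\<lambda>x. \<phi> k x - f x)) \<longlonglongrightarrow> 0 \<and>
        (\<lambda>k. norm_L2 (\<lambda>\<xi>. fourier_L1 (\<phi> k) \<xi> - g \<xi>)) \<longlonglongrightarrow> 0)"

definition fourier :: "(real^'n \<Rightarrow> complex) \<Rightarrow> real^'n \<Rightarrow> complex" where
  "fourier f = (SOME g. is_fourier f g)"


section \<open>The spaces \<open>Y\<^sup>\<delta>\<close> and \<open>L\<^sup>1\<^sup>,\<^sup>1\<close>\<close>

definition log_symbol :: "real^'n \<Rightarrow> real" where
  "log_symbol \<xi> = ln (1 + (norm \<xi>)\<^sup>2)"

definition Y :: "real \<Rightarrow> (real^'n \<Rightarrow> complex) set" where
  "Y \<delta> = {f \<in> L2. integrable lborel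
             (\<lambda>\<xi>. (1 + log_symbol \<xi>) powr \<delta> * (norm (fourier f \<xi>))\<^sup>2)}"

definition norm_Y :: "real \<Rightarrow> (real^'n \<Rightarrow> complex) \<Rightarrow> real" where
  "norm_Y \<delta> f = sqrt (\<integral>\<xi>. (1 + log_symbol \<xi>) powr \<delta> * (norm (fourier f \<xi>))\<^sup>2 \<partial>lborel)"

definition L11 :: "(real^'n \<Rightarrow> complex) set" where
  "L11 = {f. integrable lborel f \<and> integrable lborel (\<lambda>x. (1 + norm x) * norm (f x))}"

definition norm_L11 :: "(real^'n \<Rightarrow> complex) \<Rightarrow> real" where
  "norm_L11 f = (\<integral>x. (1 + norm x) * norm (f x) \<partial>lborel)"

definition I0 :: "real \<Rightarrow> (real^'n \<Rightarrow> complex) \<Rightarrow> (real^'n \<Rightarrow> complex) \<Rightarrow> real" where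
  "I0 l u0 u1 = sqrt ((norm_L11 u0)\<^sup>2 + (norm_L11 u1)\<^sup>2
                      + (norm_Y (l + 1) u0)\<^sup>2 + (norm_Y l u1)\<^sup>2)"

definition mean :: "(real^'n \<Rightarrow> complex) \<Rightarrow> complex" where
  "mean f = (\<integral>x. f x \<partial>lborel)"


section \<open>The operator \<open>L\<close> and the Cauchy problem\<close>

text \<open>
  The unbounded operator \<open>L\<close> is given by its graph: \<open>L_graph f g\<close> says that \<open>f\<close> is in the maximal
  domain of \<open>L\<close> and \<open>L f = g\<close>. Likewise \<open>resolvent_graph f g\<close> says \<open>(I + L)\<^sup>-\<^sup>1 f = g\<close>.
\<close>

definition L_graph :: "(real^'n \<Rightarrow> complex) \<Rightarrow> (real^'n \<Rightarrow> complex) \<Rightarrow> bool" where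
  "L_graph f g \<longleftrightarrow> f \<in> L2 \<and> g \<in> L2 \<and>
     (AE \<xi> in lborel. fourier g \<xi> = complex_of_real (log_symbol \<xi>) * fourier f \<xi>)"

definition resolvent_graph :: "(real^'n \<Rightarrow> complex) \<Rightarrow> (real^'n \<Rightarrow> complex) \<Rightarrow> bool" where
  "resolvent_graph f g \<longleftrightarrow> f \<in> L2 \<and>
     (\<exists>h. L_graph g h \<and> (AE x in lborel. g x + h x = f x))"

text \<open>
  Curves \<open>[0,\<infinity>) \<rightarrow> X\<close> for a function space \<open>X\<close> with norm \<open>N\<close>. Time derivatives are taken in the norm
  of \<open>X\<close>, one-sided at \<open>t = 0\<close>. Values at negative times are irrelevant.
\<close>

definition continuous_curve ::
    "(real^'n \<Rightarrow> complex) set \<Rightarrow> ((real^'n \<Rightarrow> complex) \<Rightarrow> real) \<Rightarrow> (real \<Rightarrow> real^'n \<Rightarrow> complex) \<Rightarrow> bool"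
  where
  "continuous_curve X N u \<longleftrightarrow> (\<forall>t\<ge>0. u t \<in> X) \<and>
     (\<forall>t\<ge>0. ((\<lambda>s. N (\<lambda>x. u s x - u t x)) \<longlongrightarrow> 0) (at t within {0..}))"

definition curve_derivative ::
    "(real^'n \<Rightarrow> complex) set \<Rightarrow> ((real^'n \<Rightarrow> complex) \<Rightarrow> real) \<Rightarrow>
     (real \<Rightarrow> real^'n \<Rightarrow> complex) \<Rightarrow> (real \<Rightarrow> real^'n \<Rightarrow> complex) \<Rightarrow> bool"
  where
  "curve_derivative X N u v \<longleftrightarrow> (\<forall>t\<ge>0. u t \<in> X \<and> v t \<in> X) \<and>
     (\<forall>t\<ge>0. ((\<lambda>s. N (\<lambda>x. (u s x - u t x) /\<^sub>R (s - t) - v t x)) \<longlongrightarrow> 0) (at t within {0..}))"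

text \<open>
  Solutions in \<open>C([0,\<infinity>),Y\<^sup>2) \<inter> C\<^sup>1([0,\<infinity>),Y\<^sup>1) \<inter> C\<^sup>2([0,\<infinity>),L\<^sup>2)\<close>. In this class all three terms of the
  equation are continuous \<open>L\<^sup>2\<close>-valued curves, so the equation is stated as an identity in \<open>L\<^sup>2\<close> for
  every \<open>t > 0\<close>.
\<close>

definition is_solution ::
    "(real^'n \<Rightarrow> complex) \<Rightarrow> (real^'n \<Rightarrow> complex) \<Rightarrow> (real \<Rightarrow> real^'n \<Rightarrow> complex) \<Rightarrow> bool"
  where
  "is_solution u0 u1 u \<longleftrightarrow>
     (\<exists>ut utt :: real \<Rightarrow> real^'n \<Rightarrow> complex.
        continuous_curve (Y 2) (norm_Y 2) u \<and>
        curve_derivative (Y 1) (norm_Y 1) u ut \<and> continuous_curve (Y 1) (norm_Y 1) ut \<and>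
        curve_derivative L2 norm_L2 ut utt \<and> continuous_curve L2 norm_L2 utt \<and>
        (\<forall>t>0. \<exists>v w. L_graph (u t) v \<and> resolvent_graph (ut t) w \<and>
           (AE x in lborel. utt t x + v x + w x = 0)) \<and>
        (AE x in lborel. u 0 x = u0 x) \<and>
        (AE x in lborel. ut 0 x = u1 x))"

end

(*
  On the Fourier side the equation is, for each frequency, a damped oscillator with a = log(1+|xi|^2)
  and damping 1/(1+a), whose characteristic roots l, m have sum -1/(1+a) and product a. For fixed xi
  the combinations u_t - m u and u_t - l u solve first-order equations. The same holds for the
  L^2-valued curve, on bounded frequency sets, because the L^2 distance between e^{-lt}(u_t - m u)
  and its initial value has zero derivative; this gives u^ explicitly for almost every xi.

  For a <= 1/10 the roots are real, l lies in [-2a, -a], and m tends to -1 as a -> 0. Hence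
  |u^(t)| <= C e^{-at} there, and the Gaussian integral of e^{-t|xi|^2} gives the rate t^{-n/4}. On
  |xi| <= t^{-1/2}, |u^(t)| is eventually at least a multiple of |P_0 + P_1|, and the volume of this
  ball gives the lower bound. For a >= 1/10 the decay is only e^{-ct/(1+a)} <= C (1+a)/t, so the extra
  powers of 1+a in the norms of Y^2 and Y^1 are traded for a factor 1/t, which is at most t^{-n/4}
  as n <= 4. Norms are transferred by Plancherel's theorem, proved here by Gaussian damping.
*)
theory Submission
  imports Defs "HOL-Probability.Characteristic_Functions" "HOL-Real_Asymp.Real_Asymp"
begin

section \<open>Square-integrable functions\<close>

text \<open>At low frequencies the data enter through the coefficient u1^ - m u0^ of the slow mode.
  The transforms are continuous with values P_0 and P_1 at the origin and m tends to -1, so this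
  coefficient tends to P_0 + P_1; hence the sum in the statement. Two obstacles shape the rest.
  First, the curves are differentiable only in norm, so no differential equation is available at a
  fixed frequency, and the roots grow like sqrt a; hence the detour through bounded multipliers on
  balls that exhaust the space. Second, the roots coincide at one value of a, between 1/10 and 1.
  Near it the division by l - m is controlled by the mean value inequality, at the cost of a factor
  t that a second power of 1/t from the exponential repays. The threshold 1/10 is a convenient value
  below this double root. Since \<open>fourier\<close> selects a representative by choice,
  identities for it are claimed only almost everywhere.\<close>

lemma L2_measurable: "f \<in> L2 \<Longrightarrow> f \<in> borel_measurable lborel"
  by (simp add: L2_def)

lemma L2_integrable: "f \<in> L2 \<Longrightarrow> integrable lborel (\<lambda>x. (norm (f x))\<^sup>2)"
  by (simp add: L2_def)

lemma L2I:
  "f \<in> borel_measurable lborel \<Longrightarrow> integrable lborel (\<lambda>x. (norm (f x))\<^sup>2) \<Longrightarrow> f \<in> L2"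
  by (simp add: L2_def)

lemma L2_dominated:
  fixes f g :: "real^'n \<Rightarrow> complex"
  assumes "g \<in> L2" and [measurable]: "f \<in> borel_measurable lborel"
    and le: "AE x in lborel. norm (f x) \<le> C * norm (g x)"
  shows "f \<in> L2"
proof (rule L2I)
  show "integrable lborel (\<lambda>x. (norm (f x))\<^sup>2)"
  proof (rule Bochner_Integration.integrable_bound)
    show "integrable lborel (\<lambda>x. C\<^sup>2 * (norm (g x))\<^sup>2)"
      using L2_integrable[OF assms(1)] by simp
    show "AE x in lborel. norm ((norm (f x))\<^sup>2) \<le> norm (C\<^sup>2 * (norm (g x))\<^sup>2)"
      using le
    proof eventually_elim
      case (elim x)
      have "(norm (f x))\<^sup>2 \<le> (C * norm (g x))\<^sup>2" using elim by (intro power_mono) auto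
      then show ?case by (simp add: power_mult_distrib)
    qed
  qed simp
qed simp

lemma norm_add_squared_le: "(norm (a + b :: 'a::real_normed_vector))\<^sup>2 \<le> 2 * (norm a)\<^sup>2 + 2 * (norm b)\<^sup>2"
proof -
  have "(norm (a + b))\<^sup>2 \<le> (norm a + norm b)\<^sup>2"
    by (intro power_mono norm_triangle_ineq) auto
  also have "\<dots> \<le> 2 * (norm a)\<^sup>2 + 2 * (norm b)\<^sup>2"
    using zero_le_power2[of "norm a - norm b"] by (simp add: power2_sum power2_diff)
  finally show ?thesis .
qed

lemma L2_add:
  fixes f g :: "real^'n \<Rightarrow> complex"
  assumes "f \<in> L2" "g \<in> L2" shows "(\<lambda>x. f x + g x) \<in> L2"
proof (rule L2I)
  note [measurable] = L2_measurable[OF assms(1)] L2_measurable[OF assms(2)]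
  show "(\<lambda>x. f x + g x) \<in> borel_measurable lborel" by measurable
  show "integrable lborel (\<lambda>x. (norm (f x + g x))\<^sup>2)"
  proof (rule Bochner_Integration.integrable_bound)
    show "integrable lborel (\<lambda>x. 2 * (norm (f x))\<^sup>2 + 2 * (norm (g x))\<^sup>2)"
      using L2_integrable[OF assms(1)] L2_integrable[OF assms(2)] by simp
  qed (use norm_add_squared_le in auto)
qed

lemma L2_mult_bounded:
  fixes f :: "real^'n \<Rightarrow> complex"
  assumes "f \<in> L2" and [measurable]: "m \<in> borel_measurable lborel" and "\<And>x. norm (m x) \<le> C"
  shows "(\<lambda>x. m x * f x) \<in> L2"
  using L2_measurable[OF assms(1)] assms(3)
  by (intro L2_dominated[OF assms(1), of _ C]) (auto simp: norm_mult mult_right_mono)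

lemma L2_mult: "f \<in> L2 \<Longrightarrow> (\<lambda>x. c * f x) \<in> L2"
  using L2_mult_bounded[of f "\<lambda>_. c" "norm c"] by simp

lemma L2_diff: "f \<in> L2 \<Longrightarrow> g \<in> L2 \<Longrightarrow> (\<lambda>x. f x - g x) \<in> L2"
  using L2_add[of f "\<lambda>x. -1 * g x"] L2_mult[of g "-1"] by simp

lemma L2_zero: "(\<lambda>x. 0) \<in> L2" by (simp add: L2_def)

lemma norm_L2_nonneg: "0 \<le> norm_L2 f"
  by (simp add: norm_L2_def)

lemma norm_L2_squared: "(norm_L2 f)\<^sup>2 = (\<integral>x. (norm (f x))\<^sup>2 \<partial>lborel)"
  by (simp add: norm_L2_def)

lemma norm_L2_zero [simp]: "norm_L2 (\<lambda>x. 0) = 0" by (simp add: norm_L2_def)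

lemma norm_L2_cong_AE:
  fixes f g :: "real^'n \<Rightarrow> complex"
  assumes "f \<in> borel_measurable lborel" "g \<in> borel_measurable lborel" "AE x in lborel. f x = g x"
  shows "norm_L2 f = norm_L2 g"
  unfolding norm_L2_def using assms by (intro arg_cong[where f=sqrt] integral_cong_AE) auto

lemma norm_L2_mult: "norm_L2 (\<lambda>x. c * f x) = norm c * norm_L2 f"
  by (simp add: norm_L2_def norm_mult power_mult_distrib real_sqrt_mult)

lemma norm_L2_mono_mult:
  fixes f g :: "real^'n \<Rightarrow> complex"
  assumes g: "g \<in> L2" and f: "f \<in> borel_measurable lborel"
    and le: "AE x in lborel. norm (f x) \<le> C * norm (g x)" and C: "0 \<le> C"
  shows "norm_L2 f \<le> C * norm_L2 g"
proof -
  have "(\<integral>x. (norm (f x))\<^sup>2 \<partial>lborel) \<le> (\<integral>x. C\<^sup>2 * (norm (g x))\<^sup>2 \<partial>lborel)"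
  proof (rule integral_mono_AE)
    show "integrable lborel (\<lambda>x. (norm (f x))\<^sup>2)"
      using L2_dominated[OF g f le] by (rule L2_integrable)
    show "integrable lborel (\<lambda>x. C\<^sup>2 * (norm (g x))\<^sup>2)" using L2_integrable[OF g] by simp
    show "AE x in lborel. (norm (f x))\<^sup>2 \<le> C\<^sup>2 * (norm (g x))\<^sup>2"
      using le
    proof eventually_elim
      case (elim x)
      have "(norm (f x))\<^sup>2 \<le> (C * norm (g x))\<^sup>2" using elim by (intro power_mono) auto
      then show ?case by (simp add: power_mult_distrib)
    qed
  qed
  then have "norm_L2 f \<le> sqrt (C\<^sup>2 * (\<integral>x. (norm (g x))\<^sup>2 \<partial>lborel))"
    by (simp add: norm_L2_def)
  then show ?thesis using C by (simp add: norm_L2_def real_sqrt_mult)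
qed

lemma norm_L2_eq_0:
  fixes f :: "real^'n \<Rightarrow> complex"
  assumes "f \<in> L2" shows "norm_L2 f = 0 \<longleftrightarrow> (AE x in lborel. f x = 0)"
  using integral_nonneg_eq_0_iff_AE[OF L2_integrable[OF assms]] by (simp add: norm_L2_def)

text \<open>The weights make the right-hand side integrate to \<open>(\<alpha> + \<beta>)\<^sup>2\<close> when \<open>\<alpha>\<close>, \<open>\<beta>\<close> are the two norms.\<close>

lemma norm_add_squared_weighted:
  fixes a b :: "'a::real_normed_vector"
  assumes "\<alpha> > 0" "\<beta> > 0"
  shows "(norm (a + b))\<^sup>2 \<le> (1 + \<beta> / \<alpha>) * (norm a)\<^sup>2 + (1 + \<alpha> / \<beta>) * (norm b)\<^sup>2"
proof -
  have "2 * norm a * norm b \<le> \<beta> / \<alpha> * (norm a)\<^sup>2 + \<alpha> / \<beta> * (norm b)\<^sup>2"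
  proof -
    have "0 \<le> (\<beta> * norm a - \<alpha> * norm b)\<^sup>2 / (\<alpha> * \<beta>)" using assms by simp
    also have "\<dots> = \<beta> / \<alpha> * (norm a)\<^sup>2 + \<alpha> / \<beta> * (norm b)\<^sup>2 - 2 * norm a * norm b"
      using assms by (simp add: field_simps power2_eq_square)
    finally show ?thesis by simp
  qed
  moreover have "(norm (a + b))\<^sup>2 \<le> (norm a + norm b)\<^sup>2"
    by (intro power_mono norm_triangle_ineq) auto
  ultimately show ?thesis by (simp add: power2_sum algebra_simps)
qed

lemma norm_L2_triangle:
  fixes f g :: "real^'n \<Rightarrow> complex"
  assumes f: "f \<in> L2" and g: "g \<in> L2"
  shows "norm_L2 (\<lambda>x. f x + g x) \<le> norm_L2 f + norm_L2 g"
\<comment> \<open>The weights \<beta> / \<alpha> and \<alpha> / \<beta> divide by both norms, so a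
  vanishing norm is treated separately, through equality almost everywhere.\<close>
proof (cases "norm_L2 f = 0 \<or> norm_L2 g = 0")
  case True
  note [measurable] = L2_measurable[OF f] L2_measurable[OF g]
  show ?thesis
  proof (cases "norm_L2 f = 0")
    case True
    then have "AE x in lborel. f x = 0" using norm_L2_eq_0[OF f] by simp
    then have "norm_L2 (\<lambda>x. f x + g x) = norm_L2 g" by (intro norm_L2_cong_AE) auto
    then show ?thesis using True by simp
  next
    case False
    then have z: "norm_L2 g = 0" using True by simp
    then have "AE x in lborel. g x = 0" using norm_L2_eq_0[OF g] by simp
    then have "norm_L2 (\<lambda>x. f x + g x) = norm_L2 f" by (intro norm_L2_cong_AE) auto
    then show ?thesis using z by simp
  qed
next
  case False
  define \<alpha> \<beta> where "\<alpha> = norm_L2 f" and "\<beta> = norm_L2 g"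
  have pos: "\<alpha> > 0" "\<beta> > 0"
    using False norm_L2_nonneg[of f] norm_L2_nonneg[of g] by (auto simp: \<alpha>_def \<beta>_def)
  have "(norm_L2 (\<lambda>x. f x + g x))\<^sup>2
      \<le> (\<integral>x. (1 + \<beta> / \<alpha>) * (norm (f x))\<^sup>2 + (1 + \<alpha> / \<beta>) * (norm (g x))\<^sup>2 \<partial>lborel)"
    unfolding norm_L2_squared using L2_integrable[OF f] L2_integrable[OF g] L2_integrable[OF L2_add[OF f g]]
    by (intro integral_mono norm_add_squared_weighted pos) auto
  also have "\<dots> = (1 + \<beta> / \<alpha>) * \<alpha>\<^sup>2 + (1 + \<alpha> / \<beta>) * \<beta>\<^sup>2"
    using L2_integrable[OF f] L2_integrable[OF g] by (simp add: \<alpha>_def \<beta>_def norm_L2_squared)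
  also have "\<dots> = (\<alpha> + \<beta>)\<^sup>2"
  proof -
    have "\<beta> / \<alpha> * \<alpha>\<^sup>2 = \<alpha> * \<beta>" "\<alpha> / \<beta> * \<beta>\<^sup>2 = \<alpha> * \<beta>"
      using pos by (simp_all add: power2_eq_square)
    then show ?thesis by (simp add: distrib_right power2_sum)
  qed
  finally show ?thesis
    unfolding \<alpha>_def \<beta>_def by (rule power2_le_imp_le) (simp add: norm_L2_nonneg)
qed

lemma norm_L2_triangle_diff:
  assumes "f \<in> L2" "g \<in> L2" "h \<in> L2"
  shows "norm_L2 (\<lambda>x. f x - h x) \<le> norm_L2 (\<lambda>x. f x - g x) + norm_L2 (\<lambda>x. g x - h x)"
  using norm_L2_triangle[OF L2_diff[OF assms(1,2)] L2_diff[OF assms(2,3)]] by simp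

lemma norm_L2_commute: "norm_L2 (\<lambda>x. f x - g x) = norm_L2 (\<lambda>x. g x - f x)"
  by (simp add: norm_L2_def norm_minus_commute)

lemma norm_L2_triangle_abs:
  assumes "f \<in> L2" "g \<in> L2"
  shows "\<bar>norm_L2 f - norm_L2 g\<bar> \<le> norm_L2 (\<lambda>x. f x - g x)"
  using norm_L2_triangle[OF L2_diff[OF assms] assms(2)]
    norm_L2_triangle[OF L2_diff[OF assms(2,1)] assms(1)] norm_L2_commute[of f g] by simp

lemma norm_L2_tendsto:
  assumes "\<And>k. \<phi> k \<in> L2" "f \<in> L2" "(\<lambda>k. norm_L2 (\<lambda>x. \<phi> k x - f x)) \<longlonglongrightarrow> 0"
  shows "(\<lambda>k. norm_L2 (\<phi> k)) \<longlonglongrightarrow> norm_L2 f"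
proof -
  have "(\<lambda>k. norm_L2 (\<phi> k) - norm_L2 f) \<longlonglongrightarrow> 0"
    using norm_L2_triangle_abs[OF assms(1,2)]
    by (intro Lim_null_comparison[OF _ assms(3)]) auto
  then show ?thesis using LIM_zero_iff by blast
qed

text \<open>Fatou's lemma for the squares. Membership in \<open>L2\<close> must be part of the
  conclusion, because \<open>norm_L2\<close> takes the value 0 when the square is not integrable.
  The bounds may vary with k, since in Plancherel's theorem they are the norms of the
  approximations.\<close>

lemma L2_liminf_bound:
  fixes f :: "real^'n \<Rightarrow> complex"
  assumes [measurable]: "f \<in> borel_measurable lborel" and g: "\<And>k. g k \<in> L2"
    and lim: "AE x in lborel. (\<lambda>k. g k x) \<longlonglongrightarrow> f x"
    and bound: "\<And>k. norm_L2 (g k) \<le> B k" and B: "B \<longlonglongrightarrow> C"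
  shows "f \<in> L2" "norm_L2 f \<le> C"
proof -
  note [measurable] = L2_measurable[OF g]
  have B0: "0 \<le> B k" for k using norm_L2_nonneg[of "g k"] bound[of k] by linarith
  have C0: "0 \<le> C" using B by (rule LIMSEQ_le_const) (use B0 in auto)
  have "(\<integral>\<^sup>+x. ennreal ((norm (f x))\<^sup>2) \<partial>lborel)
     = (\<integral>\<^sup>+x. liminf (\<lambda>k. ennreal ((norm (g k x))\<^sup>2)) \<partial>lborel)"
  proof (rule nn_integral_cong_AE)
    show "AE x in lborel. ennreal ((norm (f x))\<^sup>2) = liminf (\<lambda>k. ennreal ((norm (g k x))\<^sup>2))"
      using lim
    proof eventually_elim
      case (elim x)
      then have "(\<lambda>k. ennreal ((norm (g k x))\<^sup>2)) \<longlonglongrightarrow> ennreal ((norm (f x))\<^sup>2)"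
        by (intro tendsto_ennrealI tendsto_intros)
      then show ?case using lim_imp_Liminf trivial_limit_sequentially by metis
    qed
  qed
  also have "\<dots> \<le> liminf (\<lambda>k. \<integral>\<^sup>+x. ennreal ((norm (g k x))\<^sup>2) \<partial>lborel)"
    by (intro nn_integral_liminf) auto
  also have "\<dots> = liminf (\<lambda>k. ennreal ((norm_L2 (g k))\<^sup>2))"
    using nn_integral_eq_integral[OF L2_integrable[OF g]] by (simp add: norm_L2_squared)
  also have "\<dots> \<le> liminf (\<lambda>k. ennreal ((B k)\<^sup>2))"
    by (intro Liminf_mono always_eventually) (auto intro!: ennreal_leI power_mono bound norm_L2_nonneg)
  also have "\<dots> = ennreal (C\<^sup>2)"
    by (intro lim_imp_Liminf tendsto_ennrealI tendsto_intros B) auto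
  finally have *: "(\<integral>\<^sup>+x. ennreal ((norm (f x))\<^sup>2) \<partial>lborel) \<le> ennreal (C\<^sup>2)" .
  then have int: "integrable lborel (\<lambda>x. (norm (f x))\<^sup>2)"
    by (intro integrableI_nonneg) (auto simp: less_top[symmetric] top_unique)
  then show "f \<in> L2" by (intro L2I) auto
  have "(norm_L2 f)\<^sup>2 \<le> C\<^sup>2"
    using * nn_integral_eq_integral[OF int] by (simp add: norm_L2_squared)
  then show "norm_L2 f \<le> C" using C0 by (rule power2_le_imp_le)
qed

section \<open>Completeness of L^2\<close>

lemma L2_AE_convergent:
  fixes g :: "nat \<Rightarrow> real^'n \<Rightarrow> complex"
  assumes g: "\<And>k. g k \<in> L2"
    and fast: "\<And>k. (norm_L2 (\<lambda>x. g (Suc k) x - g k x))\<^sup>2 \<le> (1/4) ^ k"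
  shows "AE x in lborel. convergent (\<lambda>k. g k x)"
proof -
  note [measurable] = L2_measurable[OF g]
  \<comment> \<open>The weight 2^k still leaves integrals of at most 2^-k, so the sum of the
    \<open>d k\<close> is finite almost everywhere. It is also large enough for 2 y \<le> 2^-k + 2^k
    y^2 to turn this into absolute summability of the increments.\<close>
  define d where "d k x = 2 ^ k * (norm (g (Suc k) x - g k x))\<^sup>2" for k x
  have [measurable]: "d k \<in> borel_measurable lborel" for k unfolding d_def by measurable
  have dint: "(\<integral>\<^sup>+x. ennreal (d k x) \<partial>lborel) \<le> ennreal ((1/2)^k)" for k
  proof -
    have "integrable lborel (d k)" "integral\<^sup>L lborel (d k) = 2^k * (norm_L2 (\<lambda>x. g (Suc k) x - g k x))\<^sup>2"
      using L2_integrable[OF L2_diff[OF g[of "Suc k"] g[of k]]] unfolding d_def norm_L2_squared by auto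
    moreover have "2^k * (norm_L2 (\<lambda>x. g (Suc k) x - g k x))\<^sup>2 \<le> 2^k * (1/4)^k"
      using fast by (intro mult_left_mono) auto
    moreover have "2^k * (1/4)^k = ((1/2)^k :: real)" by (simp flip: power_mult_distrib)
    ultimately show ?thesis
      by (subst nn_integral_eq_integral) (auto simp: d_def)
  qed
  have "(\<integral>\<^sup>+x. (\<Sum>k. ennreal (d k x)) \<partial>lborel) = (\<Sum>k. \<integral>\<^sup>+x. ennreal (d k x) \<partial>lborel)"
    by (intro nn_integral_suminf) auto
  also have "\<dots> \<le> (\<Sum>k. ennreal ((1/2)^k))"
    by (intro suminf_le dint) auto
  also have "\<dots> = ennreal (\<Sum>k. (1/2)^k)"
    by (intro suminf_ennreal2) (auto intro!: summable_geometric)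
  also have "\<dots> < \<infinity>" by simp
  finally have "AE x in lborel. (\<Sum>k. ennreal (d k x)) \<noteq> \<infinity>"
    by (intro nn_integral_PInf_AE) auto
  then show ?thesis
  proof eventually_elim
    case (elim x)
    then have sd: "summable (\<lambda>k. d k x)" by (intro summable_suminf_not_top) (auto simp: d_def)
    have geo: "summable (\<lambda>k. (1/2::real)^k)" by (intro summable_geometric) auto
    have "summable (\<lambda>k. g (Suc k) x - g k x)"
    proof (rule summable_comparison_test')
      show "summable (\<lambda>k. (1/2)^k + d k x)" by (intro summable_add sd geo)
      show "norm (g (Suc k) x - g k x) \<le> (1/2)^k + d k x" if "k \<ge> 0" for k
      proof -
        let ?y = "norm (g (Suc k) x - g k x)"
        have "0 \<le> 2^k * (?y - (1/2)^k)\<^sup>2" by simp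
        also have "\<dots> = d k x - 2 * ?y * (2^k * (1/2)^k) + (2^k * (1/2)^k) * (1/2)^k"
          by (simp add: d_def power2_diff algebra_simps power2_eq_square)
        also have "2^k * (1/2::real)^k = 1" by (simp flip: power_mult_distrib)
        finally have "2 * ?y \<le> (1/2)^k + d k x" by simp
        then show ?thesis using norm_ge_zero[of "g (Suc k) x - g k x"] by linarith
      qed
    qed
    then have "convergent (\<lambda>n. \<Sum>k<n. g (Suc k) x - g k x)" by (simp add: summable_iff_convergent)
    then have "convergent (\<lambda>n. g n x - g 0 x)"
      using sum_lessThan_telescope[of "\<lambda>k. g k x"] by simp
    then have "convergent (\<lambda>n. (g n x - g 0 x) + g 0 x)" by (intro convergent_add convergent_const)
    then show ?case by simp
  qed
qed

lemma L2_complete: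
  fixes g :: "nat \<Rightarrow> real^'n \<Rightarrow> complex"
  assumes g: "\<And>k. g k \<in> L2"
    and cauchy: "\<And>e. e > 0 \<Longrightarrow> \<exists>N. \<forall>m\<ge>N. \<forall>n\<ge>N. norm_L2 (\<lambda>x. g m x - g n x) < e"
  shows "\<exists>f\<in>L2. (\<lambda>k. norm_L2 (\<lambda>x. g k x - f x)) \<longlonglongrightarrow> 0"
proof -
  note [measurable] = L2_measurable[OF g]
  have "\<forall>k. \<exists>N. \<forall>m\<ge>N. \<forall>n\<ge>N. norm_L2 (\<lambda>x. g m x - g n x) < (1/2)^k"
    by (intro allI cauchy) auto
  then obtain N where N: "\<And>k m n. m \<ge> N k \<Longrightarrow> n \<ge> N k \<Longrightarrow> norm_L2 (\<lambda>x. g m x - g n x) < (1/2)^k"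
    by (auto dest!: choice)
  \<comment> \<open>Each index exceeds its predecessor and reaches the next threshold
    \<open>N\<close>, so consecutive terms of the subsequence differ by less than (1/2)^k in
    norm.\<close>
  define r where "r = rec_nat (N 0) (\<lambda>k rk. max (Suc rk) (N (Suc k)))"
  have rN: "r k \<ge> N k" for k by (cases k) (auto simp: r_def)
  have "strict_mono r" by (rule strict_monoI_Suc) (auto simp: r_def less_max_iff_disj)
  have rmono: "r (Suc k) \<ge> r k" for k using \<open>strict_mono r\<close> by (simp add: strict_mono_less_eq)
  have "AE x in lborel. convergent (\<lambda>k. g (r k) x)"
  proof (rule L2_AE_convergent[where g="\<lambda>k. g (r k)", OF g])
    fix k
    have "norm_L2 (\<lambda>x. g (r (Suc k)) x - g (r k) x) \<le> (1/2)^k"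
      using N[of k "r (Suc k)" "r k"] rN[of k] rmono[of k] by (simp add: less_imp_le)
    then have "(norm_L2 (\<lambda>x. g (r (Suc k)) x - g (r k) x))\<^sup>2 \<le> ((1/2)^k)\<^sup>2"
      by (intro power_mono norm_L2_nonneg)
    also have "((1/2)^k)\<^sup>2 = ((1/4)^k :: real)"
      by (simp add: power2_eq_square flip: power_mult_distrib)
    finally show "(norm_L2 (\<lambda>x. g (r (Suc k)) x - g (r k) x))\<^sup>2 \<le> (1/4)^k" .
  qed
  then have lim: "AE x in lborel. (\<lambda>k. g (r k) x) \<longlonglongrightarrow> lim (\<lambda>k. g (r k) x)"
    by eventually_elim (simp add: convergent_LIMSEQ_iff)
  define f where "f x = lim (\<lambda>k. g (r k) x)" for x
  have [measurable]: "f \<in> borel_measurable lborel" unfolding f_def by measurable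
  \<comment> \<open>Fatou along the shifted subsequence with \<open>g m\<close> fixed: the Cauchy
    bound passes to the limit. This shows at once that \<open>f\<close> is square integrable and
    that the whole sequence, not only the subsequence, converges to it.\<close>
  have est: "(\<lambda>x. g m x - f x) \<in> L2 \<and> norm_L2 (\<lambda>x. g m x - f x) \<le> (1/2)^j" if "m \<ge> N j" for m j
  proof -
    have L: "(\<lambda>x. g m x - g (r (i + j)) x) \<in> L2" for i by (intro L2_diff g)
    have lim': "AE x in lborel. (\<lambda>i. g m x - g (r (i + j)) x) \<longlonglongrightarrow> g m x - f x"
      using lim unfolding f_def
    proof eventually_elim
      case (elim x)
      show ?case by (intro tendsto_intros LIMSEQ_ignore_initial_segment elim)
    qed
    have "norm_L2 (\<lambda>x. g m x - g (r (i + j)) x) \<le> (1/2)^j" for i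
    proof -
      have "r (i + j) \<ge> r j" using \<open>strict_mono r\<close> by (simp add: strict_mono_less_eq)
      then show ?thesis using N[of j m "r (i + j)"] that rN[of j] by (simp add: less_imp_le)
    qed
    from L2_liminf_bound[OF _ L lim' this tendsto_const] show ?thesis by simp
  qed
  have fL2: "f \<in> L2"
    using L2_diff[OF g[of "N 0"] conjunct1[OF est[of 0 "N 0"]]] by simp
  have "(\<lambda>k. norm_L2 (\<lambda>x. g k x - f x)) \<longlonglongrightarrow> 0"
  proof (rule LIMSEQ_I)
    fix e :: real assume "e > 0"
    then obtain j where "(1/2)^j < e" using real_arch_pow_inv[of e "1/2"] by auto
    then have "norm (norm_L2 (\<lambda>x. g n x - f x) - 0) < e" if "n \<ge> N j" for n
      using est[OF that] norm_L2_nonneg[of "\<lambda>x. g n x - f x"] by simp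
    then show "\<exists>no. \<forall>n\<ge>no. norm (norm_L2 (\<lambda>x. g n x - f x) - 0) < e" by blast
  qed
  with fL2 show ?thesis by blast
qed

lemma norm_L2_dominated_convergence:
  fixes g :: "nat \<Rightarrow> real^'n \<Rightarrow> complex"
  assumes [measurable]: "\<And>k. g k \<in> borel_measurable lborel" "f \<in> borel_measurable lborel"
    and w: "w \<in> borel_measurable lborel" "integrable lborel (\<lambda>x. (w x)\<^sup>2 :: real)"
    and lim: "AE x in lborel. (\<lambda>k. g k x) \<longlonglongrightarrow> f x"
    and bound: "\<And>k. AE x in lborel. norm (g k x) \<le> w x" "AE x in lborel. norm (f x) \<le> w x"
  shows "(\<lambda>k. norm_L2 (\<lambda>x. g k x - f x)) \<longlonglongrightarrow> 0"
proof -
  have "(\<lambda>k. \<integral>x. (norm (g k x - f x))\<^sup>2 \<partial>lborel) \<longlonglongrightarrow> integral\<^sup>L lborel (\<lambda>x::real^'n. 0)"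
  proof (rule integral_dominated_convergence[where w="\<lambda>x. 4 * (w x)\<^sup>2"])
    show "integrable lborel (\<lambda>x. 4 * (w x)\<^sup>2)" using w by simp
    show "AE x in lborel. (\<lambda>k. (norm (g k x - f x))\<^sup>2) \<longlonglongrightarrow> 0"
      using lim
    proof eventually_elim
      case (elim x)
      have "(\<lambda>k. (norm (g k x - f x))\<^sup>2) \<longlonglongrightarrow> (norm (f x - f x))\<^sup>2" by (intro tendsto_intros elim)
      then show ?case by simp
    qed
    show "AE x in lborel. norm ((norm (g k x - f x))\<^sup>2) \<le> 4 * (w x)\<^sup>2" for k
      using bound(1)[of k] bound(2)
    proof eventually_elim
      case (elim x)
      have "norm (g k x - f x) \<le> 2 * w x" using elim norm_triangle_ineq4[of "g k x" "f x"] by linarith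
      then have "(norm (g k x - f x))\<^sup>2 \<le> (2 * w x)\<^sup>2" by (intro power_mono) auto
      then show ?case by (simp add: power_mult_distrib)
    qed
  qed auto
  then have "(\<lambda>k. sqrt (\<integral>x. (norm (g k x - f x))\<^sup>2 \<partial>lborel)) \<longlonglongrightarrow> sqrt 0"
    by (intro tendsto_real_sqrt) simp
  then show ?thesis by (simp add: norm_L2_def)
qed

lemma L1_dominated_convergence:
  fixes g :: "nat \<Rightarrow> 'a \<Rightarrow> complex"
  assumes [measurable]: "\<And>k. g k \<in> borel_measurable M" "f \<in> borel_measurable M"
    and w: "integrable M w"
    and lim: "AE x in M. (\<lambda>k. g k x) \<longlonglongrightarrow> f x"
    and bound: "\<And>k. AE x in M. norm (g k x) \<le> w x" "AE x in M. norm (f x) \<le> w x"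
  shows "(\<lambda>k. \<integral>x. norm (g k x - f x) \<partial>M) \<longlonglongrightarrow> 0"
proof -
  have "(\<lambda>k. \<integral>x. norm (g k x - f x) \<partial>M) \<longlonglongrightarrow> (\<integral>x. 0 \<partial>M)"
  proof (rule integral_dominated_convergence[where w="\<lambda>x. 2 * w x"])
    show "integrable M (\<lambda>x. 2 * w x)" using w by simp
    show "AE x in M. (\<lambda>k. norm (g k x - f x)) \<longlonglongrightarrow> 0"
      using lim by eventually_elim (simp add: LIM_zero tendsto_norm_zero)
    show "AE x in M. norm (norm (g k x - f x)) \<le> 2 * w x" for k
      using bound(1)[of k] bound(2)
    proof eventually_elim
      case (elim x)
      then show ?case using norm_triangle_ineq4[of "g k x" "f x"] by simp
    qed
  qed auto
  then show ?thesis by simp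
qed

section \<open>Density of bounded continuous functions\<close>

lemma continuous_approx_bounded_support:
  fixes h :: "real^'n \<Rightarrow> complex"
  assumes [measurable]: "h \<in> borel_measurable lborel" and M: "M > 0"
    and hM: "\<And>x. norm (h x) \<le> M" and supp: "\<And>x. norm x > M \<Longrightarrow> h x = 0"
  shows "\<exists>\<psi>. (\<forall>k. continuous_on UNIV (\<psi> k)) \<and> (AE x in lborel. (\<lambda>k. \<psi> k x) \<longlonglongrightarrow> h x) \<and>
    (\<forall>k x. norm (\<psi> k x) \<le> M * indicator (cball 0 (M + 1)) x)"
proof -
  have "h \<in> borel_measurable lebesgue" by (rule measurable_completion) measurable
  then have "h measurable_on UNIV" by (rule lebesgue_measurable_imp_measurable_on) simp
  then obtain N g where N: "negligible N" and cont: "\<And>k. continuous_on UNIV (g k)"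
    and lim: "\<And>x. x \<notin> N \<Longrightarrow> (\<lambda>k. g k x) \<longlonglongrightarrow> h x"
    by (auto simp: measurable_on_def)
  \<comment> \<open>Measurability alone gives continuous \<open>g k\<close> without any common
    bound. The nearest-point projection \<open>P\<close> onto the ball of radius M and the cutoff
    \<eta> dominate them, and the limit is unchanged: h takes values in that ball and vanishes
    wherever \<eta> is below 1.\<close>
  define P where "P = closest_point (cball (0::complex) M)"
  define \<eta> where "\<eta> x = max 0 (min 1 (M + 1 - norm x))" for x :: "real^'n"
  define \<psi> where "\<psi> k x = of_real (\<eta> x) * P (g k x)" for k x
  have contP: "continuous_on UNIV P"
    unfolding P_def by (rule continuous_on_closest_point) (use M in auto)
  have Pid: "P z = z" if "norm z \<le> M" for z
    unfolding P_def by (rule closest_point_self) (use that in simp)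
  have PM: "norm (P z) \<le> M" for z
    using closest_point_in_set[of "cball (0::complex) M" z] M by (simp add: P_def)
  have "continuous_on UNIV (\<psi> k)" for k
    unfolding \<psi>_def \<eta>_def
    by (intro continuous_intros continuous_on_compose2[OF contP] cont) auto
  moreover have "AE x in lborel. (\<lambda>k. \<psi> k x) \<longlonglongrightarrow> h x"
  proof -
    \<comment> \<open>\<open>negligible\<close> refers to the completed measure; a statement about
      \<open>lborel\<close> needs a Borel null set around \<open>N\<close>.\<close>
    obtain N' where N': "N' \<in> null_sets lborel" "N \<subseteq> N'"
      using N by (auto simp: negligible_iff_null_sets null_sets_completion_iff2)
    show ?thesis
    proof (rule AE_I'[OF N'(1)], safe)
      fix x assume x: "\<not> (\<lambda>k. \<psi> k x) \<longlonglongrightarrow> h x"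
      show "x \<in> N'"
      proof (rule ccontr)
        assume "x \<notin> N'"
        then have "(\<lambda>k. g k x) \<longlonglongrightarrow> h x" using lim N'(2) by auto
        moreover have "isCont P (h x)" using contP by (simp add: continuous_on_eq_continuous_at)
        ultimately have "(\<lambda>k. \<psi> k x) \<longlonglongrightarrow> of_real (\<eta> x) * P (h x)"
          unfolding \<psi>_def by (intro tendsto_intros isCont_tendsto_compose[of _ P])
        moreover have "of_real (\<eta> x) * P (h x) = h x"
          by (cases "norm x > M") (use Pid[of 0] M in \<open>simp_all add: Pid[OF hM] supp \<eta>_def\<close>)
        ultimately show False using x by simp
      qed
    qed
  qed
  moreover have "norm (\<psi> k x) \<le> M * indicator (cball 0 (M + 1)) x" for k x
  proof -
    have "norm (\<psi> k x) = \<eta> x * norm (P (g k x))" by (simp add: \<psi>_def norm_mult \<eta>_def)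
    also have "\<dots> \<le> indicator (cball 0 (M + 1)) x * M"
      by (intro mult_mono PM) (auto simp: \<eta>_def indicator_def)
    finally show ?thesis by (simp add: mult.commute)
  qed
  ultimately show ?thesis by blast
qed

text \<open>Cutting f to 0 where |x| or |f| exceeds k keeps the result below |f|, so the same
  truncation converges by domination in L^2 and, for integrable f, in L^1.\<close>

lemma L2_truncation:
  fixes f :: "real^'n \<Rightarrow> complex"
  assumes f: "f \<in> L2" and e: "e > 0"
  shows "\<exists>h M. M > 0 \<and> h \<in> L2 \<and> (\<forall>x. norm (h x) \<le> M) \<and> (\<forall>x. norm x > M \<longrightarrow> h x = 0) \<and>
    (\<forall>x. norm (h x) \<le> norm (f x)) \<and> norm_L2 (\<lambda>x. h x - f x) < e \<and>
    (integrable lborel f \<longrightarrow> (\<integral>x. norm (h x - f x) \<partial>lborel) < e)"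
proof -
  note [measurable] = L2_measurable[OF f]
  define h where "h k x = (if norm x \<le> real k \<and> norm (f x) \<le> real k then f x else 0)" for k x
  have [measurable]: "h k \<in> borel_measurable lborel" for k unfolding h_def by measurable
  have le: "norm (h k x) \<le> norm (f x)" for k x by (simp add: h_def)
  have lim: "(\<lambda>k. h k x) \<longlonglongrightarrow> f x" for x
  proof (rule tendsto_eventually)
    obtain K where K: "real K \<ge> max (norm x) (norm (f x))" using real_arch_simple by blast
    show "eventually (\<lambda>k. h k x = f x) sequentially"
      using eventually_ge_at_top[of K] by eventually_elim (use K in \<open>auto simp: h_def\<close>)
  qed
  have "(\<lambda>k. norm_L2 (\<lambda>x. h k x - f x)) \<longlonglongrightarrow> 0"
    using L2_integrable[OF f] lim le
    by (intro norm_L2_dominated_convergence[where w="\<lambda>x. norm (f x)"]) auto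
  then have ev: "eventually (\<lambda>k. norm_L2 (\<lambda>x. h k x - f x) < e) sequentially"
    using e by (rule order_tendstoD)
  have ev': "eventually (\<lambda>k. integrable lborel f \<longrightarrow> (\<integral>x. norm (h k x - f x) \<partial>lborel) < e) sequentially"
  proof (cases "integrable lborel f")
    case True
    have "(\<lambda>k. \<integral>x. norm (h k x - f x) \<partial>lborel) \<longlonglongrightarrow> 0"
      using True lim le by (intro L1_dominated_convergence[where w="\<lambda>x. norm (f x)"]) auto
    then show ?thesis using order_tendstoD(2)[OF _ e] by auto
  qed simp
  from eventually_conj[OF eventually_conj[OF ev ev'] eventually_gt_at_top[of 0]]
  obtain k where k: "norm_L2 (\<lambda>x. h k x - f x) < e" "k > 0"
    "integrable lborel f \<longrightarrow> (\<integral>x. norm (h k x - f x) \<partial>lborel) < e"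
    by (auto dest!: eventually_happens)
  have "h k \<in> L2" using le by (intro L2_dominated[OF f, of _ 1]) auto
  then show ?thesis using k le
    by (intro exI[of _ "h k"] exI[of _ "real k"]) (auto simp: h_def)
qed

lemma integrable_indicator_cball: "integrable lborel (\<lambda>x::'a::euclidean_space. B * indicator (cball 0 r) x :: real)"
proof -
  have "emeasure lborel (cball (0::'a) r) < \<infinity>" by (rule emeasure_bounded_finite) simp
  then show ?thesis by simp
qed

text \<open>Both norms are approximated by the same function: L^1 closeness makes the transforms
  converge pointwise, as Fatou's lemma requires, while L^2 closeness controls the limit of the
  norms.\<close>

lemma L2_continuous_approx:
  fixes f :: "real^'n \<Rightarrow> complex"
  assumes f: "f \<in> L2" and e: "e > 0"
  shows "\<exists>\<psi>. continuous_on UNIV \<psi> \<and> (\<exists>B. \<forall>x. norm (\<psi> x) \<le> B) \<and> integrable lborel \<psi> \<and> \<psi> \<in> L2 \<and>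
    norm_L2 (\<lambda>x. \<psi> x - f x) < e \<and> (integrable lborel f \<longrightarrow> (\<integral>x. norm (\<psi> x - f x) \<partial>lborel) < e)"
proof -
  obtain h M where M: "M > 0" and h: "h \<in> L2" "\<And>x. norm (h x) \<le> M" "\<And>x. norm x > M \<Longrightarrow> h x = 0"
    and hf: "\<And>x. norm (h x) \<le> norm (f x)" "norm_L2 (\<lambda>x. h x - f x) < e/2"
      "integrable lborel f \<Longrightarrow> (\<integral>x. norm (h x - f x) \<partial>lborel) < e/2"
    using L2_truncation[OF f, of "e/2"] e by auto
  note [measurable] = L2_measurable[OF h(1)] L2_measurable[OF f]
  obtain \<psi> where \<psi>: "\<And>k. continuous_on UNIV (\<psi> k)" "AE x in lborel. (\<lambda>k. \<psi> k x) \<longlonglongrightarrow> h x"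
    "\<And>k x. norm (\<psi> k x) \<le> M * indicator (cball 0 (M + 1)) x"
    using continuous_approx_bounded_support[of h M] M h by auto
  have [measurable]: "\<psi> k \<in> borel_measurable lborel" for k
    using borel_measurable_continuous_onI[OF \<psi>(1)] by simp
  let ?w = "\<lambda>x::real^'n. M * indicator (cball 0 (M + 1)) x"
  have hw: "norm (h x) \<le> ?w x" for x using h(2)[of x] h(3)[of x] M by (cases "norm x > M") auto
  have wint: "integrable lborel ?w" by (rule integrable_indicator_cball)
  have w2: "integrable lborel (\<lambda>x. (?w x)\<^sup>2)"
  proof -
    have "(\<lambda>x. (?w x)\<^sup>2) = (\<lambda>x. M\<^sup>2 * indicator (cball 0 (M + 1)) x)"
      by (auto simp: fun_eq_iff indicator_def)
    then show ?thesis by (simp only: integrable_indicator_cball)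
  qed
  have "(\<lambda>k. norm_L2 (\<lambda>x. \<psi> k x - h x)) \<longlonglongrightarrow> 0"
    using \<psi>(3) hw borel_measurable_integrable[OF wint]
    by (intro norm_L2_dominated_convergence[OF _ _ _ w2 \<psi>(2)]) auto
  then have ev: "eventually (\<lambda>k. norm_L2 (\<lambda>x. \<psi> k x - h x) < e/2) sequentially"
    using e by (intro order_tendstoD) auto
  have "(\<lambda>k. \<integral>x. norm (\<psi> k x - h x) \<partial>lborel) \<longlonglongrightarrow> 0"
    using \<psi>(3) hw by (intro L1_dominated_convergence[OF _ _ wint \<psi>(2)]) auto
  then have ev': "eventually (\<lambda>k. (\<integral>x. norm (\<psi> k x - h x) \<partial>lborel) < e/2) sequentially"
    using e by (intro order_tendstoD) auto
  obtain k where k: "norm_L2 (\<lambda>x. \<psi> k x - h x) < e/2" "(\<integral>x. norm (\<psi> k x - h x) \<partial>lborel) < e/2"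
    using eventually_happens[OF eventually_conj[OF ev ev']] by auto
  have \<psi>int: "integrable lborel (\<psi> k)"
    using \<psi>(3) by (intro Bochner_Integration.integrable_bound[OF wint]) (auto intro: order_trans[OF _ abs_ge_self])
  have \<psi>L2: "\<psi> k \<in> L2"
  proof (rule L2I)
    show "integrable lborel (\<lambda>x. (norm (\<psi> k x))\<^sup>2)"
    proof (rule Bochner_Integration.integrable_bound[OF w2])
      show "AE x in lborel. norm ((norm (\<psi> k x))\<^sup>2) \<le> norm ((?w x)\<^sup>2)"
        using power_mono[OF \<psi>(3) norm_ge_zero, of k _ 2] by auto
    qed simp
  qed simp
  have "norm_L2 (\<lambda>x. \<psi> k x - f x) < e"
    using norm_L2_triangle_diff[OF \<psi>L2 h(1) f] k hf by linarith
  moreover have "(\<integral>x. norm (\<psi> k x - f x) \<partial>lborel) < e" if [simp]: "integrable lborel f"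
  proof -
    have [simp]: "integrable lborel h"
      using hf(1) by (intro Bochner_Integration.integrable_bound[OF that]) auto
    have "(\<integral>x. norm (\<psi> k x - f x) \<partial>lborel) \<le> (\<integral>x. norm (\<psi> k x - h x) + norm (h x - f x) \<partial>lborel)"
      using \<psi>int by (intro integral_mono) (auto intro: norm_diff_triangle_le)
    also have "\<dots> = (\<integral>x. norm (\<psi> k x - h x) \<partial>lborel) + (\<integral>x. norm (h x - f x) \<partial>lborel)"
      using \<psi>int by (intro Bochner_Integration.integral_add) auto
    also have "\<dots> < e" using k hf(3)[OF that] by linarith
    finally show ?thesis .
  qed
  moreover have "\<exists>B. \<forall>x. norm (\<psi> k x) \<le> B"
  proof (intro exI allI)
    show "norm (\<psi> k x) \<le> M" for x using \<psi>(3)[of k x] M by (cases "norm x \<le> M + 1") auto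
  qed
  ultimately show ?thesis using \<psi>(1) \<psi>int \<psi>L2 by blast
qed

section \<open>Fourier transform of integrable functions\<close>

lemma norm_exp_neg_i [simp]: "norm (exp (- (\<i> * complex_of_real r))) = 1"
  by (simp add: norm_exp_eq_Re)

lemma fourier_L1_integrable:
  fixes f :: "real^'n \<Rightarrow> complex"
  assumes f: "integrable lborel f"
  shows "integrable lborel (\<lambda>x. exp (- (\<i> * complex_of_real (x \<bullet> \<xi>))) * f x)"
  using borel_measurable_integrable[OF f]
  by (intro Bochner_Integration.integrable_bound[OF f]) (auto simp: norm_mult)

lemma norm_fourier_L1_le:
  fixes f :: "real^'n \<Rightarrow> complex"
  shows "norm (fourier_L1 f \<xi>) \<le> (\<integral>x. norm (f x) \<partial>lborel)"
  unfolding fourier_L1_def by (rule order_trans[OF integral_norm_bound]) (simp add: norm_mult)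

lemma fourier_L1_add:
  "integrable lborel f \<Longrightarrow> integrable lborel g \<Longrightarrow>
    fourier_L1 (\<lambda>x. f x + g x) \<xi> = fourier_L1 f \<xi> + fourier_L1 g \<xi>"
  unfolding fourier_L1_def distrib_left
  by (intro Bochner_Integration.integral_add fourier_L1_integrable)

lemma fourier_L1_mult: "fourier_L1 (\<lambda>x. c * f x) \<xi> = c * fourier_L1 f \<xi>"
  unfolding fourier_L1_def by (simp add: mult.left_commute)

lemma fourier_L1_diff:
  "integrable lborel f \<Longrightarrow> integrable lborel g \<Longrightarrow>
    fourier_L1 (\<lambda>x. f x - g x) \<xi> = fourier_L1 f \<xi> - fourier_L1 g \<xi>"
  using fourier_L1_add[of f "\<lambda>x. -1 * g x" \<xi>] fourier_L1_mult[of "-1" g \<xi>] by simp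

lemma fourier_L1_0: "fourier_L1 f 0 = mean f"
  by (simp add: fourier_L1_def mean_def)

lemma continuous_fourier_L1:
  fixes f :: "real^'n \<Rightarrow> complex"
  assumes f: "integrable lborel f"
  shows "continuous_on UNIV (fourier_L1 f)"
  unfolding continuous_on_sequentially
proof (intro ballI allI impI, elim conjE)
  fix \<xi> and X :: "nat \<Rightarrow> real^'n" assume X: "X \<longlonglongrightarrow> \<xi>"
  note [measurable] = borel_measurable_integrable[OF f]
  have "(\<lambda>k. \<integral>x. exp (- (\<i> * complex_of_real (x \<bullet> X k))) * f x \<partial>lborel)
     \<longlonglongrightarrow> (\<integral>x. exp (- (\<i> * complex_of_real (x \<bullet> \<xi>))) * f x \<partial>lborel)"
  proof (rule integral_dominated_convergence[where w="\<lambda>x. norm (f x)"])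
    show "AE x in lborel. (\<lambda>k. exp (- (\<i> * complex_of_real (x \<bullet> X k))) * f x)
        \<longlonglongrightarrow> exp (- (\<i> * complex_of_real (x \<bullet> \<xi>))) * f x"
      by (intro AE_I2 tendsto_intros X)
  qed (use f in \<open>auto simp: norm_mult\<close>)
  then show "(fourier_L1 f \<circ> X) \<longlonglongrightarrow> fourier_L1 f \<xi>" by (simp add: fourier_L1_def o_def)
qed

lemma measurable_fourier_L1:
  "integrable lborel f \<Longrightarrow> fourier_L1 f \<in> borel_measurable lborel"
  using borel_measurable_continuous_onI[OF continuous_fourier_L1] by simp

text \<open>The kernel has modulus 1 and is symmetric in its two variables, so this is Fubini for
  the integrable function f(x) g(\<xi>) times the kernel.\<close>

lemma fourier_L1_multiplication:
  fixes f g :: "real^'n \<Rightarrow> complex"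
  assumes f: "integrable lborel f" and g: "integrable lborel g"
  shows "(\<integral>\<xi>. fourier_L1 f \<xi> * g \<xi> \<partial>lborel) = (\<integral>x. f x * fourier_L1 g x \<partial>lborel)"
proof -
  note [measurable] = borel_measurable_integrable[OF f] borel_measurable_integrable[OF g]
  let ?F = "\<lambda>x \<xi>. exp (- (\<i> * complex_of_real (x \<bullet> \<xi>))) * f x * g \<xi>"
  have int: "integrable (lborel \<Otimes>\<^sub>M lborel) (\<lambda>(x, \<xi>). ?F x \<xi>)"
  proof (rule lborel_pair.Fubini_integrable)
    show "(\<lambda>(x, \<xi>). ?F x \<xi>) \<in> borel_measurable (lborel \<Otimes>\<^sub>M lborel)" by measurable
    show "integrable lborel (\<lambda>x. \<integral>\<xi>. norm ((\<lambda>(x, \<xi>). ?F x \<xi>) (x, \<xi>)) \<partial>lborel)"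
      using f by (simp add: norm_mult)
    have "integrable lborel (\<lambda>\<xi>. ?F x \<xi>)" for x
      by (rule Bochner_Integration.integrable_bound[where f="\<lambda>\<xi>. f x * g \<xi>"])
        (use g in \<open>auto simp: norm_mult\<close>)
    then show "AE x in lborel. integrable lborel (\<lambda>\<xi>. (\<lambda>(x, \<xi>). ?F x \<xi>) (x, \<xi>))" by simp
  qed
  have "(\<integral>\<xi>. fourier_L1 f \<xi> * g \<xi> \<partial>lborel) = (\<integral>\<xi>. (\<integral>x. ?F x \<xi> \<partial>lborel) \<partial>lborel)"
    by (simp add: fourier_L1_def)
  also have "\<dots> = (\<integral>x. (\<integral>\<xi>. ?F x \<xi> \<partial>lborel) \<partial>lborel)"
    using int by (rule lborel_pair.Fubini_integral)
  also have "\<dots> = (\<integral>x. f x * fourier_L1 g x \<partial>lborel)"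
  proof (rule Bochner_Integration.integral_cong)
    fix x
    have "(\<integral>\<xi>. ?F x \<xi> \<partial>lborel) = (\<integral>\<xi>. f x * (exp (- (\<i> * complex_of_real (\<xi> \<bullet> x))) * g \<xi>) \<partial>lborel)"
      by (intro Bochner_Integration.integral_cong) (auto simp: inner_commute)
    then show "(\<integral>\<xi>. ?F x \<xi> \<partial>lborel) = f x * fourier_L1 g x" by (simp add: fourier_L1_def)
  qed simp
  finally show ?thesis .
qed

section \<open>Gaussian integrals and scaling\<close>

lemma
  fixes f :: "'a::euclidean_space \<Rightarrow> 'b::{banach, second_countable_topology}"
  assumes [measurable]: "f \<in> borel_measurable borel" and c: "c \<noteq> 0"
  shows lborel_integral_affine:
      "integral\<^sup>L lborel f = \<bar>c\<bar> ^ DIM('a) *\<^sub>R (\<integral>x. f (t + c *\<^sub>R x) \<partial>lborel)"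
    and lborel_integrable_affine_iff: "integrable lborel (\<lambda>x. f (t + c *\<^sub>R x)) \<longleftrightarrow> integrable lborel f"
proof -
  let ?d = "\<lambda>_. \<bar>c\<bar> ^ DIM('a)"
  have L: "lborel = density (distr lborel borel (\<lambda>x. t + c *\<^sub>R x)) ?d"
    using lborel_affine[OF c, of t] by (simp add: ennreal_power)
  show "integral\<^sup>L lborel f = \<bar>c\<bar> ^ DIM('a) *\<^sub>R (\<integral>x. f (t + c *\<^sub>R x) \<partial>lborel)"
    by (subst L, subst integral_density) (auto simp: integral_distr)
  show "integrable lborel (\<lambda>x. f (t + c *\<^sub>R x)) \<longleftrightarrow> integrable lborel f"
  proof -
    have "integrable lborel f \<longleftrightarrow> integrable lborel (\<lambda>x. \<bar>c\<bar> ^ DIM('a) *\<^sub>R f (t + c *\<^sub>R x))"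
      by (subst L, subst integrable_density) (auto simp: integrable_distr_eq)
    moreover have "integrable lborel (\<lambda>x. (1 / \<bar>c\<bar> ^ DIM('a)) *\<^sub>R \<bar>c\<bar> ^ DIM('a) *\<^sub>R f (t + c *\<^sub>R x))"
      if "integrable lborel (\<lambda>x. \<bar>c\<bar> ^ DIM('a) *\<^sub>R f (t + c *\<^sub>R x))"
      using that by (rule integrable_scaleR_right)
    ultimately show ?thesis using c by (auto intro: integrable_scaleR_right)
  qed
qed

definition std_gaussian :: "'a::euclidean_space \<Rightarrow> real" where
  "std_gaussian x = (\<Prod>b\<in>Basis. std_normal_density (x \<bullet> b))"

lemma std_gaussian_eq:
  "std_gaussian (x::'a::euclidean_space) = (1 / sqrt (2 * pi)) ^ DIM('a) * exp (- (norm x)\<^sup>2 / 2)"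
proof -
  have "(norm x)\<^sup>2 = (\<Sum>b\<in>Basis. (x \<bullet> b)\<^sup>2)"
    unfolding power2_norm_eq_inner by (subst euclidean_inner) (simp add: power2_eq_square)
  then show ?thesis
    by (simp add: std_gaussian_def std_normal_density_def prod_dividef exp_sum[symmetric]
      sum_divide_distrib sum_negf power_divide)
qed

lemma std_gaussian_nonneg: "0 \<le> std_gaussian x"
  by (simp add: std_gaussian_eq)

lemma measurable_std_gaussian [measurable]: "std_gaussian \<in> borel_measurable borel"
  unfolding std_gaussian_eq[abs_def] by measurable

text \<open>Both the exponential and the density factor over the coordinates, and
  \<open>lborel\<close> is the image of a product measure. The claims thus reduce to the
  characteristic function of the one-dimensional normal distribution, evaluated at
  \<open>- (z \<bullet> b)\<close> because of the sign in the transform.\<close>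

lemma std_gaussian_char:
  fixes z :: "'a::euclidean_space"
  shows "integrable lborel (\<lambda>x::'a. exp (- (\<i> * complex_of_real (x \<bullet> z))) * complex_of_real (std_gaussian x))"
    and "(\<integral>x. exp (- (\<i> * complex_of_real (x \<bullet> z))) * complex_of_real (std_gaussian x) \<partial>lborel)
      = complex_of_real (exp (- (norm z)\<^sup>2 / 2))"
proof -
  interpret product_sigma_finite "\<lambda>_::'a. lborel :: real measure" ..
  define F where "F b t = exp (- (\<i> * complex_of_real (t * (z \<bullet> b)))) * complex_of_real (std_normal_density t)"
    for b :: 'a and t
  have intF: "integrable lborel (F b)" for b
    unfolding F_def
    by (rule Bochner_Integration.integrable_bound[OF integrable_normal_density[of 1 0]])
      (auto simp: norm_mult)
  have F: "integral\<^sup>L lborel (F b) = complex_of_real (exp (- (z \<bullet> b)\<^sup>2 / 2))" for b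
  proof -
    have "complex_of_real (exp (- (z \<bullet> b)\<^sup>2 / 2)) = char std_normal_distribution (- (z \<bullet> b))"
      by (simp add: char_std_normal_distribution)
    also have "char std_normal_distribution (- (z \<bullet> b))
      = (\<integral>t. std_normal_density t *\<^sub>R iexp (- (z \<bullet> b) * t) \<partial>lborel)"
      unfolding char_def by (subst integral_density) auto
    also have "\<dots> = integral\<^sup>L lborel (F b)"
      by (intro Bochner_Integration.integral_cong)
        (auto simp: F_def scaleR_conv_of_real mult_ac)
    finally show ?thesis ..
  qed
  have eq: "exp (- (\<i> * complex_of_real (x \<bullet> z))) * complex_of_real (std_gaussian x) = (\<Prod>b\<in>Basis. F b (x \<bullet> b))"
    for x :: 'a
  proof -
    have "x \<bullet> z = (\<Sum>b\<in>Basis. (x \<bullet> b) * (z \<bullet> b))" by (rule euclidean_inner)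
    then have "exp (- (\<i> * complex_of_real (x \<bullet> z)))
      = (\<Prod>b\<in>Basis. exp (- (\<i> * complex_of_real ((x \<bullet> b) * (z \<bullet> b)))))"
      by (simp add: exp_sum[symmetric] sum_negf sum_distrib_left)
    then show ?thesis by (simp add: F_def prod.distrib std_gaussian_def)
  qed
  have [measurable]: "F b \<in> borel_measurable borel" for b unfolding F_def by measurable
  let ?S = "\<lambda>f. \<Sum>b\<in>Basis. f b *\<^sub>R (b::'a)"
  have S: "?S f \<bullet> b = f b" if "b \<in> Basis" for f b
    using that by (simp add: inner_sum_left_Basis)
  have L: "lborel = distr (\<Pi>\<^sub>M b\<in>(Basis::'a set). (lborel::real measure)) borel ?S" by (rule lborel_eq)
  have meas: "?S \<in> measurable (\<Pi>\<^sub>M b\<in>(Basis::'a set). (lborel::real measure)) borel" by measurable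
  have mF: "(\<lambda>x::'a. \<Prod>b\<in>Basis. F b (x \<bullet> b)) \<in> borel_measurable borel" by measurable
  show "integrable lborel (\<lambda>x::'a. exp (- (\<i> * complex_of_real (x \<bullet> z))) * complex_of_real (std_gaussian x))"
    unfolding eq
    by (subst L, subst integrable_distr_eq[OF meas mF])
      (simp add: S product_integrable_prod[OF _ intF] cong: prod.cong)
  have "(\<integral>x. exp (- (\<i> * complex_of_real (x \<bullet> z))) * complex_of_real (std_gaussian x) \<partial>lborel)
    = (\<Prod>b\<in>(Basis::'a set). integral\<^sup>L lborel (F b))"
    unfolding eq
    by (subst L, subst integral_distr[OF meas mF])
      (simp add: S product_integral_prod[OF _ intF] cong: prod.cong)
  also have "\<dots> = complex_of_real (exp (\<Sum>b\<in>Basis. - (z \<bullet> b)\<^sup>2 / 2))"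
    unfolding F by (simp add: exp_sum)
  also have "(\<Sum>b\<in>Basis. - (z \<bullet> b)\<^sup>2 / 2) = - (norm z)\<^sup>2 / 2"
    unfolding power2_norm_eq_inner
    by (subst (2) euclidean_inner) (simp add: power2_eq_square sum_negf flip: sum_divide_distrib)
  finally show "(\<integral>x. exp (- (\<i> * complex_of_real (x \<bullet> z))) * complex_of_real (std_gaussian x) \<partial>lborel)
      = complex_of_real (exp (- (norm z)\<^sup>2 / 2))" .
qed

lemma integrable_std_gaussian: "integrable lborel (std_gaussian :: 'a::euclidean_space \<Rightarrow> real)"
  using integrable_norm[OF std_gaussian_char(1)[of "0::'a"]] std_gaussian_nonneg[where 'a='a] by simp

lemma integral_std_gaussian: "integral\<^sup>L lborel (std_gaussian :: 'a::euclidean_space \<Rightarrow> real) = 1"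
proof -
  have "complex_of_real (integral\<^sup>L lborel (std_gaussian :: 'a \<Rightarrow> real)) = 1"
    using std_gaussian_char(2)[of "0::'a"] by (simp flip: integral_complex_of_real)
  then show ?thesis using of_real_eq_1_iff by blast
qed

text \<open>The convolution of f with the centred Gaussian density of standard deviation s (for s >
  0), after the substitution y = x + s w. In this form the density does not depend on s, so the
  limit s to 0 only involves f.\<close>

definition gaussian_mean :: "(real^'n \<Rightarrow> complex) \<Rightarrow> real \<Rightarrow> real^'n \<Rightarrow> complex" where
  "gaussian_mean f s x = (\<integral>w. f (x + s *\<^sub>R w) * complex_of_real (std_gaussian w) \<partial>lborel)"

text \<open>The value is (2 pi)^n times the normal density with mean x and standard deviation s,
  evaluated at y. Pairing it with f therefore produces \<open>gaussian_mean\<close>.\<close>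

lemma fourier_L1_modulated_gaussian:
  fixes x y :: "real^'n"
  assumes s: "s > 0"
  shows "integrable lborel (\<lambda>\<xi>::real^'n. exp (\<i> * complex_of_real (\<xi> \<bullet> x)) * complex_of_real (exp (- (s * norm \<xi>)\<^sup>2 / 2)))" (is "integrable _ ?h")
    and "fourier_L1 (\<lambda>\<xi>. exp (\<i> * complex_of_real (\<xi> \<bullet> x)) * complex_of_real (exp (- (s * norm \<xi>)\<^sup>2 / 2))) y
      = complex_of_real ((2 * pi / s) ^ CARD('n) * std_gaussian ((1 / s) *\<^sub>R (y - x)))"
proof -
  let ?c = "sqrt (2 * pi) ^ CARD('n)"
  let ?g = "\<lambda>\<xi>::real^'n. complex_of_real (exp (- (s * norm \<xi>)\<^sup>2 / 2))"
  have g: "?g \<xi> = complex_of_real (?c * std_gaussian (0 + s *\<^sub>R \<xi>))" for \<xi>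
    using s by (simp add: std_gaussian_eq power_divide)
  have "integrable lborel (\<lambda>\<xi>::real^'n. std_gaussian (0 + s *\<^sub>R \<xi>))"
    using s by (subst lborel_integrable_affine_iff) (auto intro: integrable_std_gaussian)
  then have "integrable lborel ?g" unfolding g by (intro integrable_of_real integrable_mult_right)
  then show hint: "integrable lborel ?h"
    by (rule Bochner_Integration.integrable_bound) (auto simp: norm_mult)
  define z where "z = (1 / s) *\<^sub>R (y - x)"
  let ?k = "\<lambda>\<eta>::real^'n. exp (- (\<i> * complex_of_real (\<eta> \<bullet> z))) * complex_of_real (std_gaussian \<eta>)"
  have e: "exp (- (\<i> * complex_of_real (\<xi> \<bullet> y))) * exp (\<i> * complex_of_real (\<xi> \<bullet> x))
      = exp (- (\<i> * complex_of_real ((s *\<^sub>R \<xi>) \<bullet> z)))" for \<xi>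
  proof -
    have "(s *\<^sub>R \<xi>) \<bullet> z = \<xi> \<bullet> y - \<xi> \<bullet> x" using s by (simp add: z_def inner_diff_right field_simps)
    then show ?thesis by (simp only:) (simp add: algebra_simps flip: exp_add)
  qed
  have "fourier_L1 ?h y = (\<integral>\<xi>. complex_of_real ?c * ?k (0 + s *\<^sub>R \<xi>) \<partial>lborel)"
    unfolding fourier_L1_def
  proof (rule Bochner_Integration.integral_cong)
    fix \<xi> :: "real^'n"
    have "exp (- (\<i> * complex_of_real (\<xi> \<bullet> y))) * (exp (\<i> * complex_of_real (\<xi> \<bullet> x)) * ?g \<xi>)
      = (exp (- (\<i> * complex_of_real (\<xi> \<bullet> y))) * exp (\<i> * complex_of_real (\<xi> \<bullet> x))) * ?g \<xi>"
      by (simp only: mult.assoc)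
    also have "\<dots> = complex_of_real ?c * ?k (0 + s *\<^sub>R \<xi>)" unfolding e g by simp
    finally show "exp (- (\<i> * complex_of_real (\<xi> \<bullet> y))) * (exp (\<i> * complex_of_real (\<xi> \<bullet> x)) * ?g \<xi>)
      = complex_of_real ?c * ?k (0 + s *\<^sub>R \<xi>)" .
  qed simp
  also have "\<dots> = complex_of_real ?c * (\<integral>\<xi>. ?k (0 + s *\<^sub>R \<xi>) \<partial>lborel)" by (rule integral_mult_right_zero)
  also have "(\<integral>\<xi>. ?k (0 + s *\<^sub>R \<xi>) \<partial>lborel) = complex_of_real (1 / s ^ CARD('n)) * integral\<^sup>L lborel ?k"
    using s by (subst (2) lborel_integral_affine[where c=s and t=0]) (auto simp: scaleR_conv_of_real)
  also have "integral\<^sup>L lborel ?k = complex_of_real (?c * std_gaussian z)"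
    unfolding std_gaussian_char(2) by (simp add: std_gaussian_eq power_divide)
  also have "complex_of_real ?c * (complex_of_real (1 / s ^ CARD('n)) * complex_of_real (?c * std_gaussian z))
    = complex_of_real ((2 * pi / s) ^ CARD('n) * std_gaussian z)"
  proof -
    \<comment> \<open>One factor \<open>?c\<close> comes from writing the damping through
      \<open>std_gaussian\<close>, the other from writing the transform of the Gaussian as a density
      again.\<close>
    have "?c * ?c = (2 * pi) ^ CARD('n)" by (subst power_mult_distrib[symmetric]) simp
    moreover have "c * (1 / q * (c * g)) = (c * c) / q * g" for c q g :: real by simp
    ultimately have "?c * (1 / s ^ CARD('n) * (?c * std_gaussian z)) = (2 * pi / s) ^ CARD('n) * std_gaussian z"
      by (simp only: power_divide)
    then show ?thesis by (simp only: of_real_mult[symmetric])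
  qed
  finally show "fourier_L1 ?h y = complex_of_real ((2 * pi / s) ^ CARD('n) * std_gaussian ((1 / s) *\<^sub>R (y - x)))"
    unfolding z_def .
qed

text \<open>The multiplication formula is used twice: first with \<open>f\<close> against the conjugate of its
  damped transform, then with \<open>f\<close> against a modulated Gaussian.\<close>

lemma damped_plancherel:
  fixes f :: "real^'n \<Rightarrow> complex"
  assumes f: "integrable lborel f" and s: "s > 0"
  shows "integrable lborel (\<lambda>\<xi>. exp (- (s * norm \<xi>)\<^sup>2 / 2) * (norm (fourier_L1 f \<xi>))\<^sup>2)"
    and "complex_of_real (\<integral>\<xi>. exp (- (s * norm \<xi>)\<^sup>2 / 2) * (norm (fourier_L1 f \<xi>))\<^sup>2 \<partial>lborel)
      = complex_of_real ((2 * pi) ^ CARD('n)) * (\<integral>x. f x * cnj (gaussian_mean f s x) \<partial>lborel)"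
proof -
  note [measurable] = borel_measurable_integrable[OF f] measurable_fourier_L1[OF f, simplified]
  have [measurable]: "cnj \<in> borel_measurable borel"
    by (intro borel_measurable_continuous_onI continuous_intros)
  let ?G = "\<lambda>\<xi>::real^'n. exp (- (s * norm \<xi>)\<^sup>2 / 2)"
  \<comment> \<open>For integrable f the transform is only known to be bounded; the Gaussian factor
    makes \<psi> integrable, so that the multiplication formula applies to it.\<close>
  define \<psi> where "\<psi> \<xi> = cnj (fourier_L1 f \<xi>) * complex_of_real (?G \<xi>)" for \<xi>
  let ?M = "\<integral>x. norm (f x) \<partial>lborel"
  have Gint: "integrable lborel (\<lambda>\<xi>. complex_of_real (?G \<xi>))"
    using fourier_L1_modulated_gaussian(1)[OF s, of 0] by simp
  have [measurable]: "\<psi> \<in> borel_measurable borel" unfolding \<psi>_def by measurable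
  have \<psi>: "integrable lborel \<psi>"
  proof (rule Bochner_Integration.integrable_bound)
    show "integrable lborel (\<lambda>\<xi>. complex_of_real ?M * complex_of_real (?G \<xi>))" using Gint by simp
    show "AE \<xi> in lborel. norm (\<psi> \<xi>) \<le> norm (complex_of_real ?M * complex_of_real (?G \<xi>))"
      using norm_fourier_L1_le[of f] by (auto simp: \<psi>_def norm_mult intro!: mult_right_mono order_trans[OF _ abs_ge_self])
  qed simp
  have eq: "fourier_L1 f \<xi> * \<psi> \<xi> = complex_of_real (?G \<xi> * (norm (fourier_L1 f \<xi>))\<^sup>2)" for \<xi>
    by (simp add: \<psi>_def complex_norm_square[symmetric] mult.assoc[symmetric] mult.commute)
  show "integrable lborel (\<lambda>\<xi>. ?G \<xi> * (norm (fourier_L1 f \<xi>))\<^sup>2)"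
  proof (rule Bochner_Integration.integrable_bound)
    show "integrable lborel (\<lambda>\<xi>. complex_of_real ?M * \<psi> \<xi>)" using \<psi> by simp
    show "AE \<xi> in lborel. norm (?G \<xi> * (norm (fourier_L1 f \<xi>))\<^sup>2) \<le> norm (complex_of_real ?M * \<psi> \<xi>)"
    proof (rule AE_I2)
      fix \<xi>
      have "norm (?G \<xi> * (norm (fourier_L1 f \<xi>))\<^sup>2) = norm (fourier_L1 f \<xi>) * norm (\<psi> \<xi>)"
        by (simp add: \<psi>_def norm_mult power2_eq_square)
      also have "\<dots> \<le> ?M * norm (\<psi> \<xi>)" by (intro mult_right_mono norm_fourier_L1_le) auto
      finally show "norm (?G \<xi> * (norm (fourier_L1 f \<xi>))\<^sup>2) \<le> norm (complex_of_real ?M * \<psi> \<xi>)"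
        by (simp add: norm_mult)
    qed
  qed simp
  have "complex_of_real (\<integral>\<xi>. ?G \<xi> * (norm (fourier_L1 f \<xi>))\<^sup>2 \<partial>lborel) = (\<integral>\<xi>. fourier_L1 f \<xi> * \<psi> \<xi> \<partial>lborel)"
    unfolding eq by (simp only: integral_complex_of_real)
  also have "\<dots> = (\<integral>x. f x * fourier_L1 \<psi> x \<partial>lborel)"
    by (rule fourier_L1_multiplication[OF f \<psi>])
  also have "\<dots> = (\<integral>x. complex_of_real ((2 * pi) ^ CARD('n)) * (f x * cnj (gaussian_mean f s x)) \<partial>lborel)"
  proof (rule Bochner_Integration.integral_cong)
    fix x
    let ?h = "\<lambda>\<xi>. exp (\<i> * complex_of_real (\<xi> \<bullet> x)) * complex_of_real (?G \<xi>)"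
    have "fourier_L1 \<psi> x = (\<integral>\<xi>. cnj (fourier_L1 f \<xi> * ?h \<xi>) \<partial>lborel)"
      unfolding fourier_L1_def[of \<psi>]
      by (intro Bochner_Integration.integral_cong) (auto simp: \<psi>_def exp_cnj mult_ac)
    also have "\<dots> = cnj (\<integral>\<xi>. fourier_L1 f \<xi> * ?h \<xi> \<partial>lborel)"
      by (rule Bochner_Integration.integral_cnj[of lborel "\<lambda>\<xi>. fourier_L1 f \<xi> * ?h \<xi>"])
    also have "(\<integral>\<xi>. fourier_L1 f \<xi> * ?h \<xi> \<partial>lborel) = (\<integral>y. f y * fourier_L1 ?h y \<partial>lborel)"
      by (rule fourier_L1_multiplication[OF f fourier_L1_modulated_gaussian(1)[OF s]])
    also have "\<dots> = (\<integral>y. f y * complex_of_real ((2 * pi / s) ^ CARD('n) * std_gaussian ((1 / s) *\<^sub>R (y - x))) \<partial>lborel)"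
      unfolding fourier_L1_modulated_gaussian(2)[OF s] ..
    \<comment> \<open>The substitution y = x + s w moves the scale from the kernel to f.\<close>
    also have "\<dots> = s ^ CARD('n) *\<^sub>R
      (\<integral>w. f (x + s *\<^sub>R w) * complex_of_real ((2 * pi / s) ^ CARD('n) * std_gaussian ((1 / s) *\<^sub>R (x + s *\<^sub>R w - x))) \<partial>lborel)"
      using s by (subst lborel_integral_affine[where c=s and t=x]) auto
    also have "\<dots> = s ^ CARD('n) *\<^sub>R
      (\<integral>w. complex_of_real ((2 * pi / s) ^ CARD('n)) * (f (x + s *\<^sub>R w) * complex_of_real (std_gaussian w)) \<partial>lborel)"
      using s by (intro arg_cong2[where f=scaleR] refl Bochner_Integration.integral_cong) auto
    also have "\<dots> = complex_of_real (s ^ CARD('n) * (2 * pi / s) ^ CARD('n)) * gaussian_mean f s x"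
      unfolding gaussian_mean_def integral_mult_right_zero scaleR_conv_of_real by simp
    also have "s ^ CARD('n) * (2 * pi / s) ^ CARD('n) = (2 * pi) ^ CARD('n)"
      using s by (subst power_mult_distrib[symmetric]) simp
    finally show "f x * fourier_L1 \<psi> x = complex_of_real ((2 * pi) ^ CARD('n)) * (f x * cnj (gaussian_mean f s x))"
      by simp
  qed simp
  also have "\<dots> = complex_of_real ((2 * pi) ^ CARD('n)) * (\<integral>x. f x * cnj (gaussian_mean f s x) \<partial>lborel)"
    by (rule integral_mult_right_zero)
  finally show "complex_of_real (\<integral>\<xi>. ?G \<xi> * (norm (fourier_L1 f \<xi>))\<^sup>2 \<partial>lborel)
      = complex_of_real ((2 * pi) ^ CARD('n)) * (\<integral>x. f x * cnj (gaussian_mean f s x) \<partial>lborel)" .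
qed

lemma gaussian_mean_bound:
  fixes f :: "real^'n \<Rightarrow> complex"
  assumes [measurable]: "f \<in> borel_measurable borel" and B: "\<And>x. norm (f x) \<le> B"
  shows "norm (gaussian_mean f s x) \<le> B"
proof -
  have B0: "0 \<le> B" using B[of 0] norm_ge_zero order_trans by blast
  have "norm (gaussian_mean f s x) \<le> (\<integral>w. norm (f (x + s *\<^sub>R w) * complex_of_real (std_gaussian w)) \<partial>lborel)"
    unfolding gaussian_mean_def by (rule integral_norm_bound)
  also have "\<dots> \<le> (\<integral>w. B * std_gaussian (w::real^'n) \<partial>lborel)"
    using B B0 std_gaussian_nonneg integrable_std_gaussian[where 'a="real^'n"]
    by (intro Bochner_Integration.integral_mono') (auto simp: norm_mult intro!: mult_mono mult_nonneg_nonneg)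
  also have "\<dots> = B" by (simp add: integral_std_gaussian)
  finally show ?thesis .
qed

lemma gaussian_mean_tendsto:
  fixes f :: "real^'n \<Rightarrow> complex"
  assumes cont: "continuous_on UNIV f" and B: "\<And>x. norm (f x) \<le> B" and s: "s \<longlonglongrightarrow> 0"
  shows "(\<lambda>k. gaussian_mean f (s k) x) \<longlonglongrightarrow> f x"
proof -
  have [measurable]: "f \<in> borel_measurable borel" by (rule borel_measurable_continuous_onI[OF cont])
  have lim: "(\<lambda>k. gaussian_mean f (s k) x) \<longlonglongrightarrow> (\<integral>w. f x * complex_of_real (std_gaussian (w::real^'n)) \<partial>lborel)"
    unfolding gaussian_mean_def
  proof (rule integral_dominated_convergence[where w="\<lambda>w::real^'n. B * std_gaussian w"])
    show "AE w in lborel. (\<lambda>k. f (x + s k *\<^sub>R w) * complex_of_real (std_gaussian w))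
        \<longlonglongrightarrow> f x * complex_of_real (std_gaussian w)"
    proof (intro AE_I2 tendsto_intros)
      fix w :: "real^'n"
      have "(\<lambda>k. x + s k *\<^sub>R w) \<longlonglongrightarrow> x + 0 *\<^sub>R w" by (intro tendsto_intros s)
      then have "(\<lambda>k. x + s k *\<^sub>R w) \<longlonglongrightarrow> x" by simp
      then show "(\<lambda>k. f (x + s k *\<^sub>R w)) \<longlonglongrightarrow> f x"
        using cont by (intro isCont_tendsto_compose[of x f]) (simp_all add: continuous_on_eq_continuous_at)
    qed
    show "AE w in lborel. norm (f (x + s k *\<^sub>R w) * complex_of_real (std_gaussian w)) \<le> B * std_gaussian w" for k
      using B std_gaussian_nonneg[where 'a="real^'n"] by (auto simp: norm_mult intro!: mult_right_mono)
  qed (auto simp: integrable_std_gaussian)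
  have "(\<integral>w. f x * complex_of_real (std_gaussian (w::real^'n)) \<partial>lborel) = f x"
    using integral_std_gaussian[where 'a="real^'n"] by (simp only: integral_mult_right_zero integral_complex_of_real) simp
  then show ?thesis using lim by (simp only:)
qed

lemma measurable_gaussian_mean [measurable]:
  fixes f :: "real^'n \<Rightarrow> complex"
  assumes [measurable]: "f \<in> borel_measurable borel"
  shows "gaussian_mean f s \<in> borel_measurable borel"
proof -
  have "(\<lambda>x. \<integral>w. f (x + s *\<^sub>R w) * complex_of_real (std_gaussian w) \<partial>lborel) \<in> borel_measurable borel"
    by measurable
  then show ?thesis by (simp add: gaussian_mean_def[abs_def])
qed

text \<open>The damping is removed along s = 1 / (k + 1). On the frequency side it increases to 1,
  so monotone convergence yields integrability together with the value. On the other side continuity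
  makes the Gaussian means converge to f pointwise, and B |f| dominates the products.\<close>

lemma plancherel_continuous:
  fixes f :: "real^'n \<Rightarrow> complex"
  assumes f: "integrable lborel f" and cont: "continuous_on UNIV f" and B: "\<And>x. norm (f x) \<le> B"
  shows "fourier_L1 f \<in> L2" and "norm_L2 (fourier_L1 f) = sqrt ((2 * pi) ^ CARD('n)) * norm_L2 f"
proof -
  note [measurable] = borel_measurable_integrable[OF f] measurable_fourier_L1[OF f, simplified]
  have [measurable]: "cnj \<in> borel_measurable borel"
    by (intro borel_measurable_continuous_onI continuous_intros)
  define s where "s k = 1 / real (Suc k)" for k
  have s: "s k > 0" for k by (simp add: s_def)
  have s0: "s \<longlonglongrightarrow> 0" unfolding s_def using LIMSEQ_inverse_real_of_nat by (simp add: inverse_eq_divide)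
  define F where "F k \<xi> = exp (- (s k * norm \<xi>)\<^sup>2 / 2) * (norm (fourier_L1 f \<xi>))\<^sup>2" for k and \<xi> :: "real^'n"
  let ?I = "(2 * pi) ^ CARD('n) * (norm_L2 f)\<^sup>2"
  have "(\<lambda>k. \<integral>x. f x * cnj (gaussian_mean f (s k) x) \<partial>lborel) \<longlonglongrightarrow> (\<integral>x. f x * cnj (f x) \<partial>lborel)"
  proof (rule integral_dominated_convergence[where w="\<lambda>x. norm (f x) * B"])
    show "AE x in lborel. (\<lambda>k. f x * cnj (gaussian_mean f (s k) x)) \<longlonglongrightarrow> f x * cnj (f x)"
      by (intro AE_I2 tendsto_intros gaussian_mean_tendsto[OF cont B s0])
    show "AE x in lborel. norm (f x * cnj (gaussian_mean f (s k) x)) \<le> norm (f x) * B" for k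
      by (auto simp: norm_mult intro!: mult_left_mono gaussian_mean_bound B)
  qed (use f in auto)
  moreover have "(\<integral>x. f x * cnj (f x) \<partial>lborel) = complex_of_real ((norm_L2 f)\<^sup>2)"
    unfolding norm_L2_squared complex_norm_square[symmetric] by (rule integral_complex_of_real)
  ultimately have "(\<lambda>k. complex_of_real ((2 * pi) ^ CARD('n)) * (\<integral>x. f x * cnj (gaussian_mean f (s k) x) \<partial>lborel))
     \<longlonglongrightarrow> complex_of_real ((2 * pi) ^ CARD('n)) * complex_of_real ((norm_L2 f)\<^sup>2)"
    by (intro tendsto_intros) simp
  then have "(\<lambda>k. complex_of_real (integral\<^sup>L lborel (F k))) \<longlonglongrightarrow> complex_of_real ?I"
    unfolding F_def damped_plancherel(2)[OF f s] by (simp only: of_real_mult)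
  then have lim: "(\<lambda>k. integral\<^sup>L lborel (F k)) \<longlonglongrightarrow> ?I"
    using tendsto_of_real_iff by blast
  have int: "integrable lborel (F k)" for k
    unfolding F_def by (rule damped_plancherel(1)[OF f s])
  have mono: "AE \<xi> in lborel. mono (\<lambda>k. F k \<xi>)"
  proof (intro AE_I2 monoI)
    fix \<xi> :: "real^'n" and j k :: nat assume "j \<le> k"
    then have "s k \<le> s j" by (simp add: s_def frac_le)
    then have "(s k * norm \<xi>)\<^sup>2 \<le> (s j * norm \<xi>)\<^sup>2"
      using s[of k] by (intro power_mono mult_right_mono) auto
    then show "F j \<xi> \<le> F k \<xi>" unfolding F_def by (intro mult_right_mono) auto
  qed
  have Flim: "AE \<xi> in lborel. (\<lambda>k. F k \<xi>) \<longlonglongrightarrow> (norm (fourier_L1 f \<xi>))\<^sup>2"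
  proof (rule AE_I2)
    fix \<xi> :: "real^'n"
    have "(\<lambda>k. F k \<xi>) \<longlonglongrightarrow> exp (- (0 * norm \<xi>)\<^sup>2 / 2) * (norm (fourier_L1 f \<xi>))\<^sup>2"
      unfolding F_def by (intro tendsto_intros s0) auto
    then show "(\<lambda>k. F k \<xi>) \<longlonglongrightarrow> (norm (fourier_L1 f \<xi>))\<^sup>2" by simp
  qed
  have meas: "(\<lambda>\<xi>. (norm (fourier_L1 f \<xi>))\<^sup>2) \<in> borel_measurable lborel" by measurable
  have "integrable lborel (\<lambda>\<xi>. (norm (fourier_L1 f \<xi>))\<^sup>2)"
    by (rule integrable_monotone_convergence[OF int mono Flim lim meas])
  then show "fourier_L1 f \<in> L2" by (intro L2I) auto
  have "(norm_L2 (fourier_L1 f))\<^sup>2 = ?I"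
    unfolding norm_L2_squared[of "fourier_L1 f"] by (rule integral_monotone_convergence[OF int mono Flim lim meas])
  then have "norm_L2 (fourier_L1 f) = sqrt ?I" using norm_L2_nonneg by (metis real_sqrt_unique)
  then show "norm_L2 (fourier_L1 f) = sqrt ((2 * pi) ^ CARD('n)) * norm_L2 f"
    by (simp add: real_sqrt_mult norm_L2_nonneg)
qed

text \<open>Approximation and Fatou give only the inequality \<le>, but for every function in L^1
  and L^2. Applied to \<psi> - f with \<psi> continuous and close to f, it shows that the transforms
  are close as well, and the reverse inequality follows from the equality for \<psi>.\<close>

lemma plancherel_L1_L2:
  fixes f :: "real^'n \<Rightarrow> complex"
  assumes f: "integrable lborel f" "f \<in> L2"
  shows "fourier_L1 f \<in> L2" and "norm_L2 (fourier_L1 f) = sqrt ((2 * pi) ^ CARD('n)) * norm_L2 f"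
proof -
  let ?c = "sqrt ((2 * pi) ^ CARD('n))"
  have bound: "fourier_L1 f \<in> L2 \<and> norm_L2 (fourier_L1 f) \<le> ?c * norm_L2 f"
    if f: "integrable lborel f" "f \<in> L2" for f :: "real^'n \<Rightarrow> complex"
  proof -
    have "\<forall>k. \<exists>\<psi>. continuous_on UNIV \<psi> \<and> (\<exists>B. \<forall>x. norm (\<psi> x) \<le> B) \<and> integrable lborel \<psi> \<and> \<psi> \<in> L2 \<and>
      norm_L2 (\<lambda>x. \<psi> x - f x) < 1 / real (Suc k) \<and> (\<integral>x. norm (\<psi> x - f x) \<partial>lborel) < 1 / real (Suc k)"
    proof
      fix k :: nat
      show "\<exists>\<psi>. continuous_on UNIV \<psi> \<and> (\<exists>B. \<forall>x. norm (\<psi> x) \<le> B) \<and> integrable lborel \<psi> \<and> \<psi> \<in> L2 \<and>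
        norm_L2 (\<lambda>x. \<psi> x - f x) < 1 / real (Suc k) \<and> (\<integral>x. norm (\<psi> x - f x) \<partial>lborel) < 1 / real (Suc k)"
        using L2_continuous_approx[OF f(2), of "1 / real (Suc k)"] f(1) by simp
    qed
    then obtain \<psi> where \<psi>: "\<And>k. continuous_on UNIV (\<psi> k)" "\<And>k. \<exists>B. \<forall>x. norm (\<psi> k x) \<le> B"
      "\<And>k. integrable lborel (\<psi> k)" "\<And>k. \<psi> k \<in> L2"
      "\<And>k. norm_L2 (\<lambda>x. \<psi> k x - f x) < 1 / real (Suc k)"
      "\<And>k. (\<integral>x. norm (\<psi> k x - f x) \<partial>lborel) < 1 / real (Suc k)"
      by (auto dest!: choice)
    have inv: "(\<lambda>k. 1 / real (Suc k)) \<longlonglongrightarrow> 0"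
      using LIMSEQ_inverse_real_of_nat by (simp add: inverse_eq_divide)
    have P: "fourier_L1 (\<psi> k) \<in> L2" "norm_L2 (fourier_L1 (\<psi> k)) = ?c * norm_L2 (\<psi> k)" for k
      using plancherel_continuous[OF \<psi>(3,1)] \<psi>(2)[of k] by blast+
    have "(\<lambda>k. fourier_L1 (\<psi> k) \<xi>) \<longlonglongrightarrow> fourier_L1 f \<xi>" for \<xi>
    proof -
      have "(\<lambda>k. fourier_L1 (\<psi> k) \<xi> - fourier_L1 f \<xi>) \<longlonglongrightarrow> 0"
      proof (rule Lim_null_comparison[OF _ inv], rule always_eventually, rule allI)
        fix k
        have "norm (fourier_L1 (\<psi> k) \<xi> - fourier_L1 f \<xi>) \<le> (\<integral>x. norm (\<psi> k x - f x) \<partial>lborel)"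
          using norm_fourier_L1_le[of "\<lambda>x. \<psi> k x - f x" \<xi>] by (simp add: fourier_L1_diff \<psi> f)
        then show "norm (fourier_L1 (\<psi> k) \<xi> - fourier_L1 f \<xi>) \<le> 1 / real (Suc k)"
          using \<psi>(6)[of k] by linarith
      qed
      then show ?thesis using LIM_zero_iff by blast
    qed
    then have lim: "AE \<xi> in lborel. (\<lambda>k. fourier_L1 (\<psi> k) \<xi>) \<longlonglongrightarrow> fourier_L1 f \<xi>" by simp
    have "(\<lambda>k. norm_L2 (\<lambda>x. \<psi> k x - f x)) \<longlonglongrightarrow> 0"
      using \<psi>(5) by (intro Lim_null_comparison[OF _ inv]) (auto simp: norm_L2_nonneg less_imp_le)
    then have "(\<lambda>k. norm_L2 (\<psi> k)) \<longlonglongrightarrow> norm_L2 f" by (rule norm_L2_tendsto[OF \<psi>(4) f(2)])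
    then have "(\<lambda>k. ?c * norm_L2 (\<psi> k)) \<longlonglongrightarrow> ?c * norm_L2 f" by (intro tendsto_intros)
    from L2_liminf_bound[OF measurable_fourier_L1[OF f(1)] P(1) lim eq_refl[OF P(2)] this] show ?thesis ..
  qed
  show L: "fourier_L1 f \<in> L2" using bound[OF f] ..
  have "?c * norm_L2 f \<le> norm_L2 (fourier_L1 f)"
  proof (rule field_le_epsilon)
    fix e :: real assume "e > 0"
    \<comment> \<open>The error \<open>?c * d\<close> occurs twice: once when f is replaced by
      \<psi>, and once when the transform of \<psi> is replaced by that of f.\<close>
    define d where "d = e / (2 * ?c)"
    have d: "d > 0" "2 * ?c * d = e" using \<open>e > 0\<close> by (auto simp: d_def)
    obtain \<psi> where \<psi>: "continuous_on UNIV \<psi>" "\<exists>B. \<forall>x. norm (\<psi> x) \<le> B" "integrable lborel \<psi>" "\<psi> \<in> L2"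
      "norm_L2 (\<lambda>x. \<psi> x - f x) < d"
      using L2_continuous_approx[OF f(2) d(1)] by blast
    have P: "fourier_L1 \<psi> \<in> L2" "norm_L2 (fourier_L1 \<psi>) = ?c * norm_L2 \<psi>"
      using plancherel_continuous[OF \<psi>(3,1)] \<psi>(2) by blast+
    have "(\<lambda>\<xi>. fourier_L1 (\<lambda>x. \<psi> x - f x) \<xi>) = (\<lambda>\<xi>. fourier_L1 \<psi> \<xi> - fourier_L1 f \<xi>)"
      by (simp add: fourier_L1_diff \<psi> f)
    then have "norm_L2 (\<lambda>\<xi>. fourier_L1 \<psi> \<xi> - fourier_L1 f \<xi>) \<le> ?c * norm_L2 (\<lambda>x. \<psi> x - f x)"
      using bound[of "\<lambda>x. \<psi> x - f x"] \<psi> f L2_diff[OF \<psi>(4) f(2)] by simp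
    also have "\<dots> \<le> ?c * d" using \<psi>(5) by (intro mult_left_mono) auto
    finally have 1: "norm_L2 (\<lambda>\<xi>. fourier_L1 \<psi> \<xi> - fourier_L1 f \<xi>) \<le> ?c * d" .
    have "norm_L2 f \<le> norm_L2 \<psi> + d"
      using norm_L2_triangle_abs[OF \<psi>(4) f(2)] \<psi>(5) by linarith
    then have "?c * norm_L2 f \<le> ?c * (norm_L2 \<psi> + d)" by (intro mult_left_mono) auto
    then show "?c * norm_L2 f \<le> norm_L2 (fourier_L1 f) + e"
      using norm_L2_triangle_abs[OF P(1) L] 1 P(2) d(2) by (simp add: distrib_left)
  qed
  with bound[OF f] show "norm_L2 (fourier_L1 f) = ?c * norm_L2 f" by simp
qed

section \<open>The Fourier transform on square-integrable functions\<close>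

lemma is_fourier_L1:
  "integrable lborel f \<Longrightarrow> f \<in> L2 \<Longrightarrow> is_fourier f (fourier_L1 f)"
  unfolding is_fourier_def using plancherel_L1_L2(1)[of f] by (auto intro!: exI[of _ "\<lambda>_. f"])

lemma is_fourier_norm:
  fixes f :: "real^'n \<Rightarrow> complex"
  assumes "is_fourier f g"
  shows "norm_L2 g = sqrt ((2 * pi) ^ CARD('n)) * norm_L2 f"
proof -
  obtain \<phi> where L: "f \<in> L2" "g \<in> L2" and \<phi>: "\<And>k. \<phi> k \<in> L2" "\<And>k. integrable lborel (\<phi> k)" "\<And>k. fourier_L1 (\<phi> k) \<in> L2"
    "(\<lambda>k. norm_L2 (\<lambda>x. \<phi> k x - f x)) \<longlonglongrightarrow> 0" "(\<lambda>k. norm_L2 (\<lambda>\<xi>. fourier_L1 (\<phi> k) \<xi> - g \<xi>)) \<longlonglongrightarrow> 0"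
    using assms by (auto simp: is_fourier_def)
  have "(\<lambda>k. norm_L2 (fourier_L1 (\<phi> k))) \<longlonglongrightarrow> norm_L2 g"
    using \<phi> L by (intro norm_L2_tendsto) auto
  moreover have "(\<lambda>k. sqrt ((2 * pi) ^ CARD('n)) * norm_L2 (\<phi> k)) \<longlonglongrightarrow> sqrt ((2 * pi) ^ CARD('n)) * norm_L2 f"
    using \<phi> L by (intro tendsto_intros norm_L2_tendsto) auto
  ultimately show ?thesis
    unfolding plancherel_L1_L2(2)[OF \<phi>(2,1)] by (rule LIMSEQ_unique)
qed

lemma is_fourier_combine:
  assumes 1: "is_fourier f1 g1" and 2: "is_fourier f2 g2"
  shows "is_fourier (\<lambda>x. a * f1 x + b * f2 x) (\<lambda>\<xi>. a * g1 \<xi> + b * g2 \<xi>)"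
proof -
  obtain \<phi> where L1: "f1 \<in> L2" "g1 \<in> L2" and \<phi>: "\<And>k. \<phi> k \<in> L2" "\<And>k. integrable lborel (\<phi> k)" "\<And>k. fourier_L1 (\<phi> k) \<in> L2"
    "(\<lambda>k. norm_L2 (\<lambda>x. \<phi> k x - f1 x)) \<longlonglongrightarrow> 0" "(\<lambda>k. norm_L2 (\<lambda>\<xi>. fourier_L1 (\<phi> k) \<xi> - g1 \<xi>)) \<longlonglongrightarrow> 0"
    using 1 by (auto simp: is_fourier_def)
  obtain \<psi> where L2: "f2 \<in> L2" "g2 \<in> L2" and \<psi>: "\<And>k. \<psi> k \<in> L2" "\<And>k. integrable lborel (\<psi> k)" "\<And>k. fourier_L1 (\<psi> k) \<in> L2"
    "(\<lambda>k. norm_L2 (\<lambda>x. \<psi> k x - f2 x)) \<longlonglongrightarrow> 0" "(\<lambda>k. norm_L2 (\<lambda>\<xi>. fourier_L1 (\<psi> k) \<xi> - g2 \<xi>)) \<longlonglongrightarrow> 0"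
    using 2 by (auto simp: is_fourier_def)
  have combine: "(\<lambda>k. norm_L2 (\<lambda>x. a * p k x + b * q k x - (a * f x + b * g x))) \<longlonglongrightarrow> 0"
    if "\<And>k. p k \<in> L2" "\<And>k. q k \<in> L2" "f \<in> L2" "g \<in> L2"
      "(\<lambda>k. norm_L2 (\<lambda>x. p k x - f x)) \<longlonglongrightarrow> 0" "(\<lambda>k. norm_L2 (\<lambda>x. q k x - g x)) \<longlonglongrightarrow> 0"
    for p q f g
  proof (rule Lim_null_comparison)
    have "(\<lambda>k. norm a * norm_L2 (\<lambda>x. p k x - f x) + norm b * norm_L2 (\<lambda>x. q k x - g x)) \<longlonglongrightarrow> norm a * 0 + norm b * 0"
      by (intro tendsto_intros that)
    then show "(\<lambda>k. norm a * norm_L2 (\<lambda>x. p k x - f x) + norm b * norm_L2 (\<lambda>x. q k x - g x)) \<longlonglongrightarrow> 0" by simp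
    show "eventually (\<lambda>k. norm (norm_L2 (\<lambda>x. a * p k x + b * q k x - (a * f x + b * g x)))
      \<le> norm a * norm_L2 (\<lambda>x. p k x - f x) + norm b * norm_L2 (\<lambda>x. q k x - g x)) sequentially"
    proof (rule always_eventually, rule allI)
      fix k
      have "norm_L2 (\<lambda>x. a * (p k x - f x) + b * (q k x - g x))
        \<le> norm_L2 (\<lambda>x. a * (p k x - f x)) + norm_L2 (\<lambda>x. b * (q k x - g x))"
        by (intro norm_L2_triangle L2_mult L2_diff that)
      then show "norm (norm_L2 (\<lambda>x. a * p k x + b * q k x - (a * f x + b * g x)))
        \<le> norm a * norm_L2 (\<lambda>x. p k x - f x) + norm b * norm_L2 (\<lambda>x. q k x - g x)"
        unfolding norm_L2_mult by (simp add: norm_L2_nonneg algebra_simps)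
    qed
  qed
  have F: "fourier_L1 (\<lambda>x. a * \<phi> k x + b * \<psi> k x) = (\<lambda>\<xi>. a * fourier_L1 (\<phi> k) \<xi> + b * fourier_L1 (\<psi> k) \<xi>)" for k
    using \<phi>(2) \<psi>(2) by (simp add: fun_eq_iff fourier_L1_add fourier_L1_mult)
  show ?thesis
    unfolding is_fourier_def
  proof (intro conjI exI[of _ "\<lambda>k x. a * \<phi> k x + b * \<psi> k x"] allI)
    show "(\<lambda>x. a * f1 x + b * f2 x) \<in> L2" "(\<lambda>\<xi>. a * g1 \<xi> + b * g2 \<xi>) \<in> L2"
      by (intro L2_add L2_mult L1 L2)+
    show "(\<lambda>x. a * \<phi> k x + b * \<psi> k x) \<in> L2" for k by (intro L2_add L2_mult \<phi> \<psi>)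
    show "fourier_L1 (\<lambda>x. a * \<phi> k x + b * \<psi> k x) \<in> L2" for k unfolding F by (intro L2_add L2_mult \<phi> \<psi>)
    show "integrable lborel (\<lambda>x. a * \<phi> k x + b * \<psi> k x)" for k using \<phi>(2) \<psi>(2) by simp
    show "(\<lambda>k. norm_L2 (\<lambda>x. a * \<phi> k x + b * \<psi> k x - (a * f1 x + b * f2 x))) \<longlonglongrightarrow> 0"
      by (intro combine \<phi> \<psi> L1 L2)
    show "(\<lambda>k. norm_L2 (\<lambda>\<xi>. fourier_L1 (\<lambda>x. a * \<phi> k x + b * \<psi> k x) \<xi> - (a * g1 \<xi> + b * g2 \<xi>))) \<longlonglongrightarrow> 0"
      unfolding F by (intro combine \<phi> \<psi> L1 L2)
  qed
qed

text \<open>By linearity the difference of the transforms is a transform of the difference, and the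
  isometry gives it norm 0. This determines the arbitrary choice in \<open>fourier\<close> up to
  null sets.\<close>

lemma is_fourier_AE_unique:
  fixes f1 f2 :: "real^'n \<Rightarrow> complex"
  assumes 1: "is_fourier f1 g1" and 2: "is_fourier f2 g2" and eq: "AE x in lborel. f1 x = f2 x"
  shows "AE \<xi> in lborel. g1 \<xi> = g2 \<xi>"
proof -
  have L: "f1 \<in> L2" "f2 \<in> L2" "g1 \<in> L2" "g2 \<in> L2" using 1 2 by (auto simp: is_fourier_def)
  have "is_fourier (\<lambda>x. f1 x - f2 x) (\<lambda>\<xi>. g1 \<xi> - g2 \<xi>)"
    using is_fourier_combine[OF 1 2, of 1 "-1"] by simp
  then have "norm_L2 (\<lambda>\<xi>. g1 \<xi> - g2 \<xi>) = sqrt ((2 * pi) ^ CARD('n)) * norm_L2 (\<lambda>x. f1 x - f2 x)"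
    by (rule is_fourier_norm)
  also have "norm_L2 (\<lambda>x. f1 x - f2 x) = 0"
    using eq by (subst norm_L2_eq_0[OF L2_diff[OF L(1,2)]]) auto
  finally have "AE \<xi> in lborel. g1 \<xi> - g2 \<xi> = 0"
    using norm_L2_eq_0[OF L2_diff[OF L(3,4)]] by simp
  then show ?thesis by simp
qed

text \<open>The isometry turns an approximating sequence in L^1 and L^2 into a Cauchy sequence of
  transforms; completeness supplies the limit.\<close>

lemma is_fourier_exists:
  fixes f :: "real^'n \<Rightarrow> complex"
  assumes f: "f \<in> L2" shows "\<exists>g. is_fourier f g"
proof -
  let ?c = "sqrt ((2 * pi) ^ CARD('n))"
  have "\<forall>k. \<exists>\<psi>. integrable lborel \<psi> \<and> \<psi> \<in> L2 \<and> norm_L2 (\<lambda>x. \<psi> x - f x) < 1 / real (Suc k)"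
  proof
    fix k :: nat
    show "\<exists>\<psi>. integrable lborel \<psi> \<and> \<psi> \<in> L2 \<and> norm_L2 (\<lambda>x. \<psi> x - f x) < 1 / real (Suc k)"
      using L2_continuous_approx[OF f, of "1 / real (Suc k)"] by auto
  qed
  then obtain \<psi> where \<psi>: "\<And>k. integrable lborel (\<psi> k)" "\<And>k. \<psi> k \<in> L2"
    "\<And>k. norm_L2 (\<lambda>x. \<psi> k x - f x) < 1 / real (Suc k)"
    by (auto dest!: choice)
  have inv: "(\<lambda>k. 1 / real (Suc k)) \<longlonglongrightarrow> 0"
    using LIMSEQ_inverse_real_of_nat by (simp add: inverse_eq_divide)
  have lim: "(\<lambda>k. norm_L2 (\<lambda>x. \<psi> k x - f x)) \<longlonglongrightarrow> 0"
    using \<psi>(3) by (intro Lim_null_comparison[OF _ inv]) (auto simp: norm_L2_nonneg less_imp_le)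
  have P: "fourier_L1 (\<psi> k) \<in> L2" for k by (rule plancherel_L1_L2(1)[OF \<psi>(1,2)])
  have "\<exists>g\<in>L2. (\<lambda>k. norm_L2 (\<lambda>\<xi>. fourier_L1 (\<psi> k) \<xi> - g \<xi>)) \<longlonglongrightarrow> 0"
  proof (rule L2_complete[OF P])
    fix e :: real assume "e > 0"
    then have "eventually (\<lambda>k. norm_L2 (\<lambda>x. \<psi> k x - f x) < e / (2 * ?c)) sequentially"
      by (intro order_tendstoD[OF lim]) auto
    then obtain N where N: "\<And>k. k \<ge> N \<Longrightarrow> norm_L2 (\<lambda>x. \<psi> k x - f x) < e / (2 * ?c)"
      by (auto simp: eventually_sequentially)
    have "norm_L2 (\<lambda>\<xi>. fourier_L1 (\<psi> m) \<xi> - fourier_L1 (\<psi> n) \<xi>) < e" if "m \<ge> N" "n \<ge> N" for m n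
    proof -
      have "norm_L2 (\<lambda>x. \<psi> m x - \<psi> n x) < e / (2 * ?c) + e / (2 * ?c)"
        using norm_L2_triangle_diff[OF \<psi>(2)[of m] f \<psi>(2)[of n]] N[OF that(1)] N[OF that(2)]
          norm_L2_commute[of f "\<psi> n"] by linarith
      then have "?c * norm_L2 (\<lambda>x. \<psi> m x - \<psi> n x) < ?c * (e / (2 * ?c) + e / (2 * ?c))"
        by (intro mult_strict_left_mono) auto
      also have "\<dots> = e" by simp
      finally have "?c * norm_L2 (\<lambda>x. \<psi> m x - \<psi> n x) < e" .
      moreover have "fourier_L1 (\<lambda>x. \<psi> m x - \<psi> n x) = (\<lambda>\<xi>. fourier_L1 (\<psi> m) \<xi> - fourier_L1 (\<psi> n) \<xi>)"
        using \<psi>(1) by (simp add: fun_eq_iff fourier_L1_diff)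
      ultimately show ?thesis
        using plancherel_L1_L2(2)[of "\<lambda>x. \<psi> m x - \<psi> n x"] \<psi>(1) L2_diff[OF \<psi>(2) \<psi>(2)] by simp
    qed
    then show "\<exists>N. \<forall>m\<ge>N. \<forall>n\<ge>N. norm_L2 (\<lambda>\<xi>. fourier_L1 (\<psi> m) \<xi> - fourier_L1 (\<psi> n) \<xi>) < e" by blast
  qed
  then show ?thesis unfolding is_fourier_def using f \<psi>(1,2) P lim by blast
qed

lemma is_fourier_fourier: "f \<in> L2 \<Longrightarrow> is_fourier f (fourier f)"
  unfolding fourier_def by (rule someI_ex[OF is_fourier_exists])

lemma fourier_L2: "f \<in> L2 \<Longrightarrow> fourier f \<in> L2"
  using is_fourier_fourier[of f] by (simp add: is_fourier_def)

lemma norm_L2_fourier: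
  "f \<in> L2 \<Longrightarrow> norm_L2 (fourier (f :: real^'n \<Rightarrow> complex)) = sqrt ((2 * pi) ^ CARD('n)) * norm_L2 f"
  using is_fourier_norm is_fourier_fourier by blast

lemma fourier_combine:
  assumes "f \<in> L2" "g \<in> L2"
  shows "AE \<xi> in lborel. fourier (\<lambda>x. a * f x + b * g x) \<xi> = a * fourier f \<xi> + b * fourier g \<xi>"
proof (rule is_fourier_AE_unique)
  show "is_fourier (\<lambda>x. a * f x + b * g x) (fourier (\<lambda>x. a * f x + b * g x))"
    by (intro is_fourier_fourier L2_add L2_mult assms)
  show "is_fourier (\<lambda>x. a * f x + b * g x) (\<lambda>\<xi>. a * fourier f \<xi> + b * fourier g \<xi>)"
    by (intro is_fourier_combine is_fourier_fourier assms)
qed simp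

lemma fourier_cong:
  assumes "f \<in> L2" "g \<in> L2" "AE x in lborel. f x = g x"
  shows "AE \<xi> in lborel. fourier f \<xi> = fourier g \<xi>"
  by (intro is_fourier_AE_unique[OF is_fourier_fourier is_fourier_fourier] assms)

lemma fourier_eq_fourier_L1:
  assumes "integrable lborel f" "f \<in> L2"
  shows "AE \<xi> in lborel. fourier f \<xi> = fourier_L1 f \<xi>"
  by (rule is_fourier_AE_unique[OF is_fourier_fourier is_fourier_L1]) (simp_all add: assms)

section \<open>Transport equations in L^2 with a bounded multiplier\<close>

lemma norm_exp_minus_one_le:
  fixes w :: complex
  shows "norm (exp w - 1) \<le> norm w * exp (norm w)"
  using Taylor_exp_field[of w 0] by (simp add: mult.commute)

lemma norm_exp_remainder_le:
  fixes w :: complex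
  shows "norm (exp w - 1 - w) \<le> (norm w)\<^sup>2 * exp (norm w)"
  using Taylor_exp_field[of w 1] by (simp add: power2_eq_square algebra_simps)

text \<open>Put d = s - t and let Q be the error of the difference quotient, so that
  \<open>z1 = z0 + d (Q + g)\<close>. With exp(-l t) = exp(-l s) exp(l d) the increment becomes
  exp(-l s) (d Q + d g + (1 - exp(l d)) z0). In general this is O(|d|). If g = l z0, the first-order
  terms cancel and only d Q and a remainder of order d^2 are left. The factor exp(K (t + 1)) bounds
  exp(-l s), as s is at most t + 1.\<close>

lemma multiplier_increment:
  fixes z0 z1 g :: "real^'n \<Rightarrow> complex"
  assumes L: "z0 \<in> L2" "z1 \<in> L2" "g \<in> L2"
    and l: "l \<in> borel_measurable lborel" "\<And>\<xi>. norm (l \<xi>) \<le> K"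
    and st: "0 \<le> s" "0 \<le> t" "s \<noteq> t" "\<bar>s - t\<bar> \<le> 1"
  defines "D \<equiv> norm_L2 (\<lambda>\<xi>. (z1 \<xi> - z0 \<xi>) /\<^sub>R (s - t) - g \<xi>)"
    and "E \<equiv> norm_L2 (\<lambda>\<xi>. exp (- (l \<xi> * s)) * z1 \<xi> - exp (- (l \<xi> * t)) * z0 \<xi>)"
  shows "E \<le> \<bar>s - t\<bar> * exp (K * (t + 1)) * (D + norm_L2 g + K * exp K * norm_L2 z0)"
    and "AE \<xi> in lborel. g \<xi> = l \<xi> * z0 \<xi> \<Longrightarrow>
      E \<le> \<bar>s - t\<bar> * exp (K * (t + 1)) * (D + K\<^sup>2 * exp K * norm_L2 z0 * \<bar>s - t\<bar>)"
proof -
  note [measurable] = L2_measurable[OF L(1)] L2_measurable[OF L(2)] L2_measurable[OF L(3)] l(1)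
  have K: "0 \<le> K" using l(2)[of 0] norm_ge_zero order_trans by blast
  define d where "d = s - t"
  have d: "d \<noteq> 0" "\<bar>d\<bar> \<le> 1" "s = t + d" using st by (auto simp: d_def)
  define Q where "Q \<xi> = (z1 \<xi> - z0 \<xi>) /\<^sub>R d - g \<xi>" for \<xi>
  have QL: "Q \<in> L2"
    unfolding Q_def using L2_mult[OF L2_diff[OF L(2,1)], of "inverse d"]
    by (intro L2_diff L) (simp add: scaleR_conv_of_real)
  have [measurable]: "Q \<in> borel_measurable lborel" by (rule L2_measurable[OF QL])
  have z1: "z1 \<xi> = z0 \<xi> + of_real d * (Q \<xi> + g \<xi>)" for \<xi>
    using d(1) by (simp add: Q_def scaleR_conv_of_real field_simps)
  let ?C = "exp (K * (t + 1))"
  have es: "norm (exp (- (l \<xi> * s))) \<le> ?C" for \<xi>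
  proof -
    have "norm (exp (- (l \<xi> * s))) \<le> exp (norm (l \<xi> * s))"
      using norm_exp[of "- (l \<xi> * s)"] by simp
    also have "norm (l \<xi> * s) \<le> K * (t + 1)"
    proof -
      have "norm (complex_of_real s) \<le> t + 1" unfolding norm_of_real using st by linarith
      then show ?thesis using l(2)[of \<xi>] K unfolding norm_mult by (intro mult_mono) auto
    qed
    finally show ?thesis by simp
  qed
  have ld: "norm (l \<xi> * d) \<le> K * \<bar>d\<bar>" for \<xi>
    using l(2)[of \<xi>] by (simp add: norm_mult mult_right_mono)
  have eld: "exp (norm (l \<xi> * d)) \<le> exp K" for \<xi>
    using ld[of \<xi>] mult_left_mono[OF d(2) K] by simp
  have et: "exp (- (l \<xi> * t)) = exp (- (l \<xi> * s)) * exp (l \<xi> * d)" for \<xi>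
    unfolding d(3) by (simp add: algebra_simps flip: exp_add)
  let ?e = "\<lambda>\<xi>. exp (- (l \<xi> * complex_of_real s))"
  have sL: "(\<lambda>\<xi>. of_real d * (?e \<xi> * Q \<xi>)) \<in> L2" "(\<lambda>\<xi>. of_real d * (?e \<xi> * g \<xi>)) \<in> L2"
    using QL L(3) es by (auto intro!: L2_mult L2_mult_bounded[of _ _ ?C])
  have nQ: "norm_L2 (\<lambda>\<xi>. of_real d * (?e \<xi> * Q \<xi>)) \<le> \<bar>d\<bar> * (?C * D)"
    unfolding norm_L2_mult D_def d_def[symmetric] Q_def[symmetric]
    using es by (auto intro!: mult_left_mono norm_L2_mono_mult[OF QL] simp: norm_mult mult_right_mono)
  show "E \<le> \<bar>s - t\<bar> * ?C * (D + norm_L2 g + K * exp K * norm_L2 z0)"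
  proof -
    let ?r = "\<lambda>\<xi>. ?e \<xi> * (1 - exp (l \<xi> * d)) * z0 \<xi>"
    have b: "norm (?r \<xi>) \<le> (\<bar>d\<bar> * (?C * (K * exp K))) * norm (z0 \<xi>)" for \<xi>
    proof -
      have "norm (1 - exp (l \<xi> * d)) \<le> norm (l \<xi> * d) * exp (norm (l \<xi> * d))"
        using norm_exp_minus_one_le[of "l \<xi> * d"] by (simp add: norm_minus_commute)
      also have "\<dots> \<le> (K * \<bar>d\<bar>) * exp K" using ld eld K by (intro mult_mono) auto
      finally have "norm (?e \<xi>) * norm (1 - exp (l \<xi> * d)) \<le> ?C * ((K * \<bar>d\<bar>) * exp K)"
        using es by (intro mult_mono) auto
      then have "norm (?e \<xi>) * norm (1 - exp (l \<xi> * d)) * norm (z0 \<xi>) \<le> ?C * ((K * \<bar>d\<bar>) * exp K) * norm (z0 \<xi>)"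
        by (intro mult_right_mono) auto
      then show ?thesis by (simp add: norm_mult mult_ac)
    qed
    have rL: "?r \<in> L2" by (rule L2_dominated[OF L(1)]) (use b in auto)
    have nr: "norm_L2 ?r \<le> (\<bar>d\<bar> * (?C * (K * exp K))) * norm_L2 z0"
      using K by (intro norm_L2_mono_mult[OF L(1)] AE_I2 b) auto
    have ng: "norm_L2 (\<lambda>\<xi>. of_real d * (?e \<xi> * g \<xi>)) \<le> \<bar>d\<bar> * (?C * norm_L2 g)"
      unfolding norm_L2_mult
      using es by (auto intro!: mult_left_mono norm_L2_mono_mult[OF L(3)] simp: norm_mult mult_right_mono)
    have "E = norm_L2 (\<lambda>\<xi>. (of_real d * (?e \<xi> * Q \<xi>) + of_real d * (?e \<xi> * g \<xi>)) + ?r \<xi>)"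
      unfolding E_def et z1 by (intro arg_cong[where f=norm_L2] ext) (simp add: algebra_simps)
    also have "\<dots> \<le> norm_L2 (\<lambda>\<xi>. of_real d * (?e \<xi> * Q \<xi>) + of_real d * (?e \<xi> * g \<xi>)) + norm_L2 ?r"
      by (intro norm_L2_triangle L2_add sL rL)
    also have "norm_L2 (\<lambda>\<xi>. of_real d * (?e \<xi> * Q \<xi>) + of_real d * (?e \<xi> * g \<xi>))
      \<le> norm_L2 (\<lambda>\<xi>. of_real d * (?e \<xi> * Q \<xi>)) + norm_L2 (\<lambda>\<xi>. of_real d * (?e \<xi> * g \<xi>))"
      by (intro norm_L2_triangle sL)
    finally have "E \<le> \<bar>d\<bar> * (?C * D) + \<bar>d\<bar> * (?C * norm_L2 g) + (\<bar>d\<bar> * (?C * (K * exp K))) * norm_L2 z0"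
      using nQ ng nr by linarith
    then show ?thesis by (simp add: d_def[symmetric] algebra_simps)
  qed
  show "E \<le> \<bar>s - t\<bar> * ?C * (D + K\<^sup>2 * exp K * norm_L2 z0 * \<bar>s - t\<bar>)" if eq: "AE \<xi> in lborel. g \<xi> = l \<xi> * z0 \<xi>"
  proof -
    let ?r = "\<lambda>\<xi>. ?e \<xi> * (1 + l \<xi> * d - exp (l \<xi> * d)) * z0 \<xi>"
    have b: "norm (?r \<xi>) \<le> (\<bar>d\<bar> * (?C * (K\<^sup>2 * \<bar>d\<bar> * exp K))) * norm (z0 \<xi>)" for \<xi>
    proof -
      have "norm (1 + l \<xi> * d - exp (l \<xi> * d)) = norm (exp (l \<xi> * d) - 1 - l \<xi> * d)"
        by (subst norm_minus_commute) (simp add: algebra_simps)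
      also have "\<dots> \<le> (norm (l \<xi> * d))\<^sup>2 * exp (norm (l \<xi> * d))" by (rule norm_exp_remainder_le)
      also have "\<dots> \<le> (K * \<bar>d\<bar>)\<^sup>2 * exp K" using ld eld K by (intro mult_mono power_mono) auto
      finally have "norm (?e \<xi>) * norm (1 + l \<xi> * d - exp (l \<xi> * d)) \<le> ?C * ((K * \<bar>d\<bar>)\<^sup>2 * exp K)"
        using es by (intro mult_mono) auto
      then have "norm (?e \<xi>) * norm (1 + l \<xi> * d - exp (l \<xi> * d)) * norm (z0 \<xi>) \<le> ?C * ((K * \<bar>d\<bar>)\<^sup>2 * exp K) * norm (z0 \<xi>)"
        by (intro mult_right_mono) auto
      moreover have "?C * ((K * \<bar>d\<bar>)\<^sup>2 * exp K) = \<bar>d\<bar> * (?C * (K\<^sup>2 * \<bar>d\<bar> * exp K))"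
        by (simp only: power2_eq_square mult_ac)
      ultimately show ?thesis by (simp only: norm_mult)
    qed
    have rL: "?r \<in> L2" by (rule L2_dominated[OF L(1)]) (use b in auto)
    have nr: "norm_L2 ?r \<le> (\<bar>d\<bar> * (?C * (K\<^sup>2 * \<bar>d\<bar> * exp K))) * norm_L2 z0"
      by (intro norm_L2_mono_mult[OF L(1)] AE_I2 b) auto
    have "E = norm_L2 (\<lambda>\<xi>. of_real d * (?e \<xi> * Q \<xi>) + ?r \<xi>)"
      unfolding E_def
    proof (rule norm_L2_cong_AE)
      show "AE \<xi> in lborel. ?e \<xi> * z1 \<xi> - exp (- (l \<xi> * t)) * z0 \<xi> = of_real d * (?e \<xi> * Q \<xi>) + ?r \<xi>"
        using eq
      proof eventually_elim
        case (elim \<xi>)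
        show ?case unfolding et z1 elim by (simp add: algebra_simps)
      qed
    qed measurable
    also have "\<dots> \<le> norm_L2 (\<lambda>\<xi>. of_real d * (?e \<xi> * Q \<xi>)) + norm_L2 ?r"
      by (intro norm_L2_triangle sL rL)
    finally have "E \<le> \<bar>d\<bar> * (?C * D) + (\<bar>d\<bar> * (?C * (K\<^sup>2 * \<bar>d\<bar> * exp K))) * norm_L2 z0"
      using nQ nr by linarith
    then show ?thesis by (simp add: d_def[symmetric] algebra_simps)
  qed
qed

text \<open>By the reverse triangle inequality, increments of the scalar function \<open>N\<close>
  are at most the L^2 norms of the increments of y. So \<open>N\<close> has derivative 0 without any
  differentiability of the norm itself, and ordinary one-variable calculus shows that it is
  constant.\<close>

lemma transport_solution:
  fixes z g :: "real \<Rightarrow> real^'n \<Rightarrow> complex"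
  assumes L: "\<And>t. 0 \<le> t \<Longrightarrow> z t \<in> L2" "\<And>t. 0 \<le> t \<Longrightarrow> g t \<in> L2"
    and l: "l \<in> borel_measurable lborel" "\<And>\<xi>. norm (l \<xi>) \<le> K"
    and der: "\<And>t. 0 \<le> t \<Longrightarrow>
      ((\<lambda>s. norm_L2 (\<lambda>\<xi>. (z s \<xi> - z t \<xi>) /\<^sub>R (s - t) - g t \<xi>)) \<longlongrightarrow> 0) (at t within {0..})"
    and eq: "\<And>t. 0 < t \<Longrightarrow> AE \<xi> in lborel. g t \<xi> = l \<xi> * z t \<xi>"
    and T: "0 \<le> T"
  shows "AE \<xi> in lborel. z T \<xi> = exp (l \<xi> * T) * z 0 \<xi>"
proof -
  note [measurable] = l(1)
  define y where "y t \<xi> = exp (- (l \<xi> * complex_of_real t)) * z t \<xi>" for t \<xi>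
  have yL: "y t \<in> L2" if "0 \<le> t" for t
    unfolding y_def
  proof (rule L2_mult_bounded[OF L(1)[OF that], of _ "exp (K * t)"])
    fix \<xi>
    have "norm (exp (- (l \<xi> * complex_of_real t))) \<le> exp (norm (l \<xi> * complex_of_real t))"
      using norm_exp[of "- (l \<xi> * complex_of_real t)"] by simp
    also have "\<dots> \<le> exp (K * t)" using l(2)[of \<xi>] that by (simp add: norm_mult mult_right_mono)
    finally show "norm (exp (- (l \<xi> * complex_of_real t))) \<le> exp (K * t)" .
  qed measurable
  define N where "N t = norm_L2 (\<lambda>\<xi>. y t \<xi> - y 0 \<xi>)" for t
  have Ndiff: "\<bar>N s - N t\<bar> \<le> norm_L2 (\<lambda>\<xi>. y s \<xi> - y t \<xi>)" if "0 \<le> s" "0 \<le> t" for s t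
    using norm_L2_triangle_abs[OF L2_diff[OF yL[OF that(1)] yL[of 0]] L2_diff[OF yL[OF that(2)] yL[of 0]]]
    by (simp add: N_def)
  define D where "D t s = norm_L2 (\<lambda>\<xi>. (z s \<xi> - z t \<xi>) /\<^sub>R (s - t) - g t \<xi>)" for t s
  have near: "eventually (\<lambda>s. 0 \<le> s \<and> s \<noteq> t \<and> \<bar>s - t\<bar> \<le> 1) (at t within {0..})" for t :: real
    unfolding eventually_at by (intro exI[of _ 1]) (auto simp: dist_real_def)
  \<comment> \<open>The equation is assumed only for positive times, so at 0 the first, cruder
    increment bound is used. It gives continuity there, which is enough for constancy on
    [0, T].\<close>
  have N0: "(N \<longlongrightarrow> N 0) (at 0 within {0..})"
  proof -
    let ?B = "\<lambda>s. \<bar>s - 0\<bar> * exp (K * (0 + 1)) * (D 0 s + norm_L2 (g 0) + K * exp K * norm_L2 (z 0))"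
    have "((\<lambda>s. N s - N 0) \<longlongrightarrow> 0) (at 0 within {0..})"
    proof (rule Lim_null_comparison)
      show "eventually (\<lambda>s. norm (N s - N 0) \<le> ?B s) (at 0 within {0..})"
        using near[of 0]
      proof eventually_elim
        case (elim s)
        have "norm_L2 (\<lambda>\<xi>. y s \<xi> - y 0 \<xi>) \<le> ?B s"
          unfolding D_def y_def
          by (rule multiplier_increment(1)) (use elim L l in auto)
        then show ?case using Ndiff[of s 0] elim by simp
      qed
      have "(?B \<longlongrightarrow> \<bar>0 - 0\<bar> * exp (K * (0 + 1)) * (0 + norm_L2 (g 0) + K * exp K * norm_L2 (z 0))) (at 0 within {0..})"
        using der[of 0] unfolding D_def by (intro tendsto_intros) auto
      then show "(?B \<longlongrightarrow> 0) (at 0 within {0..})" by simp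
    qed
    then show ?thesis using LIM_zero_iff by blast
  qed
  have Nder: "DERIV N t :> 0" if t: "0 < t" for t
  proof -
    let ?B = "\<lambda>s. exp (K * (t + 1)) * (D t s + K\<^sup>2 * exp K * norm_L2 (z t) * \<bar>s - t\<bar>)"
    have "((\<lambda>s. (N s - N t) / (s - t)) \<longlongrightarrow> 0) (at t within {0..})"
    proof (rule Lim_null_comparison)
      show "eventually (\<lambda>s. norm ((N s - N t) / (s - t)) \<le> ?B s) (at t within {0..})"
        using near[of t]
      proof eventually_elim
        case (elim s)
        have "norm_L2 (\<lambda>\<xi>. y s \<xi> - y t \<xi>) \<le> \<bar>s - t\<bar> * exp (K * (t + 1)) * (D t s + K\<^sup>2 * exp K * norm_L2 (z t) * \<bar>s - t\<bar>)"
          unfolding D_def y_def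
          by (rule multiplier_increment(2)) (use elim L l eq t in auto)
        then have "\<bar>N s - N t\<bar> \<le> \<bar>s - t\<bar> * ?B s" using Ndiff[of s t] elim t by (simp add: mult.assoc)
        then show ?case using elim by (simp add: divide_le_eq mult.commute)
      qed
      have "(?B \<longlongrightarrow> exp (K * (t + 1)) * (0 + K\<^sup>2 * exp K * norm_L2 (z t) * \<bar>t - t\<bar>)) (at t within {0..})"
        using der[of t] t unfolding D_def by (intro tendsto_intros) auto
      then show "(?B \<longlongrightarrow> 0) (at t within {0..})" by simp
    qed
    \<comment> \<open>For positive t the one-sided filter of the curve derivative is the full
      neighbourhood filter, so \<open>N\<close> is differentiable in the usual sense.\<close>
    moreover have "at t within {0..} = at t" using t by (intro at_within_interior) (simp add: interior_Ici[of 0 "-1"])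
    ultimately show ?thesis by (simp add: has_field_derivative_iff)
  qed
  have "N T = 0"
  proof (cases "T = 0")
    case False
    have "continuous_on {0..T} N"
      unfolding continuous_on_def
    proof
      fix x assume x: "x \<in> {0..T}"
      show "(N \<longlongrightarrow> N x) (at x within {0..T})"
      proof (cases "x = 0")
        case True
        then show ?thesis using tendsto_within_subset[OF N0, of "{0..T}"] by auto
      next
        case False
        then have "isCont N x" using Nder[of x] x by (intro DERIV_isCont) auto
        then show ?thesis by (simp add: isCont_def tendsto_within_subset[where S=UNIV])
      qed
    qed
    then have "N T = N 0" using T False Nder by (intro DERIV_isconst_end) auto
    then show ?thesis by (simp add: N_def)
  qed (simp add: N_def)
  then have "AE \<xi> in lborel. y T \<xi> - y 0 \<xi> = 0"
    using norm_L2_eq_0[OF L2_diff[OF yL[OF T] yL[of 0]]] by (simp add: N_def)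
  then show ?thesis
  proof eventually_elim
    case (elim \<xi>)
    then have "exp (- (l \<xi> * T)) * z T \<xi> = z 0 \<xi>" by (simp add: y_def)
    then have "exp (l \<xi> * T) * exp (- (l \<xi> * T)) * z T \<xi> = exp (l \<xi> * T) * z 0 \<xi>" by simp
    then show ?case by (simp flip: exp_add)
  qed
qed

section \<open>The characteristic roots\<close>

text \<open>A quarter of the discriminant of the characteristic polynomial; its square root is half
  the distance between the roots.\<close>

definition char_disc :: "real \<Rightarrow> real" where
  "char_disc a = (1 / (1 + a))\<^sup>2 / 4 - a"

text \<open>The explicit real and imaginary cases let real parts and moduli of the roots be read off
  directly in the overdamped and in the oscillating regime.\<close>

definition disc_root :: "real \<Rightarrow> complex" where
  "disc_root a = (if 0 \<le> char_disc a then complex_of_real (sqrt (char_disc a))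
     else \<i> * complex_of_real (sqrt (- char_disc a)))"

text \<open>For \<open>\<sigma> = \<plusminus>1\<close> these are the roots of \<open>\<lambda>\<^sup>2 + \<lambda> / (1 + a) + a\<close>.\<close>

definition char_root :: "real \<Rightarrow> real \<Rightarrow> complex" where
  "char_root \<sigma> a = complex_of_real (- (1 / (1 + a)) / 2) + complex_of_real \<sigma> * disc_root a"

lemma disc_root_squared: "(disc_root a)\<^sup>2 = complex_of_real (char_disc a)"
  by (simp add: disc_root_def power_mult_distrib flip: of_real_power)

lemma char_root_sum: "char_root \<sigma> a + char_root (- \<sigma>) a = - complex_of_real (1 / (1 + a))"
proof -
  have "(complex_of_real (- c / 2) + complex_of_real \<sigma> * r) + (complex_of_real (- c / 2) + complex_of_real (- \<sigma>) * r)
    = - complex_of_real c" for c r by (simp add: field_simps)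
  then show ?thesis unfolding char_root_def .
qed

lemma char_root_prod:
  assumes "\<sigma>\<^sup>2 = 1" shows "char_root \<sigma> a * char_root (- \<sigma>) a = complex_of_real a"
proof -
  have "char_root \<sigma> a * char_root (- \<sigma>) a
    = (complex_of_real (- (1 / (1 + a)) / 2))\<^sup>2 - complex_of_real (\<sigma>\<^sup>2) * (disc_root a)\<^sup>2"
    by (simp add: char_root_def power2_eq_square algebra_simps)
  also have "\<dots> = complex_of_real ((1 / (1 + a))\<^sup>2 / 4) - complex_of_real (char_disc a)"
  proof -
    have "(complex_of_real (- c / 2))\<^sup>2 = complex_of_real (c\<^sup>2 / 4)" for c by (simp add: power_divide)
    then show ?thesis by (simp only: assms disc_root_squared of_real_1 mult_1)
  qed
  also have "\<dots> = complex_of_real a" by (simp add: char_disc_def)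
  finally show ?thesis .
qed

text \<open>Linear growth is a crude bound, but it is applied only where a is bounded: on a ball of
  frequencies and for a at most 1.\<close>

lemma norm_char_root_le:
  assumes "0 \<le> a" "\<bar>\<sigma>\<bar> = 1" shows "norm (char_root \<sigma> a) \<le> 2 + a"
proof -
  have b: "0 \<le> 1 / (1 + a)" "1 / (1 + a) \<le> 1" using assms by auto
  then have b2: "(1 / (1 + a))\<^sup>2 \<le> 1" by (simp add: power_le_one)
  have "(norm (disc_root a))\<^sup>2 = \<bar>char_disc a\<bar>"
    using disc_root_squared[of a] by (metis norm_of_real norm_power)
  also have "\<dots> \<le> (1 + a)\<^sup>2"
  proof -
    have "\<bar>X / 4 - a\<bar> \<le> 1 + a\<^sup>2 + 2 * a" if "0 \<le> X" "X \<le> 1" for X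
      using that assms(1) zero_le_power2[of a] by linarith
    from this[OF zero_le_power2 b2] show ?thesis unfolding char_disc_def power2_sum by simp
  qed
  finally have "norm (disc_root a) \<le> 1 + a" by (rule power2_le_imp_le) (use assms in auto)
  moreover have "norm (complex_of_real (- (1 / (1 + a)) / 2)) \<le> 1"
  proof -
    have "\<bar>- c / 2\<bar> \<le> 1" if "0 \<le> c" "c \<le> 1" for c :: real using that by linarith
    from this[OF b] show ?thesis unfolding norm_of_real .
  qed
  ultimately show ?thesis
    unfolding char_root_def using norm_triangle_ineq[of "complex_of_real (- (1 / (1 + a)) / 2)" "complex_of_real \<sigma> * disc_root a"] assms
    by (simp add: norm_mult)
qed

lemma measurable_char_root [measurable]: "char_root \<sigma> \<in> borel_measurable borel"
  unfolding char_root_def[abs_def] disc_root_def char_disc_def by measurable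

lemma log_symbol_nonneg: "0 \<le> log_symbol \<xi>"
  by (simp add: log_symbol_def)

lemma measurable_log_symbol [measurable]: "log_symbol \<in> borel_measurable borel"
  unfolding log_symbol_def[abs_def] by measurable

lemma log_symbol_le: "norm \<xi> \<le> r \<Longrightarrow> log_symbol \<xi> \<le> ln (1 + r\<^sup>2)"
  unfolding log_symbol_def by (intro ln_mono add_mono power_mono) (auto simp: add_pos_nonneg)

section \<open>The solution formula\<close>

lemma Y_imp_L2: "f \<in> Y \<delta> \<Longrightarrow> f \<in> L2"
  by (simp add: Y_def)

lemma Y_combine:
  fixes f g :: "real^'n \<Rightarrow> complex"
  assumes f: "f \<in> Y \<delta>" and g: "g \<in> Y \<delta>"
  shows "(\<lambda>x. a * f x + b * g x) \<in> Y \<delta>"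
proof -
  have L: "f \<in> L2" "g \<in> L2" using f g by (auto simp: Y_def)
  have S: "(\<lambda>x. a * f x + b * g x) \<in> L2" by (intro L2_add L2_mult L)
  note [measurable] = L2_measurable[OF fourier_L2[OF L(1)], simplified] L2_measurable[OF fourier_L2[OF L(2)], simplified]
    L2_measurable[OF fourier_L2[OF S], simplified]
  let ?w = "\<lambda>\<xi>. (1 + log_symbol \<xi>) powr \<delta>"
  have "integrable lborel (\<lambda>\<xi>. ?w \<xi> * (norm (fourier (\<lambda>x. a * f x + b * g x) \<xi>))\<^sup>2)"
  proof (rule Bochner_Integration.integrable_bound)
    show "integrable lborel (\<lambda>\<xi>. 2 * (norm a)\<^sup>2 * (?w \<xi> * (norm (fourier f \<xi>))\<^sup>2)
      + 2 * (norm b)\<^sup>2 * (?w \<xi> * (norm (fourier g \<xi>))\<^sup>2))"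
      using f g by (auto simp: Y_def)
    show "AE \<xi> in lborel. norm (?w \<xi> * (norm (fourier (\<lambda>x. a * f x + b * g x) \<xi>))\<^sup>2)
      \<le> norm (2 * (norm a)\<^sup>2 * (?w \<xi> * (norm (fourier f \<xi>))\<^sup>2)
      + 2 * (norm b)\<^sup>2 * (?w \<xi> * (norm (fourier g \<xi>))\<^sup>2))"
      using fourier_combine[OF L, of a b]
    proof eventually_elim
      case (elim \<xi>)
      have "?w \<xi> * (norm (a * fourier f \<xi> + b * fourier g \<xi>))\<^sup>2
        \<le> ?w \<xi> * (2 * (norm (a * fourier f \<xi>))\<^sup>2 + 2 * (norm (b * fourier g \<xi>))\<^sup>2)"
        by (intro mult_left_mono norm_add_squared_le) auto
      then show ?case unfolding elim by (simp add: norm_mult power_mult_distrib algebra_simps)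
    qed
  qed measurable
  then show ?thesis using S by (simp add: Y_def)
qed

lemma norm_L2_fourier_le_norm_Y:
  fixes f :: "real^'n \<Rightarrow> complex"
  assumes f: "f \<in> Y \<delta>" and "0 \<le> \<delta>"
  shows "norm_L2 (fourier f) \<le> norm_Y \<delta> f"
  unfolding norm_L2_def norm_Y_def
proof (intro real_sqrt_le_mono integral_mono)
  show "integrable lborel (\<lambda>\<xi>. (norm (fourier f \<xi>))\<^sup>2)"
    using f by (intro L2_integrable fourier_L2 Y_imp_L2)
  show "integrable lborel (\<lambda>\<xi>. (1 + log_symbol \<xi>) powr \<delta> * (norm (fourier f \<xi>))\<^sup>2)"
    using f by (simp add: Y_def)
  fix \<xi> :: "real^'n"
  have "1 \<le> (1 + log_symbol \<xi>) powr \<delta>" using assms log_symbol_nonneg[of \<xi>] by (simp add: ge_one_powr_ge_zero)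
  then show "(norm (fourier f \<xi>))\<^sup>2 \<le> (1 + log_symbol \<xi>) powr \<delta> * (norm (fourier f \<xi>))\<^sup>2"
    using mult_right_mono[of 1 _ "(norm (fourier f \<xi>))\<^sup>2"] by simp
qed

lemma fourier_difference_quotient:
  fixes f0 f1 g :: "real^'n \<Rightarrow> complex"
  assumes L: "f0 \<in> L2" "f1 \<in> L2" "g \<in> L2"
  shows "AE \<xi> in lborel. fourier (\<lambda>x. (f1 x - f0 x) /\<^sub>R h - g x) \<xi>
    = (fourier f1 \<xi> - fourier f0 \<xi>) /\<^sub>R h - fourier g \<xi>"
proof -
  let ?c = "complex_of_real (inverse h)"
  have eq: "(\<lambda>x. (f1 x - f0 x) /\<^sub>R h - g x) = (\<lambda>x. 1 * (?c * f1 x + (- ?c) * f0 x) + (-1) * g x)"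
    by (auto simp: fun_eq_iff scaleR_conv_of_real algebra_simps)
  have "(\<lambda>x. ?c * f1 x + (- ?c) * f0 x) \<in> L2" by (intro L2_add L2_mult L)
  from fourier_combine[OF this L(3), of 1 "-1"] fourier_combine[OF L(2,1), of ?c "- ?c"]
  show ?thesis
    unfolding eq
  proof eventually_elim
    case (elim \<xi>)
    show ?case unfolding elim by (simp add: scaleR_conv_of_real algebra_simps)
  qed
qed

text \<open>Both kinds of derivative are brought to the same form, convergence of difference
  quotients of transforms in L^2: for \<open>Y 1\<close> because the weight is at least 1, for
  \<open>L2\<close> by Plancherel.\<close>

lemma fourier_curve_derivative:
  fixes u :: "real \<Rightarrow> real^'n \<Rightarrow> complex"
  shows "curve_derivative (Y 1) (norm_Y 1) u v \<Longrightarrow> 0 \<le> t \<Longrightarrow>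
      ((\<lambda>s. norm_L2 (\<lambda>\<xi>. (fourier (u s) \<xi> - fourier (u t) \<xi>) /\<^sub>R (s - t) - fourier (v t) \<xi>)) \<longlongrightarrow> 0) (at t within {0..})"
    and "curve_derivative L2 norm_L2 u v \<Longrightarrow> 0 \<le> t \<Longrightarrow>
      ((\<lambda>s. norm_L2 (\<lambda>\<xi>. (fourier (u s) \<xi> - fourier (u t) \<xi>) /\<^sub>R (s - t) - fourier (v t) \<xi>)) \<longlongrightarrow> 0) (at t within {0..})"
proof -
  assume t: "0 \<le> t"
  let ?q = "\<lambda>s x. (u s x - u t x) /\<^sub>R (s - t) - v t x"
  let ?Q = "\<lambda>s \<xi>. (fourier (u s) \<xi> - fourier (u t) \<xi>) /\<^sub>R (s - t) - fourier (v t) \<xi>"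
  have ge0: "eventually (\<lambda>s. 0 \<le> s) (at t within {0..})"
    unfolding eventually_at by (intro exI[of _ 1]) auto
  have qeq: "?q s = (\<lambda>x. 1 * (complex_of_real (inverse (s - t)) * u s x + (- complex_of_real (inverse (s - t))) * u t x) + (-1) * v t x)" for s
    by (auto simp: fun_eq_iff scaleR_conv_of_real algebra_simps)
  have Q: "norm_L2 (?Q s) = norm_L2 (fourier (?q s))" if L: "\<forall>t\<ge>0. u t \<in> L2 \<and> v t \<in> L2" and s: "0 \<le> s" for s
  proof -
    have L': "u s \<in> L2" "u t \<in> L2" "v t \<in> L2" using L s t by auto
    have qL: "?q s \<in> L2" unfolding qeq by (intro L2_add L2_mult L')
    note [measurable] = L2_measurable[OF fourier_L2[OF L'(1)], simplified] L2_measurable[OF fourier_L2[OF L'(2)], simplified]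
      L2_measurable[OF fourier_L2[OF L'(3)], simplified] L2_measurable[OF fourier_L2[OF qL], simplified]
    show ?thesis
      by (rule norm_L2_cong_AE) (use fourier_difference_quotient[OF L'(2,1,3), of "s - t"] in \<open>auto elim: AE_mp\<close>)
  qed
  { assume c: "curve_derivative (Y 1) (norm_Y 1) u v"
    then have Ys: "\<forall>t\<ge>0. u t \<in> Y 1 \<and> v t \<in> Y 1" by (auto simp: curve_derivative_def)
    show "((\<lambda>s. norm_L2 (?Q s)) \<longlongrightarrow> 0) (at t within {0..})"
    proof (rule Lim_null_comparison)
      show "((\<lambda>s. norm_Y 1 (?q s)) \<longlongrightarrow> 0) (at t within {0..})" using c t by (auto simp: curve_derivative_def)
      show "eventually (\<lambda>s. norm (norm_L2 (?Q s)) \<le> norm_Y 1 (?q s)) (at t within {0..})"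
        using ge0
      proof eventually_elim
        case (elim s)
        \<comment> \<open>Outside \<open>Y 1\<close>, \<open>norm_Y\<close> could be the default
          value 0 of a non-integrable integral and would bound nothing.\<close>
        have "?q s \<in> Y 1" unfolding qeq using Ys elim t by (intro Y_combine) auto
        then have "norm_L2 (fourier (?q s)) \<le> norm_Y 1 (?q s)" by (intro norm_L2_fourier_le_norm_Y) auto
        moreover have "norm_L2 (?Q s) = norm_L2 (fourier (?q s))"
          using Ys Y_imp_L2 by (intro Q elim) blast
        ultimately show ?case by (simp add: norm_L2_nonneg)
      qed
    qed }
  { assume c: "curve_derivative L2 norm_L2 u v"
    then have L: "\<forall>t\<ge>0. u t \<in> L2 \<and> v t \<in> L2" by (auto simp: curve_derivative_def)
    let ?c = "sqrt ((2 * pi) ^ CARD('n))"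
    show "((\<lambda>s. norm_L2 (?Q s)) \<longlongrightarrow> 0) (at t within {0..})"
    proof (rule Lim_null_comparison)
      have "((\<lambda>s. ?c * norm_L2 (?q s)) \<longlongrightarrow> ?c * 0) (at t within {0..})"
        using c t by (intro tendsto_intros) (auto simp: curve_derivative_def)
      then show "((\<lambda>s. ?c * norm_L2 (?q s)) \<longlongrightarrow> 0) (at t within {0..})" by simp
      show "eventually (\<lambda>s. norm (norm_L2 (?Q s)) \<le> ?c * norm_L2 (?q s)) (at t within {0..})"
        using ge0
      proof eventually_elim
        case (elim s)
        have "?q s \<in> L2" unfolding qeq using L elim t by (intro L2_add L2_mult) auto
        from norm_L2_fourier[OF this] Q[OF L elim] show ?case
          by (simp add: abs_mult norm_L2_nonneg)
      qed
    qed }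
qed

lemma fourier_equation:
  fixes f g h :: "real^'n \<Rightarrow> complex"
  assumes v: "L_graph f v" and w: "resolvent_graph g w" and L: "h \<in> L2"
    and eq: "AE x in lborel. h x + v x + w x = 0"
  shows "AE \<xi> in lborel. fourier h \<xi> = - (of_real (log_symbol \<xi>) * fourier f \<xi>) - of_real (1 / (1 + log_symbol \<xi>)) * fourier g \<xi>"
proof -
  have vL: "v \<in> L2" and vF: "AE \<xi> in lborel. fourier v \<xi> = of_real (log_symbol \<xi>) * fourier f \<xi>"
    using v by (auto simp: L_graph_def)
  obtain k where gL: "g \<in> L2" and k: "L_graph w k" and sum: "AE x in lborel. w x + k x = g x"
    using w by (auto simp: resolvent_graph_def)
  have wL: "w \<in> L2" "k \<in> L2" and kF: "AE \<xi> in lborel. fourier k \<xi> = of_real (log_symbol \<xi>) * fourier w \<xi>"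
    using k by (auto simp: L_graph_def)
  have s1: "AE \<xi> in lborel. fourier (\<lambda>x. 1 * w x + 1 * k x) \<xi> = fourier g \<xi>"
    using sum by (intro fourier_cong L2_add L2_mult wL gL) auto
  have s2: "AE \<xi> in lborel. fourier (\<lambda>x. (-1) * v x + (-1) * w x) \<xi> = fourier h \<xi>"
  proof (intro fourier_cong L2_add L2_mult wL vL L)
    show "AE x in lborel. (-1) * v x + (-1) * w x = h x"
      using eq
    proof eventually_elim
      case (elim x)
      then have "h x = - (v x + w x)" by (simp only: eq_neg_iff_add_eq_0 add.assoc)
      then show ?case by simp
    qed
  qed
  from s1 s2 vF kF fourier_combine[OF wL, of 1 1] fourier_combine[OF vL wL(1), of "-1" "-1"]
  show ?thesis
  proof eventually_elim
    case (elim \<xi>)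
    let ?a = "log_symbol \<xi>"
    \<comment> \<open>The transform of w + L w = g; dividing by 1 + a, which is at least 1, recovers
      the multiplier of the resolvent.\<close>
    have "fourier g \<xi> = (1 + of_real ?a) * fourier w \<xi>" using elim(1,4,5) by (simp add: algebra_simps)
    moreover have "1 + complex_of_real ?a \<noteq> 0"
      using log_symbol_nonneg[of \<xi>] by (metis add_nonneg_eq_0_iff of_real_1 of_real_add of_real_eq_0_iff zero_le_one zero_neq_one)
    ultimately have gw: "of_real (1 / (1 + ?a)) * fourier g \<xi> = fourier w \<xi>" by simp
    have hw: "fourier h \<xi> = - fourier v \<xi> - fourier w \<xi>" using elim(2,6) by simp
    show ?case unfolding hw gw elim(3) ..
  qed
qed

text \<open>With l and m the roots for \<sigma> and -\<sigma>, their sum and product turn the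
  equation into u_tt^ = (l + m) u_t^ - l m u^. Hence z = u_t^ - m u^ has derivative u_tt^ - m u_t^ =
  l z. The sign \<sigma> covers both combinations at once. The cutoff to the ball makes l and m
  bounded multipliers.\<close>

lemma solution_transport_ball:
  fixes u ut utt :: "real \<Rightarrow> real^'n \<Rightarrow> complex"
  assumes ut: "curve_derivative (Y 1) (norm_Y 1) u ut"
    and utt: "curve_derivative L2 norm_L2 ut utt"
    and eq: "\<And>t. 0 < t \<Longrightarrow> \<exists>v w. L_graph (u t) v \<and> resolvent_graph (ut t) w \<and> (AE x in lborel. utt t x + v x + w x = 0)"
    and \<sigma>: "\<bar>\<sigma>\<bar> = 1" and t: "0 \<le> t" and R: "0 \<le> R"
  shows "AE \<xi> in lborel. norm \<xi> \<le> R \<longrightarrow>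
    fourier (ut t) \<xi> - char_root (- \<sigma>) (log_symbol \<xi>) * fourier (u t) \<xi>
    = exp (char_root \<sigma> (log_symbol \<xi>) * t) *
      (fourier (ut 0) \<xi> - char_root (- \<sigma>) (log_symbol \<xi>) * fourier (u 0) \<xi>)"
proof -
  have L: "fourier (u t) \<in> L2" "fourier (ut t) \<in> L2" "fourier (utt t) \<in> L2" "utt t \<in> L2" if "0 \<le> t" for t
    using ut utt that by (auto simp: curve_derivative_def intro!: fourier_L2 intro: Y_imp_L2)
  define I where "I \<xi> = complex_of_real (indicator (cball 0 R) \<xi>)" for \<xi> :: "real^'n"
  define m where "m \<xi> = I \<xi> * char_root (- \<sigma>) (log_symbol \<xi>)" for \<xi>
  define l where "l \<xi> = I \<xi> * char_root \<sigma> (log_symbol \<xi>)" for \<xi>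
  \<comment> \<open>The bound 2 + a for the roots, with a at most ln (1 + R^2) on the ball; outside
    the ball both multipliers vanish.\<close>
  define K where "K = 2 + ln (1 + R\<^sup>2)"
  have [measurable]: "cball (0::real^'n) R \<in> sets borel" by simp
  have [measurable]: "I \<in> borel_measurable borel" "m \<in> borel_measurable borel" "l \<in> borel_measurable borel"
    unfolding m_def l_def I_def by measurable
  have K0: "0 \<le> K" by (simp add: K_def add_nonneg_nonneg)
  have I1: "norm (I \<xi>) \<le> 1" for \<xi> by (simp add: I_def indicator_def)
  have root: "norm (I \<xi> * char_root \<tau> (log_symbol \<xi>)) \<le> K" if "\<bar>\<tau>\<bar> = 1" for \<tau> \<xi>
  proof (cases "norm \<xi> \<le> R")
    case True
    then show ?thesis
      using norm_char_root_le[OF log_symbol_nonneg that, of \<xi>] log_symbol_le[of \<xi> R] by (simp add: I_def K_def)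
  next
    case False
    then show ?thesis using K0 by (simp add: I_def)
  qed
  have mK: "norm (m \<xi>) \<le> K" and lK: "norm (l \<xi>) \<le> K" for \<xi>
    unfolding m_def l_def by (rule root, simp add: \<sigma>)+
  define z where "z t \<xi> = I \<xi> * fourier (ut t) \<xi> - m \<xi> * fourier (u t) \<xi>" for t \<xi>
  define g where "g t \<xi> = I \<xi> * fourier (utt t) \<xi> - m \<xi> * fourier (ut t) \<xi>" for t \<xi>
  have "AE \<xi> in lborel. z t \<xi> = exp (l \<xi> * t) * z 0 \<xi>"
  proof (rule transport_solution[where g=g and K=K])
    show "z t \<in> L2" if "0 \<le> t" for t
      unfolding z_def by (intro L2_diff L2_mult_bounded[OF L(2)[OF that] _ I1] L2_mult_bounded[OF L(1)[OF that] _ mK]) simp_all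
    show "g t \<in> L2" if "0 \<le> t" for t
      unfolding g_def by (intro L2_diff L2_mult_bounded[OF L(3)[OF that] _ I1] L2_mult_bounded[OF L(2)[OF that] _ mK]) simp_all
    show "l \<in> borel_measurable lborel" by simp
    show "norm (l \<xi>) \<le> K" for \<xi> by (rule lK)
    show "0 \<le> t" by (rule t)
    show "((\<lambda>s. norm_L2 (\<lambda>\<xi>. (z s \<xi> - z t \<xi>) /\<^sub>R (s - t) - g t \<xi>)) \<longlongrightarrow> 0) (at t within {0..})" if t: "0 \<le> t" for t
    proof (rule Lim_null_comparison)
      let ?U = "\<lambda>s \<xi>. (fourier (u s) \<xi> - fourier (u t) \<xi>) /\<^sub>R (s - t) - fourier (ut t) \<xi>"
      let ?V = "\<lambda>s \<xi>. (fourier (ut s) \<xi> - fourier (ut t) \<xi>) /\<^sub>R (s - t) - fourier (utt t) \<xi>"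
      have "((\<lambda>s. 1 * norm_L2 (?V s) + K * norm_L2 (?U s)) \<longlongrightarrow> 1 * 0 + K * 0) (at t within {0..})"
        by (intro tendsto_intros fourier_curve_derivative(1)[OF ut t] fourier_curve_derivative(2)[OF utt t])
      then show "((\<lambda>s. 1 * norm_L2 (?V s) + K * norm_L2 (?U s)) \<longlongrightarrow> 0) (at t within {0..})" by simp
      show "eventually (\<lambda>s. norm (norm_L2 (\<lambda>\<xi>. (z s \<xi> - z t \<xi>) /\<^sub>R (s - t) - g t \<xi>))
        \<le> 1 * norm_L2 (?V s) + K * norm_L2 (?U s)) (at t within {0..})"
        unfolding eventually_at
      proof (intro exI[of _ 1] conjI ballI impI)
        fix s :: real assume "s \<in> {0..}"
        then have s: "0 \<le> s" by simp
        let ?c = "complex_of_real (inverse (s - t))"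
        have scale: "(f \<xi> - h \<xi>) /\<^sub>R (s - t) = ?c * (f \<xi> - h \<xi>)" for f h :: "real^'n \<Rightarrow> complex" and \<xi>
          by (simp add: scaleR_conv_of_real)
        have VL: "?V s \<in> L2" and UL: "?U s \<in> L2"
          unfolding scale by (intro L2_diff L2_mult L s t)+
        have mV: "?V s \<in> borel_measurable borel" and mU: "?U s \<in> borel_measurable borel"
          using L2_measurable[OF VL] L2_measurable[OF UL] by simp_all
        have VL': "(\<lambda>\<xi>. I \<xi> * ?V s \<xi>) \<in> L2" and UL': "(\<lambda>\<xi>. m \<xi> * ?U s \<xi>) \<in> L2"
          by (intro L2_mult_bounded[OF VL _ I1], simp) (intro L2_mult_bounded[OF UL _ mK], simp)
        have "(\<lambda>\<xi>. (z s \<xi> - z t \<xi>) /\<^sub>R (s - t) - g t \<xi>) = (\<lambda>\<xi>. I \<xi> * ?V s \<xi> - m \<xi> * ?U s \<xi>)"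
          unfolding z_def g_def by (simp add: fun_eq_iff scaleR_conv_of_real algebra_simps)
        then have "norm_L2 (\<lambda>\<xi>. (z s \<xi> - z t \<xi>) /\<^sub>R (s - t) - g t \<xi>)
          \<le> norm_L2 (\<lambda>\<xi>. I \<xi> * ?V s \<xi>) + norm_L2 (\<lambda>\<xi>. m \<xi> * ?U s \<xi>)"
          using norm_L2_triangle_diff[OF VL' L2_zero UL'] norm_L2_commute[of "\<lambda>\<xi>. m \<xi> * ?U s \<xi>" "\<lambda>_. 0"]
          by simp
        also have "\<dots> \<le> 1 * norm_L2 (?V s) + K * norm_L2 (?U s)"
          using I1 mK K0 L2_measurable[OF VL'] L2_measurable[OF UL']
          by (intro add_mono norm_L2_mono_mult[OF VL] norm_L2_mono_mult[OF UL] AE_I2)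
            (auto simp: norm_mult simp del: norm_scaleR intro!: mult_right_mono mult_left_le_one_le)
        finally show "norm (norm_L2 (\<lambda>\<xi>. (z s \<xi> - z t \<xi>) /\<^sub>R (s - t) - g t \<xi>)) \<le> 1 * norm_L2 (?V s) + K * norm_L2 (?U s)"
          by (simp add: norm_L2_nonneg)
      qed simp
    qed
    show "AE \<xi> in lborel. g t \<xi> = l \<xi> * z t \<xi>" if t: "0 < t" for t
    proof -
      obtain v w where "L_graph (u t) v" "resolvent_graph (ut t) w" "AE x in lborel. utt t x + v x + w x = 0"
        using eq[OF t] by auto
      from fourier_equation[OF this(1,2) L(4)[OF less_imp_le[OF t]] this(3)] show ?thesis
      proof eventually_elim
        case (elim \<xi>)
        let ?a = "log_symbol \<xi>"
        let ?l = "char_root \<sigma> ?a" and ?m = "char_root (- \<sigma>) ?a"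
        \<comment> \<open>The damping and the symbol are replaced by the sum and the product of the
          roots; the equation then factors and \<open>g = l z\<close> is pure algebra.\<close>
        have b: "- complex_of_real (1 / (1 + ?a)) = ?l + ?m" and a: "complex_of_real ?a = ?l * ?m"
          using char_root_sum[of \<sigma> ?a] char_root_prod[of \<sigma> ?a] \<sigma> by (auto simp: abs_square_eq_1)
        have "fourier (utt t) \<xi> = - (?l * ?m) * fourier (u t) \<xi> + (?l + ?m) * fourier (ut t) \<xi>"
          unfolding a[symmetric] b[symmetric] using elim by simp
        moreover have "I \<xi> = 0 \<or> I \<xi> = 1" by (simp add: I_def indicator_def)
        ultimately show ?case by (auto simp: g_def z_def l_def m_def algebra_simps)
      qed
    qed
  qed
  then show ?thesis
  proof eventually_elim
    case (elim \<xi>)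
    then show ?case by (auto simp: z_def l_def m_def I_def)
  qed
qed

text \<open>A double root forces 4 a (1 + a)^2 = 1. The left side is strictly increasing for a \<ge>
  0, so all such frequencies have the same norm and lie on one sphere, which is a null set.\<close>

lemma AE_char_roots_distinct: "AE \<xi> in lborel. char_root 1 (log_symbol \<xi>) \<noteq> char_root (-1) (log_symbol (\<xi> :: real^'n))"
proof -
  have inj: "norm \<xi> = norm \<eta>" if eq: "char_root 1 (log_symbol \<xi>) = char_root (-1) (log_symbol \<xi>)"
    "char_root 1 (log_symbol \<eta>) = char_root (-1) (log_symbol \<eta>)" for \<xi> \<eta> :: "real^'n"
  proof -
    have d: "4 * a * (1 + a)\<^sup>2 = 1" if "char_root 1 a = char_root (-1) a" "0 \<le> a" for a
    proof -
      have "disc_root a = 0" using that(1) by (simp add: char_root_def)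
      then have "complex_of_real (char_disc a) = 0" using disc_root_squared[of a] by simp
      then have "char_disc a = 0" by (simp only: of_real_eq_0_iff)
      then have "(1 / (1 + a))\<^sup>2 / 4 = a" by (simp add: char_disc_def)
      moreover have "(1 / (1 + a))\<^sup>2 * (1 + a)\<^sup>2 = 1" using that(2) by (simp flip: power_mult_distrib)
      ultimately show ?thesis by (metis mult.commute mult.assoc nonzero_mult_div_cancel_left times_divide_eq_right zero_neq_numeral)
    qed
    have less: "\<not> a < b" if "4 * a * (1 + a)\<^sup>2 = 1" "4 * b * (1 + b)\<^sup>2 = 1" "0 \<le> a" for a b :: real
    proof
      assume "a < b"
      have "4 * a * (1 + a)\<^sup>2 < 4 * b * (1 + b)\<^sup>2"
        by (rule mult_strict_mono) (use that(3) \<open>a < b\<close> in \<open>auto intro: power_strict_mono\<close>)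
      then show False using that by simp
    qed
    have "log_symbol \<xi> = log_symbol \<eta>"
      using d[OF eq(1) log_symbol_nonneg] d[OF eq(2) log_symbol_nonneg] less log_symbol_nonneg
      by (metis linorder_neqE_linordered_idom)
    then have "1 + (norm \<xi>)\<^sup>2 = 1 + (norm \<eta>)\<^sup>2"
      unfolding log_symbol_def by (subst (asm) ln_inj_iff) (auto simp: add_pos_nonneg)
    then show ?thesis by simp
  qed
  show ?thesis
  proof (cases "\<exists>\<eta>::real^'n. char_root 1 (log_symbol \<eta>) = char_root (-1) (log_symbol \<eta>)")
    case True
    then obtain \<eta> :: "real^'n" where \<eta>: "char_root 1 (log_symbol \<eta>) = char_root (-1) (log_symbol \<eta>)" by blast
    have "sphere 0 (norm \<eta>) \<in> null_sets (lborel :: (real^'n) measure)"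
      using negligible_sphere[of "0::real^'n" "norm \<eta>"] by (simp add: negligible_iff_null_sets null_sets_completion_iff)
    then show ?thesis by (rule AE_I') (use inj[OF _ \<eta>] in auto)
  qed simp
qed

text \<open>Subtracting the transported combinations for the two roots eliminates u_t^. The factor l
  - m stays on the left, so the formula can be used before anything is known about the size of the
  gap.\<close>

lemma solution_formula:
  fixes u0 u1 :: "real^'n \<Rightarrow> complex"
  assumes sol: "is_solution u0 u1 u" and L: "u0 \<in> L2" "u1 \<in> L2" and t: "0 \<le> t"
  shows "AE \<xi> in lborel. let l = char_root 1 (log_symbol \<xi>); m = char_root (-1) (log_symbol \<xi>) in l \<noteq> m \<and>
    (l - m) * fourier (u t) \<xi> = exp (l * t) * (fourier u1 \<xi> - m * fourier u0 \<xi>)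
      - exp (m * t) * (fourier u1 \<xi> - l * fourier u0 \<xi>)"
proof -
  obtain ut utt where c: "continuous_curve (Y 2) (norm_Y 2) u" "curve_derivative (Y 1) (norm_Y 1) u ut"
    "curve_derivative L2 norm_L2 ut utt"
    "\<And>t. 0 < t \<Longrightarrow> \<exists>v w. L_graph (u t) v \<and> resolvent_graph (ut t) w \<and> (AE x in lborel. utt t x + v x + w x = 0)"
    and init: "AE x in lborel. u 0 x = u0 x" "AE x in lborel. ut 0 x = u1 x"
    using sol by (auto simp: is_solution_def)
  have L0: "u 0 \<in> L2" "ut 0 \<in> L2" using c(3,1) by (auto simp: curve_derivative_def continuous_curve_def Y_imp_L2)
  \<comment> \<open>Integer radii exhaust the space, and countably many exceptional null sets can be
    united.\<close>
  have T: "AE \<xi> in lborel. \<forall>k::nat. norm \<xi> \<le> real k \<longrightarrow>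
    fourier (ut t) \<xi> - char_root (- \<sigma>) (log_symbol \<xi>) * fourier (u t) \<xi>
    = exp (char_root \<sigma> (log_symbol \<xi>) * t) *
      (fourier (ut 0) \<xi> - char_root (- \<sigma>) (log_symbol \<xi>) * fourier (u 0) \<xi>)" if "\<bar>\<sigma>\<bar> = 1" for \<sigma>
    unfolding AE_all_countable using solution_transport_ball[OF c(2-4) that t] by simp
  have T1: "AE \<xi> in lborel. \<forall>k::nat. norm \<xi> \<le> real k \<longrightarrow>
    fourier (ut t) \<xi> - char_root (-1) (log_symbol \<xi>) * fourier (u t) \<xi>
    = exp (char_root 1 (log_symbol \<xi>) * t) *
      (fourier (ut 0) \<xi> - char_root (-1) (log_symbol \<xi>) * fourier (u 0) \<xi>)" using T[of 1] by simp
  have T2: "AE \<xi> in lborel. \<forall>k::nat. norm \<xi> \<le> real k \<longrightarrow>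
    fourier (ut t) \<xi> - char_root 1 (log_symbol \<xi>) * fourier (u t) \<xi>
    = exp (char_root (-1) (log_symbol \<xi>) * t) *
      (fourier (ut 0) \<xi> - char_root 1 (log_symbol \<xi>) * fourier (u 0) \<xi>)" using T[of "-1"] by simp
  from T1 T2 AE_char_roots_distinct fourier_cong[OF L0(1) L(1) init(1)] fourier_cong[OF L0(2) L(2) init(2)]
  show ?thesis
  proof eventually_elim
    case (elim \<xi>)
    obtain k :: nat where k: "norm \<xi> \<le> real k" using real_arch_simple by blast
    let ?l = "char_root 1 (log_symbol \<xi>)" and ?m = "char_root (-1) (log_symbol \<xi>)"
    have "(?l - ?m) * fourier (u t) \<xi> = (fourier (ut t) \<xi> - ?m * fourier (u t) \<xi>) - (fourier (ut t) \<xi> - ?l * fourier (u t) \<xi>)"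
      by (simp add: algebra_simps)
    also have "\<dots> = exp (?l * t) * (fourier u1 \<xi> - ?m * fourier u0 \<xi>) - exp (?m * t) * (fourier u1 \<xi> - ?l * fourier u0 \<xi>)"
      using elim(1)[rule_format, OF k] elim(2)[rule_format, OF k] elim(4,5) by simp
    finally show ?case using elim(3) by (simp add: Let_def)
  qed
qed

section \<open>Pointwise bounds in frequency space\<close>

text \<open>The mean value inequality on a half-plane. The factor |l - m| cancels the denominator of
  the divided difference, so the bound survives at frequencies near the double root.\<close>

lemma norm_exp_diff_le:
  fixes l m :: complex
  assumes "Re l \<le> R" "Re m \<le> R" "0 \<le> t"
  shows "norm (exp (l * of_real t) - exp (m * of_real t)) \<le> t * exp (R * t) * norm (l - m)"
proof (rule field_differentiable_bound[where S="{z. Re z \<le> R}" and f'="\<lambda>z. exp (z * of_real t) * of_real t"])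
  show "convex {z. Re z \<le> R}" by (rule convex_halfspace_Re_le)
  show "norm (exp (z * of_real t) * of_real t) \<le> t * exp (R * t)" if "z \<in> {z. Re z \<le> R}" for z
  proof -
    have "Re z * t \<le> R * t" using that assms(3) by (intro mult_right_mono) auto
    then have "exp (Re z * t) * t \<le> exp (R * t) * t" using assms(3) by (intro mult_right_mono) auto
    then show ?thesis using assms(3) by (simp add: norm_mult mult.commute)
  qed
qed (use assms in \<open>auto intro!: derivative_eq_intros\<close>)

text \<open>Let b = 1 / (1 + a). The slow root is -(b/2 - d), and (b/2 - d) (b/2 + d) = a. Since b/2
  + d lies between 1/2 and 1, b/2 - d lies between a and 2 a. The value 3/10 for d comes from b
  \<ge> 10/11.\<close>

lemma char_root_low:
  assumes a: "0 \<le> a" "a \<le> 1/10"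
  defines "d \<equiv> sqrt (char_disc a)"
  shows "char_root \<sigma> a = complex_of_real (- (1 / (1 + a)) / 2 + \<sigma> * d)"
    and "3/10 \<le> d" "2 * d \<le> 1"
    and "- (1 / (1 + a)) / 2 + d \<le> - a" "- 2 * a \<le> - (1 / (1 + a)) / 2 + d"
    and "-1 \<le> - (1 / (1 + a)) / 2 - d" "- (1 / (1 + a)) / 2 - d \<le> - a"
proof -
  define b where "b = 1 / (1 + a)"
  have b: "10/11 \<le> b" "b \<le> 1" using a by (auto simp: b_def field_simps)
  have "(10/11)\<^sup>2 \<le> b\<^sup>2" using b by (intro power_mono) auto
  then have disc: "(3/10)\<^sup>2 \<le> char_disc a" using a by (simp add: char_disc_def b_def[symmetric] power2_eq_square)
  then have disc0: "0 \<le> char_disc a" by (rule order_trans[rotated]) simp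
  show "char_root \<sigma> a = complex_of_real (- (1 / (1 + a)) / 2 + \<sigma> * d)"
    using disc0 by (simp add: char_root_def disc_root_def d_def)
  show d: "3/10 \<le> d" unfolding d_def using disc by (rule real_le_rsqrt)
  have d2: "d\<^sup>2 = b\<^sup>2 / 4 - a" using disc0 by (simp add: d_def char_disc_def b_def)
  have "d \<le> b / 2"
  proof (rule power2_le_imp_le)
    show "d\<^sup>2 \<le> (b / 2)\<^sup>2" using d2 a by (simp add: power_divide)
  qed (use b in auto)
  then show "2 * d \<le> 1" using b by simp
  have prod: "(b / 2 - d) * (b / 2 + d) = a" using d2 by (simp add: power2_eq_square algebra_simps)
  have "(b / 2 - d) * (b / 2 + d) \<le> (b / 2 - d) * 1"
    using \<open>d \<le> b / 2\<close> b by (intro mult_left_mono) auto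
  then have *: "a \<le> b / 2 - d" using prod by simp
  then show "- (1 / (1 + a)) / 2 + d \<le> - a" by (simp add: b_def)
  have "(b / 2 - d) * (1/2) \<le> (b / 2 - d) * (b / 2 + d)"
    using \<open>d \<le> b / 2\<close> b d by (intro mult_left_mono) auto
  then have "b / 2 - d \<le> 2 * a" using prod by simp
  then show "- 2 * a \<le> - (1 / (1 + a)) / 2 + d" by (simp add: b_def)
  have "-1 \<le> - b / 2 - d" using b \<open>d \<le> b / 2\<close> by simp
  then show "-1 \<le> - (1 / (1 + a)) / 2 - d" by (simp add: b_def)
  have "- b / 2 - d \<le> - a" using b d a by linarith
  then show "- (1 / (1 + a)) / 2 - d \<le> - a" by (simp add: b_def)
qed

text \<open>Let b = 1 / (1 + a). Complex roots have real part -b/2. For real roots the slower one is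
  at most -a, as in the low regime, and a \<ge> 1/10 \<ge> b/10; this is where the constant 10 comes
  from.\<close>

lemma Re_char_root_high:
  assumes a: "1/10 \<le> a" and \<sigma>: "\<sigma> = 1 \<or> \<sigma> = -1"
  shows "Re (char_root \<sigma> a) \<le> - (1 / (10 * (1 + a)))"
proof -
  define b where "b = 1 / (1 + a)"
  have b: "0 < b" "b \<le> 1" using a by (auto simp: b_def)
  have eq: "1 / (10 * (1 + a)) = b / 10" by (simp add: b_def)
  show ?thesis
  proof (cases "0 \<le> char_disc a")
    case True
    define d where "d = sqrt (char_disc a)"
    have d: "0 \<le> d" "d\<^sup>2 = b\<^sup>2 / 4 - a" using True by (auto simp: d_def char_disc_def b_def)
    have "d \<le> b / 2"
    proof (rule power2_le_imp_le)
      show "d\<^sup>2 \<le> (b / 2)\<^sup>2" using d a by (simp add: power_divide)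
    qed (use b in auto)
    have "a = (b / 2 - d) * (b / 2 + d)" using d(2) by (simp add: power2_eq_square algebra_simps)
    also have "\<dots> \<le> (b / 2 - d) * 1" using \<open>d \<le> b / 2\<close> b by (intro mult_left_mono) auto
    finally have "- b / 2 + d \<le> - (b / 10)" using a b by simp
    moreover have "- b / 2 - d \<le> - b / 2 + d" using d by simp
    moreover have "Re (char_root \<sigma> a) = - b / 2 + \<sigma> * d" using True by (simp add: char_root_def disc_root_def d_def b_def)
    ultimately show ?thesis unfolding eq using \<sigma> by auto
  next
    case False
    then have "Re (char_root \<sigma> a) = - b / 2" by (simp add: char_root_def disc_root_def b_def)
    then show ?thesis unfolding eq using b by simp
  qed
qed

text \<open>For a \<ge> 1 the roots are complex conjugates, so their common modulus is the root of
  their product a. The gap of size sqrt a is why the velocity costs only half of the power of 1 + a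
  that the position costs.\<close>

lemma char_root_large:
  assumes a: "1 \<le> a"
  shows "norm (char_root (-1) a) = sqrt a" and "sqrt a \<le> norm (char_root 1 a - char_root (-1) a)"
proof -
  define b where "b = 1 / (1 + a)"
  have b: "0 < b" "b \<le> 1" using a by (auto simp: b_def)
  have "b\<^sup>2 \<le> 1" using b by (simp add: power_le_one)
  then have disc: "char_disc a \<le> - (a / 4)" using a by (simp add: char_disc_def b_def)
  then have neg: "char_disc a < 0" using a by linarith
  have m: "char_root (-1) a = Complex (- b / 2) (- sqrt (- char_disc a))"
    using neg by (simp add: char_root_def disc_root_def b_def complex_eq_iff)
  have "(norm (char_root (-1) a))\<^sup>2 = a"
  proof -
    have "char_disc a = b\<^sup>2 / 4 - a" by (simp add: char_disc_def b_def)
    then show ?thesis unfolding cmod_power2 m using neg by (simp add: power_divide)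
  qed
  then show "norm (char_root (-1) a) = sqrt a" by (metis norm_ge_zero real_sqrt_unique)
  have "sqrt a = 2 * sqrt (a / 4)" by (simp add: real_sqrt_divide)
  also have "\<dots> \<le> 2 * sqrt (- char_disc a)" using disc by (intro mult_left_mono real_sqrt_le_mono) auto
  also have "\<dots> = norm (char_root 1 a - char_root (-1) a)"
    using neg by (simp add: char_root_def disc_root_def norm_mult)
  finally show "sqrt a \<le> norm (char_root 1 a - char_root (-1) a)" .
qed

text \<open>The solution is v = exp(m t) v0 + q (v1 - m v0) with the divided difference q = (exp(l
  t) - exp(m t)) / (l - m). All division by the gap is confined to q, for which each frequency
  regime supplies its own bound.\<close>

lemma solution_bound:
  fixes l m v v0 v1 :: complex and q :: real
  assumes ne: "l \<noteq> m" and eq: "(l - m) * v = exp (l * of_real t) * (v1 - m * v0) - exp (m * of_real t) * (v1 - l * v0)"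
    and q: "norm (exp (l * of_real t) - exp (m * of_real t)) \<le> q * norm (l - m)"
    and e: "norm (exp (m * of_real t)) \<le> e"
  shows "norm v \<le> e * norm v0 + q * (norm v1 + norm m * norm v0)"
proof -
  let ?q = "(exp (l * of_real t) - exp (m * of_real t)) / (l - m)"
  have "(l - m) * v = (l - m) * (exp (m * of_real t) * v0 + ?q * (v1 - m * v0))"
    using ne unfolding eq by (simp add: distrib_left) (simp add: algebra_simps)
  then have v: "v = exp (m * of_real t) * v0 + ?q * (v1 - m * v0)" using ne by simp
  have nq: "norm ?q \<le> q" using q ne by (simp add: norm_divide divide_le_eq)
  have "norm v \<le> norm (exp (m * of_real t)) * norm v0 + norm ?q * norm (v1 - m * v0)"
    unfolding v by (rule order_trans[OF norm_triangle_ineq]) (simp only: norm_mult order_refl)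
  also have "\<dots> \<le> e * norm v0 + q * (norm v1 + norm m * norm v0)"
  proof (intro add_mono mult_mono e nq order_refl)
    show "norm (v1 - m * v0) \<le> norm v1 + norm m * norm v0"
      using norm_triangle_ineq4[of v1 "m * v0"] by (simp add: norm_mult)
    show "0 \<le> e" using e norm_ge_zero order_trans by blast
    show "0 \<le> q" using nq norm_ge_zero order_trans by blast
  qed auto
  finally show ?thesis .
qed

text \<open>With x = t / (10 (1 + a)) both exponentials are at most exp(-x), which is bounded by 1 /
  x and by 2 / x^2. The first bound is the trade of 1 + a for 1/t; the second offsets the factor t
  of the mean value inequality.\<close>

lemma high_frequency_bound:
  assumes a: "1/10 \<le> a" and t: "0 < t"
  defines "l \<equiv> char_root 1 a" and "m \<equiv> char_root (-1) a"
  assumes ne: "l \<noteq> m" and eq: "(l - m) * v = exp (l * of_real t) * (v1 - m * v0) - exp (m * of_real t) * (v1 - l * v0)"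
  shows "norm v \<le> 2500 / t * ((1 + a) * norm v0 + sqrt (1 + a) * norm v1)"
proof -
  define R where "R = - (1 / (10 * (1 + a)))"
  have Re: "Re l \<le> R" "Re m \<le> R" unfolding l_def m_def R_def by (intro Re_char_root_high a; simp)+
  have eR: "norm (exp (z * of_real t)) \<le> exp (R * t)" if "Re z \<le> R" for z
    using that t by (simp add: mult_right_mono)
  define x where "x = t / (10 * (1 + a))"
  have x: "0 < x" "R * t = - x" using a t by (auto simp: x_def R_def)
  have "x \<le> exp x" using exp_ge_add_one_self[of x] by linarith
  then have "exp (R * t) \<le> 1 / x" using x by (simp add: exp_minus field_simps)
  also have "1 / x = 10 * (1 + a) / t" using a t by (simp add: x_def)
  finally have e1: "exp (R * t) \<le> 10 * (1 + a) / t" .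
  have "exp (R * t) \<le> 2 / x\<^sup>2"
  proof -
    have "x\<^sup>2 / 2 \<le> exp x" using exp_lower_Taylor_quadratic[of x] x by simp
    then have "exp (R * t) \<le> 1 / (x\<^sup>2 / 2)" using x unfolding x(2) exp_minus inverse_eq_divide by (intro divide_left_mono) auto
    then show ?thesis by simp
  qed
  also have "2 / x\<^sup>2 = 200 * (1 + a)\<^sup>2 / t\<^sup>2"
    unfolding x_def power_divide power_mult_distrib by simp
  finally have e2: "exp (R * t) \<le> 200 * (1 + a)\<^sup>2 / t\<^sup>2" .
  show ?thesis
  \<comment> \<open>The double root falls into the case a \<le> 1, where the mean value inequality
    is used and powers of 1 + a are constants. For a > 1 the gap is at least sqrt a, and the two
    exponentials are estimated separately.\<close>
  proof (cases "a \<le> 1")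
    case True
    have "(1 + a)\<^sup>2 \<le> 2\<^sup>2" using a True by (intro power_mono) auto
    then have "200 * (1 + a)\<^sup>2 / t\<^sup>2 \<le> 800 / t\<^sup>2" by (intro divide_right_mono) auto
    then have "t * exp (R * t) \<le> t * (800 / t\<^sup>2)" using t e2 by (intro mult_left_mono) auto
    then have q: "t * exp (R * t) \<le> 800 / t" using t by (simp add: power2_eq_square)
    have "10 * (1 + a) / t \<le> 20 / t" using t True by (intro divide_right_mono) auto
    then have e: "exp (R * t) \<le> 20 / t" using e1 by linarith
    have "norm (exp (l * of_real t) - exp (m * of_real t)) \<le> (800 / t) * norm (l - m)"
      using norm_exp_diff_le[OF Re, of t] t mult_right_mono[OF q, of "norm (l - m)"] by simp
    from solution_bound[OF ne eq this order_trans[OF eR[OF Re(2)] e]]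
    have "norm v \<le> 20 / t * norm v0 + 800 / t * (norm v1 + norm m * norm v0)" .
    also have "\<dots> \<le> 20 / t * norm v0 + 800 / t * (norm v1 + 3 * norm v0)"
      using norm_char_root_le[of a "-1"] a True t
      by (intro add_left_mono mult_left_mono mult_right_mono) (auto simp: m_def)
    \<comment> \<open>2420 = 20 + 3 * 800; the final constant 2500 rounds this up and also covers
      the other case.\<close>
    also have "\<dots> = 1 / t * (2420 * norm v0 + 800 * norm v1)" using t by (simp add: field_simps)
    also have "\<dots> \<le> 1 / t * (2500 * ((1 + a) * norm v0 + sqrt (1 + a) * norm v1))"
    proof (rule mult_left_mono)
      have "1 * norm v0 \<le> (1 + a) * norm v0" using a by (intro mult_right_mono) auto
      moreover have "1 * norm v1 \<le> sqrt (1 + a) * norm v1" using a by (intro mult_right_mono) auto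
      ultimately show "2420 * norm v0 + 800 * norm v1 \<le> 2500 * ((1 + a) * norm v0 + sqrt (1 + a) * norm v1)"
        using norm_ge_zero[of v0] norm_ge_zero[of v1] unfolding distrib_left by linarith
    qed (use t in auto)
    finally show ?thesis by simp
  next
    case False
    then have a1: "1 \<le> a" by simp
    define r where "r = sqrt a"
    have r: "1 \<le> r" "r\<^sup>2 = a" using a1 by (auto simp: r_def)
    let ?E = "10 * (1 + a) / t"
    have "norm (exp (l * of_real t) - exp (m * of_real t)) \<le> ?E + ?E"
      using norm_triangle_ineq4[of "exp (l * of_real t)" "exp (m * of_real t)"] eR[OF Re(1)] eR[OF Re(2)] e1 by linarith
    \<comment> \<open>The inserted factor r = sqrt a is bounded by the gap; the remaining 1 / r
      reduces (1 + a) |v1| to a multiple of sqrt (1 + a) |v1|.\<close>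
    also have "\<dots> = 2 * ?E / r * r" using r by simp
    also have "\<dots> \<le> 2 * ?E / r * norm (l - m)"
      using char_root_large(2)[OF a1] r a t unfolding l_def m_def r_def by (intro mult_left_mono) auto
    finally have q: "norm (exp (l * of_real t) - exp (m * of_real t)) \<le> 2 * ?E / r * norm (l - m)" .
    have nm: "norm m = r" unfolding m_def r_def by (rule char_root_large(1)[OF a1])
    from solution_bound[OF ne eq q order_trans[OF eR[OF Re(2)] e1]]
    have "norm v \<le> ?E * norm v0 + 2 * ?E / r * (norm v1 + r * norm v0)" unfolding nm .
    also have "\<dots> = 1 / t * (30 * ((1 + a) * norm v0) + 20 * ((1 + a) / r * norm v1))"
      using r t by (simp add: field_simps)
    also have "\<dots> \<le> 1 / t * (2500 * ((1 + a) * norm v0 + sqrt (1 + a) * norm v1))"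
    proof (rule mult_left_mono)
      have "(1 + a) / r \<le> 2 * sqrt (1 + a)"
      proof -
        have "sqrt (1 + a) \<le> sqrt (4 * a)" using a1 by (intro real_sqrt_le_mono) auto
        then have "sqrt (1 + a) \<le> 2 * r" by (simp add: r_def real_sqrt_mult)
        then have "sqrt (1 + a) * sqrt (1 + a) \<le> sqrt (1 + a) * (2 * r)" using a by (intro mult_left_mono) auto
        then have "1 + a \<le> 2 * sqrt (1 + a) * r" using a by simp
        then show ?thesis using r by (simp add: divide_le_eq)
      qed
      then have "(1 + a) / r * norm v1 \<le> 2 * sqrt (1 + a) * norm v1" by (intro mult_right_mono) auto
      moreover have "0 \<le> (1 + a) * norm v0" "0 \<le> sqrt (1 + a) * norm v1" using a by auto
      ultimately show "30 * ((1 + a) * norm v0) + 20 * ((1 + a) / r * norm v1)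
        \<le> 2500 * ((1 + a) * norm v0 + sqrt (1 + a) * norm v1)"
        unfolding distrib_left by linarith
    qed (use t in auto)
    finally show ?thesis by simp
  qed
qed

lemma low_frequency_bound:
  assumes a: "0 \<le> a" "a \<le> 1/10" and t: "0 \<le> t"
  defines "l \<equiv> char_root 1 a" and "m \<equiv> char_root (-1) a"
  assumes ne: "l \<noteq> m" and eq: "(l - m) * v = exp (l * of_real t) * (v1 - m * v0) - exp (m * of_real t) * (v1 - l * v0)"
  shows "norm v \<le> 5 * exp (- a * t) * (norm v0 + norm v1)"
proof -
  define d where "d = sqrt (char_disc a)"
  note low = char_root_low[OF a, folded d_def]
  have l: "l = complex_of_real (- (1 / (1 + a)) / 2 + d)" and m: "m = complex_of_real (- (1 / (1 + a)) / 2 - d)"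
    unfolding l_def m_def low(1) by simp_all
  have "l - m = complex_of_real (2 * d)" unfolding l m by (simp only: of_real_diff[symmetric]) simp
  then have lm: "norm (l - m) = 2 * d" using low(2) by (simp only: norm_of_real)
  have bound: "norm (exp (complex_of_real x * of_real t)) \<le> exp (- a * t)" if "x \<le> - a" for x
  proof -
    have "x * t \<le> - a * t" using that t by (rule mult_right_mono)
    then show ?thesis by simp
  qed
  have el: "norm (exp (l * of_real t)) \<le> exp (- a * t)" and em: "norm (exp (m * of_real t)) \<le> exp (- a * t)"
    using bound[OF low(4)] bound[OF low(7)] unfolding l m by simp_all
  have "norm (exp (l * of_real t) - exp (m * of_real t)) \<le> exp (- a * t) + exp (- a * t)"
    using norm_triangle_ineq4[of "exp (l * of_real t)" "exp (m * of_real t)"] el em by linarith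
  \<comment> \<open>The gap is 2 d \<ge> 6/10, so the divided difference is at most 2 / (6/10) =
    10/3 times the exponential. The constant 5 then exceeds 1 + 10/3.\<close>
  also have "\<dots> = 10/3 * exp (- a * t) * (6/10)" by simp
  also have "\<dots> \<le> 10/3 * exp (- a * t) * norm (l - m)"
    unfolding lm using low(2) by (intro mult_left_mono) auto
  finally have q: "norm (exp (l * of_real t) - exp (m * of_real t)) \<le> 10/3 * exp (- a * t) * norm (l - m)" .
  have nm: "norm m \<le> 1" unfolding m norm_of_real using low(6,7) a by linarith
  have "norm v \<le> exp (- a * t) * norm v0 + 10/3 * exp (- a * t) * (norm v1 + norm m * norm v0)"
    by (rule solution_bound[OF ne eq q em])
  also have "\<dots> \<le> exp (- a * t) * norm v0 + 10/3 * exp (- a * t) * (norm v1 + 1 * norm v0)"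
    using nm by (intro add_left_mono mult_left_mono mult_right_mono) auto
  also have "\<dots> = exp (- a * t) * (13/3 * norm v0 + 10/3 * norm v1)" by (simp add: field_simps)
  also have "\<dots> \<le> exp (- a * t) * (5 * (norm v0 + norm v1))"
  proof (rule mult_left_mono)
    show "13/3 * norm v0 + 10/3 * norm v1 \<le> 5 * (norm v0 + norm v1)"
      unfolding distrib_left by (intro add_mono mult_right_mono) auto
  qed simp
  finally show ?thesis by (simp add: algebra_simps)
qed

text \<open>For a t \<le> 1 the slow mode has lost at most the factor exp(-2), as l \<ge> -2 a. The
  fast mode is smaller by exp(-t / 2), since the gap exceeds 1/2. The gap is also at most 1, so
  passing from (l - m) v to v loses nothing.\<close>

lemma low_frequency_lower_bound:
  assumes a: "0 \<le> a" "a \<le> 1/10" and t: "0 \<le> t" "a * t \<le> 1"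
  defines "l \<equiv> char_root 1 a" and "m \<equiv> char_root (-1) a"
  assumes eq: "(l - m) * v = exp (l * of_real t) * (v1 - m * v0) - exp (m * of_real t) * (v1 - l * v0)"
  shows "exp (-2) * (norm (v1 - m * v0) - exp (- t / 2) * (norm v0 + norm v1)) \<le> norm v"
\<comment> \<open>If the bracket is not positive the claim is trivial; otherwise its sign allows
  exp(-2) to be replaced by the larger exp(x t).\<close>
proof (cases "norm (v1 - m * v0) \<le> exp (- t / 2) * (norm v0 + norm v1)")
  case True
  then have "exp (-2) * (norm (v1 - m * v0) - exp (- t / 2) * (norm v0 + norm v1)) \<le> 0"
    by (intro mult_nonneg_nonpos) auto
  then show ?thesis using norm_ge_zero order_trans by blast
next
  case False
  define d where "d = sqrt (char_disc a)"
  note low = char_root_low[OF a, folded d_def]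
  define x y where "x = - (1 / (1 + a)) / 2 + d" and "y = - (1 / (1 + a)) / 2 - d"
  have l: "l = complex_of_real x" and m: "m = complex_of_real y"
    unfolding l_def m_def low(1) x_def y_def by simp_all
  have xy: "x - y = 2 * d" by (simp add: x_def y_def)
  have nx: "norm l \<le> 1" unfolding l norm_of_real using low(4,5) a by (simp add: x_def)
  have lm: "norm (l - m) \<le> 1" unfolding l m using low(2,3) xy by (simp flip: of_real_diff)
  have y: "exp (y * t) \<le> exp (x * t) * exp (- t / 2)"
  proof -
    have "(2 * d) * t \<ge> (1/2) * t" using low(2) t by (intro mult_right_mono) auto
    then have "y * t \<le> x * t + - t / 2" using xy by (simp add: algebra_simps flip: xy)
    then show ?thesis by (simp flip: exp_add)
  qed
  let ?X = "norm (v1 - m * v0)" and ?Y = "norm (v1 - l * v0)"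
  have Y: "?Y \<le> norm v0 + norm v1"
  proof -
    have "?Y \<le> norm v1 + norm l * norm v0" using norm_triangle_ineq4[of v1 "l * v0"] by (simp add: norm_mult)
    also have "norm l * norm v0 \<le> 1 * norm v0" using nx by (intro mult_right_mono) auto
    finally show ?thesis by simp
  qed
  have "x * t \<ge> (- 2 * a) * t" using low(5) t by (intro mult_right_mono) (simp_all add: x_def)
  then have "-2 \<le> x * t" using t by (simp add: algebra_simps)
  then have "exp (-2) * (?X - exp (- t / 2) * (norm v0 + norm v1)) \<le> exp (x * t) * (?X - exp (- t / 2) * (norm v0 + norm v1))"
    using False by (intro mult_right_mono) auto
  also have "\<dots> = exp (x * t) * ?X - exp (x * t) * exp (- t / 2) * (norm v0 + norm v1)" by (simp add: algebra_simps)
  also have "\<dots> \<le> exp (x * t) * ?X - exp (y * t) * ?Y"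
    using y Y by (intro diff_left_mono mult_mono) auto
  also have "\<dots> = norm (exp (l * of_real t) * (v1 - m * v0)) - norm (exp (m * of_real t) * (v1 - l * v0))"
    unfolding norm_mult by (simp add: l m)
  also have "\<dots> \<le> norm ((l - m) * v)" unfolding eq by (rule norm_triangle_ineq2)
  also have "\<dots> \<le> 1 * norm v" unfolding norm_mult using lm by (intro mult_right_mono) auto
  finally show ?thesis by simp
qed

section \<open>Decay of the solution\<close>

lemma integral_gaussian_scaled:
  assumes c: "0 < c"
  shows "integrable lborel (\<lambda>\<xi>::real^'n. exp (- c * (norm \<xi>)\<^sup>2))"
    and "integral\<^sup>L lborel (\<lambda>\<xi>::real^'n. exp (- c * (norm \<xi>)\<^sup>2)) = sqrt (pi / c) ^ CARD('n)"
proof -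
  define r where "r = sqrt (2 * c)"
  have r: "r \<noteq> 0" "0 < r" "r\<^sup>2 = 2 * c" using c by (auto simp: r_def)
  have eq: "exp (- c * (norm \<xi>)\<^sup>2) = sqrt (2 * pi) ^ CARD('n) * std_gaussian (0 + r *\<^sub>R \<xi>)" for \<xi> :: "real^'n"
    using r(3) by (simp add: std_gaussian_eq power_mult_distrib power_divide)
  have "integrable lborel (\<lambda>\<xi>::real^'n. std_gaussian (0 + r *\<^sub>R \<xi>))"
    by (subst lborel_integrable_affine_iff[OF _ r(1)]) (auto intro: integrable_std_gaussian)
  then show "integrable lborel (\<lambda>\<xi>::real^'n. exp (- c * (norm \<xi>)\<^sup>2))" unfolding eq by simp
  have "1 = r ^ CARD('n) * integral\<^sup>L lborel (\<lambda>\<xi>::real^'n. std_gaussian (0 + r *\<^sub>R \<xi>))"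
    using lborel_integral_affine[OF measurable_std_gaussian r(1), where t="0::real^'n"] r
    by (simp add: integral_std_gaussian)
  then have "integral\<^sup>L lborel (\<lambda>\<xi>::real^'n. std_gaussian (0 + r *\<^sub>R \<xi>)) = 1 / r ^ CARD('n)"
    using r by (simp add: eq_divide_eq mult.commute)
  then have "integral\<^sup>L lborel (\<lambda>\<xi>::real^'n. exp (- c * (norm \<xi>)\<^sup>2)) = sqrt (2 * pi) ^ CARD('n) * (1 / r ^ CARD('n))"
    unfolding eq integral_mult_right_zero by simp
  also have "\<dots> = (sqrt (2 * pi) / r) ^ CARD('n)" by (simp add: power_divide)
  also have "sqrt (2 * pi) / r = sqrt (pi / c)" using c by (simp add: r_def flip: real_sqrt_divide)
  finally show "integral\<^sup>L lborel (\<lambda>\<xi>::real^'n. exp (- c * (norm \<xi>)\<^sup>2)) = sqrt (pi / c) ^ CARD('n)" .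
qed

lemma log_symbol_le_norm_squared: "log_symbol \<xi> \<le> (norm \<xi>)\<^sup>2"
  unfolding log_symbol_def by (rule ln_add_one_self_le_self) simp

text \<open>The squared low-frequency bound decays like exp(-2 a t); this inequality turns it into
  the Gaussian exp(-t |\<xi>|^2). The hypothesis first gives |\<xi>|^2 \<le> 1/2, and there x - x^2
  \<ge> x / 2.\<close>

lemma log_symbol_ge_half_norm_squared:
  assumes "log_symbol \<xi> \<le> 1/10"
  shows "(norm \<xi>)\<^sup>2 \<le> 2 * log_symbol \<xi>"
proof -
  let ?x = "(norm \<xi>)\<^sup>2"
  have "exp (log_symbol \<xi>) = 1 + ?x" by (simp add: log_symbol_def add_pos_nonneg)
  moreover have "exp (log_symbol \<xi>) \<le> exp (1/10)" using assms by simp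
  moreover have "exp (1/10) \<le> 1 + 1/10 + (1/10 :: real)\<^sup>2" by (rule exp_bound) auto
  ultimately have x: "?x \<le> 1/2" by (simp add: power2_eq_square)
  have "?x - ?x\<^sup>2 \<le> log_symbol \<xi>"
    unfolding log_symbol_def using x by (intro ln_one_plus_pos_lower_bound) auto
  moreover have "?x * ?x \<le> ?x * (1/2)" using x by (intro mult_left_mono) auto
  ultimately show ?thesis by (simp only: power2_eq_square[of ?x])
qed

text \<open>Both the Gaussian integral and the volume of the ball scale like the n-th power of sqrt
  (1 / t); these are squared norms, so the rate is the square root of this.\<close>

lemma sqrt_power_eq_powr:
  assumes "0 < t" shows "sqrt (1 / t) ^ n = (t powr (- real n / 4))\<^sup>2"
proof -
  have "sqrt (1 / t) ^ n = (t powr (- 1/2)) ^ n"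
    using assms by (simp add: powr_minus powr_half_sqrt real_sqrt_divide inverse_eq_divide)
  also have "\<dots> = t powr (- real n / 4) * t powr (- real n / 4)"
    using assms by (simp add: powr_power flip: powr_add)
  finally show ?thesis by (simp add: power2_eq_square)
qed

lemma solution_L2:
  assumes "is_solution u0 u1 u" "0 \<le> t" shows "u t \<in> L2"
proof -
  have "continuous_curve (Y 2) (norm_Y 2) u" using assms(1) by (auto simp: is_solution_def)
  then show ?thesis using assms(2) by (auto simp: continuous_curve_def Y_imp_L2)
qed

lemma solution_upper_bound:
  fixes u0 u1 :: "real^'n \<Rightarrow> complex"
  assumes n: "CARD('n) \<le> 3" and u0: "integrable lborel u0" "u0 \<in> Y 2" and u1: "integrable lborel u1" "u1 \<in> Y 1"
  shows "\<exists>C>0. \<forall>u t. is_solution u0 u1 u \<longrightarrow> 1 \<le> t \<longrightarrow> norm_L2 (fourier (u t)) \<le> C * t powr (- real CARD('n) / 4)"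
proof -
  have L: "u0 \<in> L2" "u1 \<in> L2" using u0 u1 Y_imp_L2 by blast+
  note [measurable] = L2_measurable[OF fourier_L2[OF L(1)], simplified] L2_measurable[OF fourier_L2[OF L(2)], simplified]
  \<comment> \<open>The L^1 norms bound both transforms uniformly, which is what low frequencies
    need.\<close>
  define A where "A = (\<integral>x. norm (u0 x) \<partial>lborel) + (\<integral>x. norm (u1 x) \<partial>lborel)"
  have A: "AE \<xi> in lborel. norm (fourier u0 \<xi>) + norm (fourier u1 \<xi>) \<le> A"
    using fourier_eq_fourier_L1[OF u0(1) L(1)] fourier_eq_fourier_L1[OF u1(1) L(2)]
  proof eventually_elim
    case (elim \<xi>)
    show ?case unfolding elim A_def by (intro add_mono norm_fourier_L1_le)
  qed
  \<comment> \<open>The sum of the densities of the squared \<open>Y 2\<close> norm of u0 and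
    \<open>Y 1\<close> norm of u1; these are exactly the powers of 1 + a that the high-frequency
    bound produces after squaring.\<close>
  define H where "H \<xi> = (1 + log_symbol \<xi>)\<^sup>2 * (norm (fourier u0 \<xi>))\<^sup>2 + (1 + log_symbol \<xi>) * (norm (fourier u1 \<xi>))\<^sup>2" for \<xi>
  have H0: "0 \<le> H \<xi>" for \<xi> using log_symbol_nonneg[of \<xi>] by (simp add: H_def)
  have Hint: "integrable lborel H"
  proof -
    have pos: "0 < 1 + log_symbol \<xi>" for \<xi> :: "real^'n" using log_symbol_nonneg[of \<xi>] by linarith
    have "(\<lambda>\<xi>. (1 + log_symbol \<xi>) powr 2 * (norm (fourier u0 \<xi>))\<^sup>2) = (\<lambda>\<xi>. (1 + log_symbol \<xi>)\<^sup>2 * (norm (fourier u0 \<xi>))\<^sup>2)"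
      using pos less_imp_le[OF pos] by (simp add: fun_eq_iff)
    moreover have "(\<lambda>\<xi>. (1 + log_symbol \<xi>) powr 1 * (norm (fourier u1 \<xi>))\<^sup>2) = (\<lambda>\<xi>. (1 + log_symbol \<xi>) * (norm (fourier u1 \<xi>))\<^sup>2)"
      using pos by (simp add: fun_eq_iff less_imp_le)
    ultimately show ?thesis
      unfolding H_def using u0(2) u1(2) unfolding Y_def by (intro Bochner_Integration.integrable_add) auto
  qed
  define J where "J = integral\<^sup>L lborel H"
  have J: "0 \<le> J" unfolding J_def using H0 by simp
  \<comment> \<open>25 is the square of the low-frequency constant 5. The factor 2 comes from
    squaring a sum of two terms in the high-frequency bound.\<close>
  define B where "B = 25 * A\<^sup>2 * sqrt pi ^ CARD('n) + 2 * 2500\<^sup>2 * J"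
  have B: "0 \<le> B" using J by (simp add: B_def)
  have main: "norm_L2 (fourier (u t)) \<le> (sqrt B + 1) * t powr (- real CARD('n) / 4)"
    if sol: "is_solution u0 u1 u" and t: "1 \<le> t" for u t
  proof -
    have tp: "0 < t" "0 \<le> t" using t by auto
    have uL: "u t \<in> L2" by (rule solution_L2[OF sol tp(2)])
    let ?D = "\<lambda>\<xi>. 25 * A\<^sup>2 * exp (- t * (norm \<xi>)\<^sup>2) + 2 * 2500\<^sup>2 / t\<^sup>2 * H \<xi>"
    have pw: "AE \<xi> in lborel. (norm (fourier (u t) \<xi>))\<^sup>2 \<le> ?D \<xi>"
      using A solution_formula[OF sol L tp(2)]
    proof eventually_elim
      case (elim \<xi>)
      let ?a = "log_symbol \<xi>" and ?v = "fourier (u t) \<xi>" and ?f = "fourier u0 \<xi>" and ?g = "fourier u1 \<xi>"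
      have ne: "char_root 1 ?a \<noteq> char_root (-1) ?a"
        and eq: "(char_root 1 ?a - char_root (-1) ?a) * ?v = exp (char_root 1 ?a * of_real t) * (?g - char_root (-1) ?a * ?f)
          - exp (char_root (-1) ?a * of_real t) * (?g - char_root 1 ?a * ?f)"
        using elim(2) by (auto simp: Let_def)
      show ?case
      proof (cases "?a \<le> 1/10")
        case True
        have "norm ?v \<le> 5 * exp (- ?a * t) * (norm ?f + norm ?g)"
          by (rule low_frequency_bound[OF log_symbol_nonneg True tp(2) ne eq])
        also have "\<dots> \<le> 5 * exp (- ?a * t) * A" using elim(1) by (intro mult_left_mono) auto
        finally have "(norm ?v)\<^sup>2 \<le> (5 * exp (- ?a * t) * A)\<^sup>2" by (intro power_mono) auto
        also have "\<dots> = 25 * A\<^sup>2 * exp (2 * (- ?a * t))" by (simp add: power_mult_distrib flip: exp_double)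
        also have "\<dots> \<le> 25 * A\<^sup>2 * exp (- t * (norm \<xi>)\<^sup>2)"
        proof -
          have "t * (norm \<xi>)\<^sup>2 \<le> t * (2 * ?a)" using log_symbol_ge_half_norm_squared[OF True] tp by (intro mult_left_mono) auto
          then show ?thesis by (intro mult_left_mono) (auto simp: algebra_simps)
        qed
        also have "\<dots> \<le> ?D \<xi>" using H0[of \<xi>] by simp
        finally show ?thesis .
      next
        case False
        then have a: "1/10 \<le> ?a" by simp
        let ?x = "(1 + ?a) * norm ?f" and ?y = "sqrt (1 + ?a) * norm ?g"
        have "norm ?v \<le> 2500 / t * (?x + ?y)" by (rule high_frequency_bound[OF a tp(1) ne eq])
        then have "(norm ?v)\<^sup>2 \<le> (2500 / t * (?x + ?y))\<^sup>2" by (intro power_mono) auto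
        also have "\<dots> = 2500\<^sup>2 / t\<^sup>2 * (?x + ?y)\<^sup>2" by (simp only: power_mult_distrib power_divide)
        also have "\<dots> \<le> 2500\<^sup>2 / t\<^sup>2 * (2 * H \<xi>)"
        proof (rule mult_left_mono)
          have "(?x + ?y)\<^sup>2 \<le> 2 * ?x\<^sup>2 + 2 * ?y\<^sup>2" using norm_add_squared_le[of ?x ?y] by simp
          also have "\<dots> = 2 * H \<xi>" using log_symbol_nonneg[of \<xi>] by (simp add: H_def power_mult_distrib)
          finally show "(?x + ?y)\<^sup>2 \<le> 2 * H \<xi>" .
        qed simp
        also have "\<dots> = 2 * 2500\<^sup>2 / t\<^sup>2 * H \<xi>" by simp
        also have "\<dots> \<le> ?D \<xi>" by simp
        finally show ?thesis .
      qed
    qed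
    note gauss = integral_gaussian_scaled[OF tp(1), where 'n='n]
    have "(norm_L2 (fourier (u t)))\<^sup>2 \<le> integral\<^sup>L lborel ?D"
      unfolding norm_L2_squared
    proof (rule integral_mono_AE[OF L2_integrable[OF fourier_L2[OF uL]] _ pw])
      show "integrable lborel ?D" using gauss(1) Hint by simp
    qed
    also have "\<dots> = 25 * A\<^sup>2 * sqrt (pi / t) ^ CARD('n) + 2 * 2500\<^sup>2 / t\<^sup>2 * J"
      using gauss Hint by (simp add: J_def)
    also have "\<dots> \<le> B * sqrt (1 / t) ^ CARD('n)"
    proof -
      have "sqrt (pi / t) ^ CARD('n) = sqrt pi ^ CARD('n) * sqrt (1 / t) ^ CARD('n)"
        by (subst power_mult_distrib[symmetric], subst real_sqrt_mult[symmetric]) simp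
      \<comment> \<open>1 / t^2 is the fourth power of sqrt (1 / t) \<le> 1, so the high frequencies
        decay at least as fast as the Gaussian part because n \<le> 4.\<close>
      moreover have "1 / t\<^sup>2 \<le> sqrt (1 / t) ^ CARD('n)"
      proof -
        have "sqrt (1 / t) ^ 4 = ((sqrt (1 / t))\<^sup>2)\<^sup>2" by (simp flip: power_mult)
        also have "\<dots> = 1 / t\<^sup>2" using tp by (simp add: power_divide)
        finally have "1 / t\<^sup>2 = sqrt (1 / t) ^ 4" ..
        also have "\<dots> \<le> sqrt (1 / t) ^ CARD('n)" using n t by (intro power_decreasing) auto
        finally show ?thesis .
      qed
      then have "2 * 2500\<^sup>2 * J * (1 / t\<^sup>2) \<le> 2 * 2500\<^sup>2 * J * sqrt (1 / t) ^ CARD('n)"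
        using J by (intro mult_left_mono) auto
      ultimately show ?thesis by (simp add: B_def algebra_simps)
    qed
    also have "\<dots> = B * (t powr (- real CARD('n) / 4))\<^sup>2" unfolding sqrt_power_eq_powr[OF tp(1)] ..
    finally have "norm_L2 (fourier (u t)) \<le> sqrt (B * (t powr (- real CARD('n) / 4))\<^sup>2)"
      by (rule real_le_rsqrt)
    also have "\<dots> = sqrt B * t powr (- real CARD('n) / 4)" by (simp add: real_sqrt_mult)
    \<comment> \<open>The summand 1 only keeps the constant positive.\<close>
    also have "\<dots> \<le> (sqrt B + 1) * t powr (- real CARD('n) / 4)" by (intro mult_right_mono) auto
    finally show ?thesis .
  qed
  moreover have "0 < sqrt B + 1" using B by (simp add: add_nonneg_pos)
  ultimately show ?thesis by blast
qed

text \<open>At the origin the coefficient of the slow mode is P_1 + P_0, as m = -1 there. Continuity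
  keeps half of its modulus on a ball whose radius depends on the data, and that radius only affects
  how large t has to be.\<close>

lemma initial_data_near_zero:
  fixes u0 u1 :: "real^'n \<Rightarrow> complex"
  assumes u: "integrable lborel u0" "integrable lborel u1" and P: "mean u0 + mean u1 \<noteq> 0"
  shows "\<exists>r>0. \<forall>\<xi>. norm \<xi> < r \<longrightarrow> log_symbol \<xi> \<le> 1/10 \<longrightarrow>
    norm (mean u0 + mean u1) / 2 \<le> norm (fourier_L1 u1 \<xi> - char_root (-1) (log_symbol \<xi>) * fourier_L1 u0 \<xi>)"
proof -
  \<comment> \<open>A real formula for the fast root that agrees with it for a \<le> 1/10. The real
    \<open>sqrt\<close> is defined and continuous on negative arguments too, so the composite is
    continuous everywhere and no neighbourhood has to be singled out.\<close>
  define h where "h a = - (1 / (1 + a)) / 2 - sqrt (char_disc a)" for a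
  define F where "F \<xi> = norm (fourier_L1 u1 \<xi> - of_real (h (log_symbol \<xi>)) * fourier_L1 u0 \<xi>)" for \<xi>
  have "continuous_on UNIV (\<lambda>\<xi>::real^'n. h (log_symbol \<xi>))"
  proof -
    have "1 + log_symbol \<xi> \<noteq> 0" "1 + (norm \<xi>)\<^sup>2 \<noteq> 0" for \<xi> :: "real^'n"
      using log_symbol_nonneg[of \<xi>] zero_le_power2[of "norm \<xi>"] by linarith+
    then show ?thesis
      unfolding h_def char_disc_def log_symbol_def by (intro continuous_intros) auto
  qed
  then have "continuous_on UNIV F"
    unfolding F_def by (intro continuous_intros continuous_fourier_L1 u)
  then have "isCont F 0" by (simp add: continuous_on_eq_continuous_at)
  have F0: "F 0 = norm (mean u0 + mean u1)"
    by (simp add: F_def h_def log_symbol_def char_disc_def fourier_L1_0 real_sqrt_divide add.commute power2_eq_square)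
  then have "(F \<longlongrightarrow> norm (mean u0 + mean u1)) (at 0)" using \<open>isCont F 0\<close> by (simp add: isCont_def)
  then have "eventually (\<lambda>\<xi>. norm (mean u0 + mean u1) / 2 < F \<xi>) (at 0)"
    using P by (intro order_tendstoD(1)) auto
  then obtain r where r: "r > 0" "\<And>\<xi>. \<xi> \<noteq> 0 \<Longrightarrow> norm \<xi> < r \<Longrightarrow> norm (mean u0 + mean u1) / 2 < F \<xi>"
    by (auto simp: eventually_at)
  \<comment> \<open>The filter at 0 leaves out the origin itself, where the value is known
    exactly.\<close>
  have "norm (mean u0 + mean u1) / 2 \<le> F \<xi>" if "norm \<xi> < r" for \<xi>
    using r(2)[of \<xi>] that F0 by (cases "\<xi> = 0") (auto simp: less_imp_le)
  moreover have "char_root (-1) (log_symbol \<xi>) = of_real (h (log_symbol \<xi>))" if "log_symbol \<xi> \<le> 1/10" for \<xi> :: "real^'n"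
    using char_root_low(1)[OF log_symbol_nonneg that, of "-1"] by (simp add: h_def)
  ultimately show ?thesis using r(1) unfolding F_def by (metis (no_types, lifting))
qed

lemma solution_lower_bound:
  fixes u0 u1 :: "real^'n \<Rightarrow> complex"
  assumes u0: "integrable lborel u0" "u0 \<in> L2" and u1: "integrable lborel u1" "u1 \<in> L2"
    and P: "mean u0 + mean u1 \<noteq> 0"
  shows "\<exists>c>0. \<forall>u. is_solution u0 u1 u \<longrightarrow> (\<forall>\<^sub>F t in at_top. c * t powr (- real CARD('n) / 4) \<le> norm_L2 (fourier (u t)))"
proof -
  let ?P = "norm (mean u0 + mean u1)"
  define A where "A = (\<integral>x. norm (u0 x) \<partial>lborel) + (\<integral>x. norm (u1 x) \<partial>lborel)"
  \<comment> \<open>Half of |P_0 + P_1| is guaranteed near the origin; a quarter of it is given up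
    to absorb the fast mode, and exp(-2) is the loss of the slow mode.\<close>
  define \<kappa> where "\<kappa> = exp (-2) * (?P / 4)"
  have \<kappa>: "0 < \<kappa>" using P by (simp add: \<kappa>_def)
  obtain r where r: "r > 0" "\<And>\<xi>. norm \<xi> < r \<Longrightarrow> log_symbol \<xi> \<le> 1/10 \<Longrightarrow>
    ?P / 2 \<le> norm (fourier_L1 u1 \<xi> - char_root (-1) (log_symbol \<xi>) * fourier_L1 u0 \<xi>)"
    using initial_data_near_zero[OF u0(1) u1(1) P] by blast
  define \<omega> where "\<omega> = unit_ball_vol (real CARD('n))"
  have \<omega>: "0 < \<omega>" by (simp add: \<omega>_def)
  have "((\<lambda>t::real. exp (- t / 2) * A) \<longlongrightarrow> 0) at_top" by real_asymp
  then have evA: "eventually (\<lambda>t. exp (- t / 2) * A < ?P / 4) at_top"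
    using P by (intro order_tendstoD(2)) auto
  have "((\<lambda>t::real. sqrt (1 / t)) \<longlongrightarrow> 0) at_top" by real_asymp
  then have evr: "eventually (\<lambda>t::real. sqrt (1 / t) < r) at_top" using r(1) by (rule order_tendstoD(2))
  have main: "\<forall>\<^sub>F t in at_top. \<kappa> * sqrt \<omega> * t powr (- real CARD('n) / 4) \<le> norm_L2 (fourier (u t))"
    if sol: "is_solution u0 u1 u" for u
    using evA evr eventually_ge_at_top[of "10::real"]
  proof eventually_elim
    case (elim t)
    then have tp: "0 < t" "0 \<le> t" by auto
    have uL: "u t \<in> L2" by (rule solution_L2[OF sol tp(2)])
    \<comment> \<open>The symbol is at most |\<xi>|^2, so on this ball a t \<le> 1 and the slow mode
      has not yet decayed; t \<ge> 10 places the ball in the low regime.\<close>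
    let ?B = "cball (0::real^'n) (sqrt (1 / t))"
    have pw: "AE \<xi> in lborel. \<kappa>\<^sup>2 * indicator ?B \<xi> \<le> (norm (fourier (u t) \<xi>))\<^sup>2"
      using solution_formula[OF sol u0(2) u1(2) tp(2)] fourier_eq_fourier_L1[OF u0] fourier_eq_fourier_L1[OF u1]
    proof eventually_elim
      case (elim \<xi>)
      let ?a = "log_symbol \<xi>" and ?v = "fourier (u t) \<xi>" and ?f = "fourier u0 \<xi>" and ?g = "fourier u1 \<xi>"
      show ?case
      proof (cases "\<xi> \<in> ?B")
        case True
        then have n: "norm \<xi> \<le> sqrt (1 / t)" by simp
        then have "(norm \<xi>)\<^sup>2 \<le> (sqrt (1 / t))\<^sup>2" by (intro power_mono) auto
        then have a: "?a \<le> 1 / t" using log_symbol_le_norm_squared[of \<xi>] tp by simp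
        then have at: "?a * t \<le> 1" using tp by (simp add: field_simps)
        have "1 / t \<le> 1/10" using \<open>10 \<le> t\<close> by (simp add: field_simps)
        then have a10: "?a \<le> 1/10" using a by linarith
        have X: "?P / 2 \<le> norm (?g - char_root (-1) ?a * ?f)"
          unfolding elim(2,3) using n \<open>sqrt (1 / t) < r\<close> by (intro r(2) a10) auto
        have "norm ?f + norm ?g \<le> A" unfolding elim(2,3) A_def by (intro add_mono norm_fourier_L1_le)
        then have "exp (- t / 2) * (norm ?f + norm ?g) \<le> exp (- t / 2) * A" by (intro mult_left_mono) auto
        then have "?P / 4 \<le> norm (?g - char_root (-1) ?a * ?f) - exp (- t / 2) * (norm ?f + norm ?g)"
          using X \<open>exp (- t / 2) * A < ?P / 4\<close> by linarith
        then have "\<kappa> \<le> exp (-2) * (norm (?g - char_root (-1) ?a * ?f) - exp (- t / 2) * (norm ?f + norm ?g))"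
          unfolding \<kappa>_def by (intro mult_left_mono) auto
        also have "\<dots> \<le> norm ?v"
          by (rule low_frequency_lower_bound[OF log_symbol_nonneg a10 tp(2) at]) (use elim(1) in \<open>simp add: Let_def\<close>)
        finally have "\<kappa>\<^sup>2 \<le> (norm ?v)\<^sup>2" using \<kappa> by (intro power_mono) auto
        then show ?thesis using True by simp
      qed simp
    qed
    have "\<kappa>\<^sup>2 * (\<omega> * sqrt (1 / t) ^ CARD('n)) = (\<integral>\<xi>. \<kappa>\<^sup>2 * indicator ?B \<xi> \<partial>lborel)"
      using tp by (simp add: \<omega>_def content_cball)
    also have "\<dots> \<le> (norm_L2 (fourier (u t)))\<^sup>2"
      unfolding norm_L2_squared
      by (rule integral_mono_AE[OF integrable_indicator_cball L2_integrable[OF fourier_L2[OF uL]] pw])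
    finally have "(\<kappa> * sqrt \<omega> * t powr (- real CARD('n) / 4))\<^sup>2 \<le> (norm_L2 (fourier (u t)))\<^sup>2"
      unfolding sqrt_power_eq_powr[OF tp(1)] using \<omega> by (simp add: power_mult_distrib)
    then show ?case by (rule power2_le_imp_le) (rule norm_L2_nonneg)
  qed
  have "0 < \<kappa> * sqrt \<omega>" using \<kappa> \<omega> by simp
  then show ?thesis using main by blast
qed

text \<open>Each mean is bounded by the weighted norm of its function, so a nonzero sum of means
  excludes that both norms vanish. The final constant divides by this quantity.\<close>

lemma I0_pos:
  assumes "mean u0 + mean u1 \<noteq> 0" "u0 \<in> L11" "u1 \<in> L11"
  shows "0 < I0 l u0 u1"
proof (rule ccontr)
  assume "\<not> 0 < I0 l u0 u1"
  then have "(norm_L11 u0)\<^sup>2 + (norm_L11 u1)\<^sup>2 + (norm_Y (l + 1) u0)\<^sup>2 + (norm_Y l u1)\<^sup>2 \<le> 0"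
    by (simp add: I0_def not_less)
  then have "(norm_L11 u0)\<^sup>2 \<le> 0" "(norm_L11 u1)\<^sup>2 \<le> 0"
    using zero_le_power2[of "norm_L11 u0"] zero_le_power2[of "norm_L11 u1"]
      zero_le_power2[of "norm_Y (l + 1) u0"] zero_le_power2[of "norm_Y l u1"] by linarith+
  then have z: "norm_L11 u0 = 0" "norm_L11 u1 = 0" by simp_all
  have le: "norm (mean f) \<le> norm_L11 f" if "f \<in> L11" for f
  proof -
    have "norm (mean f) \<le> (\<integral>x. norm (f x) \<partial>lborel)" unfolding mean_def by (rule integral_norm_bound)
    also have "\<dots> \<le> norm_L11 f"
      unfolding norm_L11_def
    proof (rule integral_mono)
      show "integrable lborel (\<lambda>x. norm (f x))" "integrable lborel (\<lambda>x. (1 + norm x) * norm (f x))"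
        using that by (auto simp: L11_def)
      show "norm (f x) \<le> (1 + norm x) * norm (f x)" for x
        using mult_right_mono[of 1 "1 + norm x" "norm (f x)"] by simp
    qed
    finally show ?thesis .
  qed
  have "mean u0 = 0" "mean u1 = 0" using le[OF assms(2)] le[OF assms(3)] z by simp_all
  then show False using assms(1) by simp
qed

theorem theorem1p5:
  fixes u0 u1 :: "real^'n \<Rightarrow> complex"
  assumes "1 \<le> CARD('n)" and "CARD('n) \<le> 3"
    and "u0 \<in> L11 \<inter> Y 2" and "u1 \<in> L11 \<inter> Y 1"
    and "mean u0 + mean u1 \<noteq> 0"
  shows "\<exists>C1>0. \<exists>C2>0. \<forall>u. is_solution u0 u1 u \<longrightarrow>
           (\<forall>\<^sub>F t in at_top.
              C1 * norm (mean u0 + mean u1) * t powr (- real CARD('n) / 4) \<le> norm_L2 (u t) \<and>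
              norm_L2 (u t) \<le> C2 * I0 1 u0 u1 * t powr (- real CARD('n) / 4))"
proof -
  let ?P = "norm (mean u0 + mean u1)" and ?I = "I0 1 u0 u1"
  let ?k = "sqrt ((2 * pi) ^ CARD('n))"
  have u0: "integrable lborel u0" "u0 \<in> Y 2" and u1: "integrable lborel u1" "u1 \<in> Y 1"
    using assms(3,4) by (auto simp: L11_def)
  obtain C where C: "C > 0" "\<And>u t. is_solution u0 u1 u \<Longrightarrow> 1 \<le> t \<Longrightarrow>
    norm_L2 (fourier (u t)) \<le> C * t powr (- real CARD('n) / 4)"
    using solution_upper_bound[OF assms(2) u0 u1] by blast
  obtain c where c: "c > 0" "\<And>u. is_solution u0 u1 u \<Longrightarrow>
    (\<forall>\<^sub>F t in at_top. c * t powr (- real CARD('n) / 4) \<le> norm_L2 (fourier (u t)))"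
    using solution_lower_bound[OF u0(1) Y_imp_L2[OF u0(2)] u1(1) Y_imp_L2[OF u1(2)] assms(5)] by blast
  have I: "0 < ?I" using assms(3,4,5) by (intro I0_pos) auto
  have P: "0 < ?P" using assms(5) by simp
  have k: "0 < ?k" by simp
  \<comment> \<open>The constants may depend on the data, so they absorb |P_0 + P_1| and
    \<open>?I\<close>. The factor \<open>?k\<close> is the Plancherel constant of the transform
    without normalisation.\<close>
  define C1 C2 where "C1 = c / (?k * ?P)" and "C2 = C / (?k * ?I)"
  show ?thesis
  proof (rule exI[of _ C1], intro conjI exI[of _ C2] allI impI)
    show "0 < C1" "0 < C2" unfolding C1_def C2_def using c C I P k by (auto intro!: divide_pos_pos mult_pos_pos)
    fix u assume sol: "is_solution u0 u1 u"
    show "\<forall>\<^sub>F t in at_top. C1 * ?P * t powr (- real CARD('n) / 4) \<le> norm_L2 (u t) \<and>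
      norm_L2 (u t) \<le> C2 * ?I * t powr (- real CARD('n) / 4)"
      using c(2)[OF sol] eventually_ge_at_top[of "1::real"]
    proof eventually_elim
      case (elim t)
      have uL: "u t \<in> L2" using elim by (intro solution_L2[OF sol]) auto
      have n: "norm_L2 (u t) = norm_L2 (fourier (u t)) / ?k" using norm_L2_fourier[OF uL] k by simp
      have "C1 * ?P * t powr (- real CARD('n) / 4) = c * t powr (- real CARD('n) / 4) / ?k"
        using P by (simp add: C1_def)
      also have "\<dots> \<le> norm_L2 (u t)" unfolding n using elim(1) k by (intro divide_right_mono) auto
      finally have 1: "C1 * ?P * t powr (- real CARD('n) / 4) \<le> norm_L2 (u t)" .
      have "norm_L2 (u t) \<le> C * t powr (- real CARD('n) / 4) / ?k"
        unfolding n using C(2)[OF sol elim(2)] k by (intro divide_right_mono) auto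
      also have "\<dots> = C2 * ?I * t powr (- real CARD('n) / 4)" using I by (simp add: C2_def)
      finally show ?case using 1 by blast
    qed
  qed
qed

end
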